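(* Let $\mathscr{P}=G/K$ be one of the non-compact symmetric spaces $\mathscr{P}_n(\mathbb{R})=GL_n(\mathbb{R})/O_n$, $\mathscr{P}_n(\mathbb{C})=GL_n(\mathbb{C})/U_n$, $\mathscr{P}_n(\mathbb{H})=GL_n(\mathbb{H})/Sp_n$, $\mathscr{P}_3(\mathbb{O})=GL_3(\mathbb{O})/F_4$, and let $\mathfrak{g}$ be the Lie algebra of $G$. There exist totally geodesic submanifolds of $\mathscr{P}$ given by $\mathscr{F}=\exp\mathfrak{a}$, where $\mathfrak{a}\subset\mathfrak{g}$ is a Cartan subalgebra.
   Context: $\mathscr{P}_n(\mathbb{K})$ is the open cone of $n\times n$ positive definite symmetric (resp. self-adjoint) matrices over $\mathbb{K}$, equipped with a $G$-invariant Riemannian metric. $GL_3(\mathbb{O})$ denotes the automorphism group of the cone $\mathscr{P}_3(\mathbb{O})$, with Lie algebra $\mathfrak{e}_{6(-26)}\oplus\mathbb{R}$. The Lie algebra has the Cartan decomposition $\mathfrak{g}=\mathfrak{k}\oplus\mathfrak{t}$, $\mathfrak{k}$ the Lie algebra of $K$, with $\mathfrak{t}$ identified with the tangent space of $\mathscr{P}$ at the base point. *)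

theory Defs
  imports "HOL-Analysis.Analysis"
begin

section \<open>The division algebras\<close>

class conjugation = euclidean_space + zero_neq_one +
  fixes conjg :: "'a \<Rightarrow> 'a"
  assumes conjg_add: "conjg (x + y) = conjg x + conjg y"
    and conjg_scaleR: "conjg (r *\<^sub>R x) = r *\<^sub>R conjg x"
    and conjg_conj [simp]: "conjg (conjg x) = x"
    and conjg_one [simp]: "conjg 1 = 1"

lemma conjg_zero [simp]: "conjg (0 :: 'a::conjugation) = 0"
  using conjg_scaleR[of 0 "0 :: 'a"] by simp

lemma conjg_minus: "conjg (- x) = - conjg (x :: 'a::conjugation)"
  using conjg_scaleR[of "- 1" x] by simp

lemma conjg_diff: "conjg (x - y) = conjg x - conjg (y :: 'a::conjugation)"
  using conjg_add[of x "- y"] by (simp add: conjg_minus)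

class comm_conjugation = conjugation + comm_ring_1 +
  assumes conjg_mult: "conjg (x * y) = conjg x * conjg y"

instantiation real :: comm_conjugation
begin
definition conjg_real :: "real \<Rightarrow> real" where "conjg_real x = x"
instance by standard (simp_all add: conjg_real_def)
end

instantiation complex :: comm_conjugation
begin
definition conjg_complex :: "complex \<Rightarrow> complex" where "conjg_complex = cnj"
instance by standard (simp_all add: conjg_complex_def)
end

text \<open>The Cayley--Dickson double: with \<open>j = CD 0 1\<close> the pair \<open>CD a b\<close> stands for \<open>a + b j\<close>.\<close>

datatype 'a cd = CD (cd_fst: 'a) (cd_snd: 'a)

type_synonym quaternion = "complex cd"
type_synonym octonion = "quaternion cd"

instantiation cd :: (real_inner) real_inner
begin

definition zero_cd :: "'a cd" where "0 = CD 0 0"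
definition plus_cd :: "'a cd \<Rightarrow> 'a cd \<Rightarrow> 'a cd" where "x + y = CD (cd_fst x + cd_fst y) (cd_snd x + cd_snd y)"
definition minus_cd :: "'a cd \<Rightarrow> 'a cd \<Rightarrow> 'a cd" where "x - y = CD (cd_fst x - cd_fst y) (cd_snd x - cd_snd y)"
definition uminus_cd :: "'a cd \<Rightarrow> 'a cd" where "- x = CD (- cd_fst x) (- cd_snd x)"
definition scaleR_cd :: "real \<Rightarrow> 'a cd \<Rightarrow> 'a cd" where "r *\<^sub>R x = CD (r *\<^sub>R cd_fst x) (r *\<^sub>R cd_snd x)"
definition inner_cd :: "'a cd \<Rightarrow> 'a cd \<Rightarrow> real" where "inner x y = inner (cd_fst x) (cd_fst y) + inner (cd_snd x) (cd_snd y)"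
definition norm_cd :: "'a cd \<Rightarrow> real" where "norm_cd x = sqrt (inner x x)"
definition sgn_cd :: "'a cd \<Rightarrow> 'a cd" where "sgn_cd x = inverse (norm x) *\<^sub>R x"
definition dist_cd :: "'a cd \<Rightarrow> 'a cd \<Rightarrow> real" where "dist_cd x y = norm (x - y)"
definition [code del]:
  "(uniformity :: ('a cd \<times> 'a cd) filter) = (INF e\<in>{0<..}. principal {(x, y). dist x y < e})"
definition [code del]:
  "open (U :: 'a cd set) \<longleftrightarrow> (\<forall>x\<in>U. eventually (\<lambda>(x', y). x' = x \<longrightarrow> y \<in> U) uniformity)"

instance
proof
  fix x y z :: "'a cd" and r s :: real
  note defs = zero_cd_def plus_cd_def minus_cd_def uminus_cd_def scaleR_cd_def inner_cd_def
  show "x + y + z = x + (y + z)" "x + y = y + x" by (simp_all add: defs add.assoc add.commute)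
  show "0 + x = x" "- x + x = 0" "x - y = x + - y" by (simp_all add: defs)
  show "r *\<^sub>R (x + y) = r *\<^sub>R x + r *\<^sub>R y" "(r + s) *\<^sub>R x = r *\<^sub>R x + s *\<^sub>R x"
    by (simp_all add: defs scaleR_add_right scaleR_add_left)
  show "r *\<^sub>R s *\<^sub>R x = (r * s) *\<^sub>R x" "1 *\<^sub>R x = x" by (simp_all add: defs)
  show "inner x y = inner y x" by (simp add: defs inner_commute)
  show "inner (x + y) z = inner x z + inner y z" by (simp add: defs inner_add_left)
  show "inner (r *\<^sub>R x) y = r * inner x y" by (simp add: defs distrib_left)
  show "0 \<le> inner x x" by (simp add: defs)
  show "inner x x = 0 \<longleftrightarrow> x = 0"
    by (cases x) (simp add: defs add_nonneg_eq_0_iff)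
  show "open U \<longleftrightarrow> (\<forall>x\<in>U. eventually (\<lambda>(x', y). x' = x \<longrightarrow> y \<in> U) uniformity)" for U :: "'a cd set"
    by (rule open_cd_def)
qed (simp_all only: norm_cd_def sgn_cd_def dist_cd_def uniformity_cd_def)

end

instantiation cd :: (euclidean_space) euclidean_space
begin

definition Basis_cd :: "'a cd set" where "Basis = (\<lambda>u. CD u 0) ` Basis \<union> CD 0 ` Basis"

instance
proof
  fix u v :: "'a cd"
  assume "u \<in> Basis" and "v \<in> Basis"
  then show "inner u v = (if u = v then 1 else 0)"
    by (auto simp: Basis_cd_def inner_cd_def inner_Basis split: if_split_asm)
next
  fix x :: "'a cd"
  show "(\<forall>u\<in>Basis. inner x u = 0) \<longleftrightarrow> x = 0"
    by (cases x) (simp add: Basis_cd_def ball_Un inner_cd_def zero_cd_def euclidean_all_zero_iff)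
qed (simp_all add: Basis_cd_def)

end

instantiation cd :: (conjugation) conjugation
begin

definition one_cd :: "'a cd" where "one_cd = CD 1 0"
definition conjg_cd :: "'a cd \<Rightarrow> 'a cd" where "conjg x = CD (conjg (cd_fst x)) (- cd_snd x)"

instance
  by standard
    (simp_all add: zero_cd_def one_cd_def plus_cd_def scaleR_cd_def conjg_cd_def conjg_add conjg_scaleR)

end

instantiation cd :: ("{conjugation, times}") times
begin
definition times_cd :: "'a cd \<Rightarrow> 'a cd \<Rightarrow> 'a cd" where "x * y = CD (cd_fst x * cd_fst y - conjg (cd_snd y) * cd_snd x)
                       (cd_snd y * cd_fst x + cd_snd x * conjg (cd_fst y))"
instance ..
end

instance cd :: (comm_conjugation) ring_1
  by standard
    (simp_all add: zero_cd_def one_cd_def plus_cd_def minus_cd_def uminus_cd_def times_cd_def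
      conjg_add conjg_diff conjg_minus conjg_mult algebra_simps)


section \<open>Self-adjoint matrices\<close>

definition adj :: "'a::conjugation^'n^'m \<Rightarrow> 'a^'m^'n" where
  "adj A = (\<chi> i j. conjg (A $ j $ i))"

lemma adj_add: "adj (A + B) = adj A + adj B"
  by (simp add: adj_def vec_eq_iff conjg_add)

lemma adj_diff: "adj (A - B) = adj A - adj B"
  by (simp add: adj_def vec_eq_iff conjg_diff)

lemma adj_minus: "adj (- A) = - adj A"
  by (simp add: adj_def vec_eq_iff conjg_minus)

lemma adj_scaleR: "adj (r *\<^sub>R A) = r *\<^sub>R adj A"
  by (simp add: adj_def vec_eq_iff conjg_scaleR)

lemma adj_mat_1 [simp]: "adj (mat 1) = mat 1"
  by (auto simp: adj_def mat_def vec_eq_iff)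

typedef (overloaded) ('a::conjugation, 'n::finite) herm = "{A :: 'a^'n^'n. adj A = A}"
  by (rule exI[of _ "mat 1"]) simp

setup_lifting type_definition_herm

text \<open>The inner product inherited from the space of matrices is the trace form
  \<open>Re tr (A B)\<close>.\<close>

instantiation herm :: (conjugation, finite) real_inner
begin

lift_definition zero_herm :: "('a, 'b) herm" is 0
  by (simp add: adj_def vec_eq_iff)
lift_definition plus_herm :: "('a, 'b) herm \<Rightarrow> ('a, 'b) herm \<Rightarrow> ('a, 'b) herm" is "(+)"
  by (simp add: adj_add)
lift_definition minus_herm :: "('a, 'b) herm \<Rightarrow> ('a, 'b) herm \<Rightarrow> ('a, 'b) herm" is "(-)"
  by (simp add: adj_diff)
lift_definition uminus_herm :: "('a, 'b) herm \<Rightarrow> ('a, 'b) herm" is uminus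
  by (simp add: adj_minus)
lift_definition scaleR_herm :: "real \<Rightarrow> ('a, 'b) herm \<Rightarrow> ('a, 'b) herm" is scaleR
  by (simp add: adj_scaleR)
lift_definition inner_herm :: "('a, 'b) herm \<Rightarrow> ('a, 'b) herm \<Rightarrow> real" is inner .
definition norm_herm :: "('a, 'b) herm \<Rightarrow> real" where "norm_herm x = sqrt (inner x x)"
definition sgn_herm :: "('a, 'b) herm \<Rightarrow> ('a, 'b) herm" where "sgn_herm x = inverse (norm x) *\<^sub>R x"
definition dist_herm :: "('a, 'b) herm \<Rightarrow> ('a, 'b) herm \<Rightarrow> real" where "dist_herm x y = norm (x - y)"
definition [code del]:
  "(uniformity :: (('a, 'b) herm \<times> ('a, 'b) herm) filter)
     = (INF e\<in>{0<..}. principal {(x, y). dist x y < e})"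
definition [code del]:
  "open (U :: ('a, 'b) herm set)
     \<longleftrightarrow> (\<forall>x\<in>U. eventually (\<lambda>(x', y). x' = x \<longrightarrow> y \<in> U) uniformity)"

instance
proof
  fix x y z :: "('a, 'b) herm" and r s :: real
  show "x + y + z = x + (y + z)" by transfer (rule add.assoc)
  show "x + y = y + x" by transfer (rule add.commute)
  show "0 + x = x" "- x + x = 0" "x - y = x + - y" by (transfer, simp)+
  show "r *\<^sub>R (x + y) = r *\<^sub>R x + r *\<^sub>R y" by transfer (rule scaleR_add_right)
  show "(r + s) *\<^sub>R x = r *\<^sub>R x + s *\<^sub>R x" by transfer (rule scaleR_add_left)
  show "r *\<^sub>R s *\<^sub>R x = (r * s) *\<^sub>R x" "1 *\<^sub>R x = x" by (transfer, simp)+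
  show "inner x y = inner y x" by transfer (rule inner_commute)
  show "inner (x + y) z = inner x z + inner y z" by transfer (rule inner_add_left)
  show "inner (r *\<^sub>R x) y = r * inner x y" "0 \<le> inner x x" "inner x x = 0 \<longleftrightarrow> x = 0"
    by (transfer, simp)+
  show "open U \<longleftrightarrow> (\<forall>x\<in>U. eventually (\<lambda>(x', y). x' = x \<longrightarrow> y \<in> U) uniformity)"
    for U :: "('a, 'b) herm set"
    by (rule open_herm_def)
qed (simp_all only: norm_herm_def sgn_herm_def dist_herm_def uniformity_herm_def)

end

lemma herm_orthonormal_basis:
  "\<exists>B :: ('a::conjugation, 'n::finite) herm set. B \<noteq> {} \<and> finite B
     \<and> (\<forall>u\<in>B. \<forall>v\<in>B. inner u v = (if u = v then 1 else 0))
     \<and> (\<forall>x. (\<forall>u\<in>B. inner x u = 0) \<longleftrightarrow> x = 0)"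
proof -
  let ?V = "{A :: 'a^'n^'n. adj A = A}"
  have V: "subspace ?V"
    by (simp add: subspace_def adj_add adj_scaleR) (simp add: adj_def vec_eq_iff)
  obtain B where B: "B \<subseteq> ?V" "pairwise orthogonal B" "\<And>x. x \<in> B \<Longrightarrow> norm x = 1"
      "independent B" "card B = dim ?V" "span B = ?V"
    by (rule orthonormal_basis_subspace[OF V]) (assumption | rule that)+
  have fin: "finite B"
    using B(4) by (rule independent_imp_finite)
  have Rep: "Rep_herm (Abs_herm b) = b" if "b \<in> B" for b
    using that B(1) by (intro Abs_herm_inverse) auto
  have ortho: "inner b c = (if b = c then 1 else 0)" if "b \<in> B" "c \<in> B" for b c
  proof (cases "b = c")
    case True
    then show ?thesis using B(3)[OF that(1)] by (simp add: norm_eq_1)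
  next
    case False
    then show ?thesis using pairwiseD[OF B(2) that] by (simp add: orthogonal_def)
  qed
  have zero: "A = 0" if "A \<in> ?V" "\<And>b. b \<in> B \<Longrightarrow> inner A b = 0" for A
  proof -
    have "A \<in> span B" using that(1) B(6) by simp
    then have "orthogonal A A"
      by (rule orthogonal_to_span) (simp add: orthogonal_def that(2))
    then show ?thesis by (simp add: orthogonal_def)
  qed
  have ne: "B \<noteq> {}"
  proof
    assume "B = {}"
    moreover have "mat 1 \<in> ?V" by simp
    ultimately have "mat 1 \<in> span ({} :: ('a^'n^'n) set)" using B(6) by blast
    then have "mat 1 = (0 :: 'a^'n^'n)" by simp
    then have "mat 1 $ i $ i = (0 :: 'a)" for i :: 'n by simp
    then show False by (simp add: mat_def)
  qed
  let ?B = "Abs_herm ` B"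
  have ne': "?B \<noteq> {}" and fin': "finite ?B"
    using ne fin by simp_all
  have ortho': "\<forall>u\<in>?B. \<forall>v\<in>?B. inner u v = (if u = v then 1 else 0)"
  proof (intro ballI)
    fix u v assume "u \<in> ?B" "v \<in> ?B"
    then obtain b c where b: "b \<in> B" "u = Abs_herm b" and c: "c \<in> B" "v = Abs_herm c"
      by blast
    have "u = v \<longleftrightarrow> b = c"
      by (metis b c Rep)
    moreover have "inner u v = inner b c"
      using Rep[OF b(1)] Rep[OF c(1)] b(2) c(2) by (simp add: inner_herm.rep_eq)
    ultimately show "inner u v = (if u = v then 1 else 0)"
      using ortho[OF b(1) c(1)] by presburger
  qed
  have zero': "\<forall>x. (\<forall>u\<in>?B. inner x u = 0) \<longleftrightarrow> x = 0"
  proof (intro allI iffI)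
    fix x assume x: "\<forall>u\<in>?B. inner x u = 0"
    have "inner (Rep_herm x) b = 0" if "b \<in> B" for b
      using bspec[OF x imageI[OF that]] Rep[OF that] by (simp add: inner_herm.rep_eq)
    then have "Rep_herm x = 0"
      by (rule zero[OF Rep_herm])
    then show "x = 0"
      by (metis Rep_herm_inject zero_herm.rep_eq)
  next
    fix x assume "x = (0 :: ('a, 'n) herm)"
    then show "\<forall>u\<in>?B. inner x u = 0" by simp
  qed
  show ?thesis
    by (rule exI[of _ ?B]) (intro conjI ne' fin' ortho' zero')
qed

instantiation herm :: (conjugation, finite) euclidean_space
begin

definition Basis_herm :: "('a, 'b) herm set" where
  "Basis_herm = (SOME B. B \<noteq> {} \<and> finite B
     \<and> (\<forall>u\<in>B. \<forall>v\<in>B. inner u v = (if u = v then 1 else 0))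
     \<and> (\<forall>x. (\<forall>u\<in>B. inner x u = 0) \<longleftrightarrow> x = 0))"

instance
proof
  have basis: "(Basis :: ('a, 'b) herm set) \<noteq> {} \<and> finite (Basis :: ('a, 'b) herm set)
     \<and> (\<forall>u\<in>Basis. \<forall>v\<in>Basis. inner u v = (if u = (v :: ('a, 'b) herm) then 1 else 0))
     \<and> (\<forall>x :: ('a, 'b) herm. (\<forall>u\<in>Basis. inner x u = 0) \<longleftrightarrow> x = 0)"
    unfolding Basis_herm_def by (rule someI_ex[OF herm_orthonormal_basis])
  show "(Basis :: ('a, 'b) herm set) \<noteq> {}"
    by (rule basis[THEN conjunct1])
  show "finite (Basis :: ('a, 'b) herm set)"
    by (rule basis[THEN conjunct2, THEN conjunct1])
  show "inner u v = (if u = v then 1 else 0)" if "u \<in> Basis" "v \<in> Basis"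
    for u v :: "('a, 'b) herm"
    by (rule basis[THEN conjunct2, THEN conjunct2, THEN conjunct1, THEN bspec, THEN bspec, OF that])
  show "(\<forall>u\<in>Basis. inner x u = 0) \<longleftrightarrow> x = 0" for x :: "('a, 'b) herm"
    by (rule basis[THEN conjunct2, THEN conjunct2, THEN conjunct2, THEN spec])
qed

end


section \<open>Homogeneous cones and their Lie algebras\<close>

text \<open>
  A linear group \<open>grp\<close> inside an associative real algebra with product \<open>gmul\<close>, unit \<open>gone\<close> and
  adjoint \<open>gstar\<close>, acting on an open cone \<open>cone\<close> with base point \<open>base\<close>.  The symmetric space
  is \<open>G / K\<close>, with \<open>K\<close> the stabiliser of \<open>base\<close>, identified with \<open>cone\<close> through
  \<open>g K \<mapsto> act g base\<close>.
\<close>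

record ('g, 'v) cone_space =
  gmul :: "'g \<Rightarrow> 'g \<Rightarrow> 'g"
  gone :: 'g
  gstar :: "'g \<Rightarrow> 'g"
  grp :: "'g set"
  act :: "'g \<Rightarrow> 'v \<Rightarrow> 'v"
  cone :: "'v set"
  base :: 'v

definition gexp :: "('g::real_normed_vector, 'v) cone_space \<Rightarrow> 'g \<Rightarrow> 'g" where
  "gexp S X = (\<Sum>n. (1 / fact n) *\<^sub>R (gmul S X ^^ n) (gone S))"

definition bracket :: "('g::real_normed_vector, 'v) cone_space \<Rightarrow> 'g \<Rightarrow> 'g \<Rightarrow> 'g" where
  "bracket S X Y = gmul S X Y - gmul S Y X"

definition lie_algebra :: "('g::real_normed_vector, 'v) cone_space \<Rightarrow> 'g set" where
  "lie_algebra S = {X. \<forall>t::real. gexp S (t *\<^sub>R X) \<in> grp S}"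

text \<open>
  The summand \<open>\<tt>\<close> of the Cartan decomposition \<open>\<gg> = \<kk> \<oplus> \<tt>\<close>: the \<open>-1\<close>-eigenspace of the
  Cartan involution \<open>X \<mapsto> - gstar X\<close>, whose \<open>+1\<close>-eigenspace \<open>\<kk>\<close> is the Lie algebra of
  the stabiliser of \<open>base\<close>.
\<close>

definition cartan_t :: "('g::real_normed_vector, 'v) cone_space \<Rightarrow> 'g set" where
  "cartan_t S = {X \<in> lie_algebra S. gstar S X = X}"

fun lower_central :: "('g::real_normed_vector, 'v) cone_space \<Rightarrow> 'g set \<Rightarrow> nat \<Rightarrow> 'g set" where
  "lower_central S \<hh> 0 = \<hh>"
| "lower_central S \<hh> (Suc n) = span {bracket S X Y | X Y. X \<in> \<hh> \<and> Y \<in> lower_central S \<hh> n}"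

definition cartan_subalgebra :: "('g::real_normed_vector, 'v) cone_space \<Rightarrow> 'g set \<Rightarrow> bool" where
  "cartan_subalgebra S \<hh> \<longleftrightarrow>
     subspace \<hh> \<and> \<hh> \<subseteq> lie_algebra S
     \<and> (\<forall>X\<in>\<hh>. \<forall>Y\<in>\<hh>. bracket S X Y \<in> \<hh>)
     \<and> (\<exists>n. lower_central S \<hh> n = {0})
     \<and> (\<forall>X\<in>lie_algebra S. (\<forall>Y\<in>\<hh>. bracket S X Y \<in> \<hh>) \<longrightarrow> X \<in> \<hh>)"

definition abelian_subspace :: "('g::real_normed_vector, 'v) cone_space \<Rightarrow> 'g set \<Rightarrow> bool" where
  "abelian_subspace S \<aa> \<longleftrightarrow>
     subspace \<aa> \<and> \<aa> \<subseteq> cartan_t S \<and> (\<forall>X\<in>\<aa>. \<forall>Y\<in>\<aa>. bracket S X Y = 0)"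

definition maximal_abelian_subspace :: "('g::real_normed_vector, 'v) cone_space \<Rightarrow> 'g set \<Rightarrow> bool" where
  "maximal_abelian_subspace S \<aa> \<longleftrightarrow>
     abelian_subspace S \<aa> \<and> (\<forall>\<bb>. abelian_subspace S \<bb> \<and> \<aa> \<subseteq> \<bb> \<longrightarrow> \<bb> = \<aa>)"

text \<open>The image of \<open>exp \<hh>\<close> in \<open>G / K\<close>.\<close>

definition exp_orbit :: "('g::real_normed_vector, 'v) cone_space \<Rightarrow> 'g set \<Rightarrow> 'v set" where
  "exp_orbit S \<hh> = {act S (gexp S X) (base S) | X. X \<in> \<hh>}"

text \<open>
  A Cartan subalgebra of \<open>\<gg>\<close> in the sense of Lie algebras need not lie in \<open>\<tt>\<close> (over the complex numbers,
  for instance, it contains \<open>\<i>\<close> times the identity), whereas for symmetric spaces the name is used for a maximal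
  abelian subspace of \<open>\<tt>\<close>.  Both meanings are imposed: \<open>\<hh>\<close> is a Cartan subalgebra of \<open>\<gg>\<close>, its
  part in \<open>\<tt>\<close> is a maximal abelian subspace, and the two have the same exponential image in \<open>G / K\<close>.
\<close>

definition adapted_cartan_subalgebra :: "('g::real_normed_vector, 'v) cone_space \<Rightarrow> 'g set \<Rightarrow> bool" where
  "adapted_cartan_subalgebra S \<hh> \<longleftrightarrow>
     cartan_subalgebra S \<hh>
     \<and> maximal_abelian_subspace S (\<hh> \<inter> cartan_t S)
     \<and> exp_orbit S \<hh> = exp_orbit S (\<hh> \<inter> cartan_t S)"


section \<open>The cones of positive definite matrices\<close>

definition posdef :: "('a::{conjugation, ring_1}, 'n::finite) herm set" where
  "posdef = {A. \<forall>x::'a^'n. x \<noteq> 0 \<longrightarrow> inner x (Rep_herm A *v x) > 0}"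

definition matrix_space :: "('a::{conjugation, ring_1}^'n^'n, ('a, 'n::finite) herm) cone_space" where
  "matrix_space =
     \<lparr> gmul = (**), gone = mat 1, gstar = adj, grp = {g. invertible g},
       act = (\<lambda>g A. Abs_herm (g ** Rep_herm A ** adj g)),
       cone = posdef, base = Abs_herm (mat 1) \<rparr>"

text \<open>Multiplication of octonions is not associative, so the library product \<open>**\<close> is unavailable.\<close>

definition jordan :: "(octonion, 3) herm \<Rightarrow> (octonion, 3) herm \<Rightarrow> (octonion, 3) herm" where
  "jordan A B = Abs_herm (\<chi> i j. (1 / 2) *\<^sub>R
     (\<Sum>k\<in>UNIV. Rep_herm A $ i $ k * Rep_herm B $ k $ j + Rep_herm B $ i $ k * Rep_herm A $ k $ j))"

text \<open>
  Over the octonions the form \<open>x \<mapsto> Re (x\<^sup>* (A x))\<close> on column vectors defines too small a cone.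
  Positive definiteness is that of the multiplication operator of \<open>A\<close> in the Euclidean Jordan
  algebra of self-adjoint matrices, which gives the symmetric cone, i.e. the interior of the
  set of squares (Faraut--Koranyi, Analysis on Symmetric Cones, Theorem III.2.1).
\<close>

definition posdef_oct :: "(octonion, 3) herm set" where
  "posdef_oct = {A. \<forall>Y. Y \<noteq> 0 \<longrightarrow> inner Y (jordan A Y) > 0}"

definition octonion_space ::
  "((octonion, 3) herm \<Rightarrow>\<^sub>L (octonion, 3) herm, (octonion, 3) herm) cone_space" where
  "octonion_space =
     \<lparr> gmul = (o\<^sub>L), gone = id_blinfun, gstar = (\<lambda>g. Blinfun (adjoint (blinfun_apply g))),
       grp = {g. bij (blinfun_apply g) \<and> blinfun_apply g ` posdef_oct = posdef_oct},
       act = blinfun_apply, cone = posdef_oct, base = Abs_herm (mat 1) \<rparr>"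


section \<open>Riemannian geometry of open subsets of Euclidean space\<close>

text \<open>The set \<open>U\<close> is meant to be open here.\<close>

primrec ck_on :: "nat \<Rightarrow> 'a::euclidean_space set \<Rightarrow> ('a \<Rightarrow> 'b::real_normed_vector) \<Rightarrow> bool" where
  "ck_on 0 U f \<longleftrightarrow> continuous_on U f"
| "ck_on (Suc k) U f \<longleftrightarrow>
     (\<forall>x\<in>U. f differentiable (at x)) \<and> (\<forall>v. ck_on k U (\<lambda>x. frechet_derivative f (at x) v))"

definition smooth_on :: "'a::euclidean_space set \<Rightarrow> ('a \<Rightarrow> 'b::real_normed_vector) \<Rightarrow> bool" where
  "smooth_on U f \<longleftrightarrow> (\<forall>k. ck_on k U f)"

definition riemannian_metric ::
  "'v::euclidean_space set \<Rightarrow> ('v \<Rightarrow> 'v \<Rightarrow> 'v \<Rightarrow> real) \<Rightarrow> bool" where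
  "riemannian_metric P m \<longleftrightarrow>
     (\<forall>p\<in>P. bilinear (m p) \<and> (\<forall>u v. m p u v = m p v u) \<and> (\<forall>v. v \<noteq> 0 \<longrightarrow> m p v v > 0))
     \<and> (\<forall>u v. smooth_on P (\<lambda>p. m p u v))"

definition invariant_metric ::
  "('g, 'v::euclidean_space) cone_space \<Rightarrow> ('v \<Rightarrow> 'v \<Rightarrow> 'v \<Rightarrow> real) \<Rightarrow> bool" where
  "invariant_metric S m \<longleftrightarrow>
     riemannian_metric (cone S) m
     \<and> (\<forall>g\<in>grp S. \<forall>p\<in>cone S. \<forall>u v. m (act S g p) (act S g u) (act S g v) = m p u v)"

text \<open>
  The Levi-Civita connection: the covariant derivative at \<open>p\<close>, in direction \<open>u\<close>, of the constant
  vector field \<open>v\<close>, as given by the Koszul formula.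
\<close>

definition christoffel ::
  "('v::euclidean_space \<Rightarrow> 'v \<Rightarrow> 'v \<Rightarrow> real) \<Rightarrow> 'v \<Rightarrow> 'v \<Rightarrow> 'v \<Rightarrow> 'v" where
  "christoffel m p u v = (THE w. \<forall>z. 2 * m p w z =
       frechet_derivative (\<lambda>q. m q v z) (at p) u
     + frechet_derivative (\<lambda>q. m q u z) (at p) v
     - frechet_derivative (\<lambda>q. m q u v) (at p) z)"

definition geodesic_on ::
  "'v::euclidean_space set \<Rightarrow> ('v \<Rightarrow> 'v \<Rightarrow> 'v \<Rightarrow> real) \<Rightarrow> real set \<Rightarrow> (real \<Rightarrow> 'v) \<Rightarrow> bool" where
  "geodesic_on P m I c \<longleftrightarrow> (\<exists>c'. \<forall>t\<in>I. c t \<in> P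
     \<and> (c has_vector_derivative c' t) (at t)
     \<and> (c' has_vector_derivative - christoffel m (c t) (c' t) (c' t)) (at t))"

text \<open>
  Local parametrisations of dimension \<open>d\<close> are smooth maps on an open set, restricted to a
  \<open>d\<close>-dimensional linear subspace \<open>T\<close>.
\<close>

definition embedded_submanifold :: "nat \<Rightarrow> 'v::euclidean_space set \<Rightarrow> bool" where
  "embedded_submanifold d M \<longleftrightarrow> (\<forall>p\<in>M. \<exists>U W T. \<exists>\<phi> :: 'v \<Rightarrow> 'v. \<exists>\<psi>.
     open U \<and> p \<in> U \<and> open W \<and> subspace T \<and> dim T = d
     \<and> smooth_on W \<phi> \<and> (\<forall>x\<in>W \<inter> T. inj_on (frechet_derivative \<phi> (at x)) T)
     \<and> homeomorphism (W \<inter> T) (U \<inter> M) \<phi> \<psi>)"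

definition tangent_space :: "'v::euclidean_space set \<Rightarrow> 'v \<Rightarrow> 'v set" where
  "tangent_space M p = {v. \<exists>c. \<exists>e>0. smooth_on {-e<..<e} c \<and> c ` {-e<..<e} \<subseteq> M
     \<and> c 0 = p \<and> (c has_vector_derivative v) (at 0)}"

definition totally_geodesic ::
  "'v::euclidean_space set \<Rightarrow> ('v \<Rightarrow> 'v \<Rightarrow> 'v \<Rightarrow> real) \<Rightarrow> 'v set \<Rightarrow> bool" where
  "totally_geodesic P m M \<longleftrightarrow> (\<forall>c e. e > 0 \<and> geodesic_on P m {-e<..<e} c \<and> c 0 \<in> M
       \<and> vector_derivative c (at 0) \<in> tangent_space M (c 0)
     \<longrightarrow> (\<exists>\<delta>>0. \<delta> \<le> e \<and> c ` {-\<delta><..<\<delta>} \<subseteq> M))"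

definition totally_geodesic_submanifold ::
  "'v::euclidean_space set \<Rightarrow> ('v \<Rightarrow> 'v \<Rightarrow> 'v \<Rightarrow> real) \<Rightarrow> 'v set \<Rightarrow> bool" where
  "totally_geodesic_submanifold P m M \<longleftrightarrow>
     M \<subseteq> P \<and> (\<exists>d. embedded_submanifold d M) \<and> totally_geodesic P m M"

end

theory Submission
  imports Defs
begin

text \<open>
  In each case the submanifold consists of the diagonal matrices with positive real entries, which is
  the fixed point set in the cone of the sign changes of the coordinates.  These are isometries of every invariant metric,
  so by uniqueness of geodesics a geodesic that is tangent to the fixed point set stays in it.

  For the octonions the Lie algebra is controlled through the faces of the cone: if \<open>A\<close> and \<open>B\<close>
  are nonnegative and orthogonal, then differentiating \<open>inner (exp (t X) A) B \<ge> 0\<close> at \<open>t = 0\<close> gives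
  \<open>inner (X A) B = 0\<close>.  Applied to matrices \<open>u u\<^sup>*\<close>, this determines the diagonal form of \<open>X\<close> on
  the off-diagonal Peirce spaces and yields infinitesimal triality.
\<close>

section \<open>Locally Lipschitz functions\<close>

text \<open>The octonionic group has no matrix model here, and its Lie algebra is never computed.
  Membership in \<open>lie_algebra\<close> is weakened to the linear condition
  \<open>face_preserving\<close>; bracketing with one operator that has six distinct eigenvalues
  then makes an element block diagonal. What survives are three scalings and four phases: 3 + 4 = 7
  is the rank of e_6 plus the centre. Only the scalings are symmetric, so they form the maximal
  abelian subspace. It is not self-normalising, because its centraliser contains the Lie algebra of
  Spin(8); the Cartan subalgebra therefore also has to contain a maximal torus of Spin(8), chosen to
  act diagonally on the four complex coordinates of an octonion. Its phases fix the base point and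
  leave the orbit unchanged.

  The associative cases share one argument, whose parameter is a self-normalising commutative
  subspace of the coefficients.

  Uniqueness of geodesics needs a locally Lipschitz connection. The connection is given only
  implicitly by the Koszul formula, so the estimate comes from that formula and the positivity of
  the metric instead of an inverse Gram matrix.\<close>

lemma isCont_tendsto_nhds: "isCont f x \<Longrightarrow> (f \<longlongrightarrow> f x) (nhds x)"
  by (simp add: isCont_def tendsto_at_iff_tendsto_nhds)

text \<open>A single filter on pairs lets estimates be combined by \<open>eventually\<close>
  reasoning. The bound on the values accompanies the Lipschitz estimate because the product rule
  consumes it.\<close>

definition lip_near :: "'a::metric_space \<Rightarrow> ('a \<Rightarrow> 'b::real_normed_vector) \<Rightarrow> bool" where
  "lip_near x f \<longleftrightarrow> (\<exists>L. \<forall>\<^sub>F z in nhds (x, x).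
     norm (f (fst z) - f (snd z)) \<le> L * dist (fst z) (snd z) \<and> norm (f (fst z)) \<le> L \<and> norm (f (snd z)) \<le> L)"

lemma eventually_nhds_pair:
  assumes "\<forall>\<^sub>F y in nhds x. Q y"
  shows "\<forall>\<^sub>F z in nhds (x, x). Q (fst z) \<and> Q (snd z)"
  unfolding nhds_prod eventually_prod_filter using assms by (intro exI[of _ Q]) auto

lemma lip_near_cong:
  assumes "lip_near x f" "\<forall>\<^sub>F y in nhds x. f y = g y"
  shows "lip_near x g"
proof -
  obtain L where "\<forall>\<^sub>F z in nhds (x, x). norm (f (fst z) - f (snd z)) \<le> L * dist (fst z) (snd z)
      \<and> norm (f (fst z)) \<le> L \<and> norm (f (snd z)) \<le> L"
    using assms(1) by (auto simp: lip_near_def)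
  with eventually_nhds_pair[OF assms(2)] show ?thesis
    unfolding lip_near_def by (intro exI[of _ L]) (erule (1) eventually_elim2, simp)
qed

lemma lip_near_const: "lip_near x (\<lambda>_. c)"
  unfolding lip_near_def
  by (intro exI[of _ "norm c"] always_eventually) simp

lemma lip_near_add:
  assumes "lip_near x f" "lip_near x g"
  shows "lip_near x (\<lambda>y. f y + g y)"
proof -
  obtain L where L: "\<forall>\<^sub>F z in nhds (x, x). norm (f (fst z) - f (snd z)) \<le> L * dist (fst z) (snd z)
      \<and> norm (f (fst z)) \<le> L \<and> norm (f (snd z)) \<le> L"
    using assms(1) by (auto simp: lip_near_def)
  obtain M where M: "\<forall>\<^sub>F z in nhds (x, x). norm (g (fst z) - g (snd z)) \<le> M * dist (fst z) (snd z)
      \<and> norm (g (fst z)) \<le> M \<and> norm (g (snd z)) \<le> M"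
    using assms(2) by (auto simp: lip_near_def)
  show ?thesis
    unfolding lip_near_def
  proof (intro exI[of _ "L + M"], use L M in eventually_elim, elim conjE, intro conjI)
    fix z assume "norm (f (fst z) - f (snd z)) \<le> L * dist (fst z) (snd z)"
      "norm (g (fst z) - g (snd z)) \<le> M * dist (fst z) (snd z)"
    then show "norm (f (fst z) + g (fst z) - (f (snd z) + g (snd z))) \<le> (L + M) * dist (fst z) (snd z)"
      unfolding add_diff_add distrib_right by (rule norm_add_rule_thm)
  qed (auto intro: norm_add_rule_thm)
qed

lemma lip_near_sum:
  "(\<And>i. i \<in> I \<Longrightarrow> lip_near x (f i)) \<Longrightarrow> lip_near x (\<lambda>y. \<Sum>i\<in>I. f i y)"
  by (induction I rule: infinite_finite_induct) (auto intro: lip_near_const lip_near_add)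

lemma lip_near_bounded_bilinear:
  assumes "bounded_bilinear h" "lip_near x f" "lip_near x g"
  shows "lip_near x (\<lambda>y. h (f y) (g y))"
proof -
  interpret h: bounded_bilinear h by fact
  obtain K where K: "K > 0" "\<And>a b. norm (h a b) \<le> norm a * norm b * K"
    using h.pos_bounded by blast
  obtain L where L: "\<forall>\<^sub>F z in nhds (x, x). norm (f (fst z) - f (snd z)) \<le> L * dist (fst z) (snd z)
      \<and> norm (f (fst z)) \<le> L \<and> norm (f (snd z)) \<le> L"
    using assms(2) by (auto simp: lip_near_def)
  obtain M where M: "\<forall>\<^sub>F z in nhds (x, x). norm (g (fst z) - g (snd z)) \<le> M * dist (fst z) (snd z)
      \<and> norm (g (fst z)) \<le> M \<and> norm (g (snd z)) \<le> M"
    using assms(3) by (auto simp: lip_near_def)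
  have est: "norm (h a b) \<le> A * B * K" if "norm a \<le> A" "norm b \<le> B" for a b A B
    by (rule order.trans[OF K(2)])
      (intro mult_mono that norm_ge_zero order.trans[OF norm_ge_zero that(1)] mult_nonneg_nonneg
        order.trans[OF norm_ge_zero that(2)] less_imp_le[OF K(1)] order.refl)
  \<comment> \<open>One constant has to serve three estimates: the difference needs
    \<open>2 * (L * M * K)\<close>, the values need \<open>L * M * K\<close>, and the sum dominates
    both.\<close>
  have "\<forall>\<^sub>F z in nhds (x, x).
      norm (h (f (fst z)) (g (fst z)) - h (f (snd z)) (g (snd z))) \<le> (2 * (L * M * K) + L * M * K) * dist (fst z) (snd z)
      \<and> norm (h (f (fst z)) (g (fst z))) \<le> 2 * (L * M * K) + L * M * K
      \<and> norm (h (f (snd z)) (g (snd z))) \<le> 2 * (L * M * K) + L * M * K"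
    using L M
  proof eventually_elim
    case (elim z)
    let ?d = "dist (fst z) (snd z)"
    have nn: "L \<ge> 0" "M \<ge> 0"
      using elim norm_ge_zero order.trans by blast+
    then have LMK: "0 \<le> L * M * K" using K(1) by simp
    have eq: "h (f (fst z)) (g (fst z)) - h (f (snd z)) (g (snd z))
        = h (f (fst z)) (g (fst z) - g (snd z)) + h (f (fst z) - f (snd z)) (g (snd z))"
      by (simp add: h.diff_left h.diff_right)
    have "norm (h (f (fst z)) (g (fst z) - g (snd z))) \<le> L * (M * ?d) * K"
      "norm (h (f (fst z) - f (snd z)) (g (snd z))) \<le> (L * ?d) * M * K"
      using elim by (auto intro: est)
    from norm_add_rule_thm[OF this]
    have "norm (h (f (fst z)) (g (fst z)) - h (f (snd z)) (g (snd z))) \<le> 2 * (L * M * K) * ?d"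
      unfolding eq by (simp add: algebra_simps)
    also have "\<dots> \<le> (2 * (L * M * K) + L * M * K) * ?d"
      by (intro mult_right_mono) (use LMK in \<open>simp_all add: mult_ac\<close>)
    finally show ?case
      using est[of "f (fst z)" L "g (fst z)" M] est[of "f (snd z)" L "g (snd z)" M] elim LMK
      by (auto simp: mult_ac)
  qed
  then show ?thesis unfolding lip_near_def by blast
qed

lemma lip_near_compose_linear:
  assumes "bounded_linear h" "lip_near (h x) f"
  shows "lip_near x (\<lambda>y. f (h y))"
proof -
  interpret h: bounded_linear h by fact
  obtain K where K: "K > 0" "\<And>a. norm (h a) \<le> norm a * K"
    using h.pos_bounded by blast
  obtain L where L: "\<forall>\<^sub>F z in nhds (h x, h x). norm (f (fst z) - f (snd z)) \<le> L * dist (fst z) (snd z)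
      \<and> norm (f (fst z)) \<le> L \<and> norm (f (snd z)) \<le> L"
    using assms(2) by (auto simp: lip_near_def)
  have "isCont (\<lambda>z. (h (fst z), h (snd z))) (x, x)"
    by (intro continuous_intros h.isCont)
  then have "filterlim (\<lambda>z. (h (fst z), h (snd z))) (nhds (h x, h x)) (nhds (x, x))"
    by (auto dest: isCont_tendsto_nhds)
  from eventually_compose_filterlim[OF L this]
  have "\<forall>\<^sub>F z in nhds (x, x). norm (f (h (fst z)) - f (h (snd z))) \<le> (L * K + L) * dist (fst z) (snd z)
      \<and> norm (f (h (fst z))) \<le> L * K + L \<and> norm (f (h (snd z))) \<le> L * K + L"
  proof eventually_elim
    case (elim z)
    have nn: "L \<ge> 0" using elim norm_ge_zero order.trans by (metis fst_conv)
    have "L * dist (h (fst z)) (h (snd z)) \<le> L * (dist (fst z) (snd z) * K)"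
      unfolding dist_norm h.diff[symmetric] by (intro mult_left_mono K nn)
    also have "\<dots> \<le> (L * K + L) * dist (fst z) (snd z)"
      using nn by (simp add: algebra_simps)
    finally show ?case using elim nn K(1) by (auto intro: order.trans add_increasing)
  qed
  then show ?thesis unfolding lip_near_def by blast
qed

text \<open>\<open>ck_on\<close> provides continuity of the derivative only in each fixed direction.
  The sum of its norms on a basis is therefore continuous, it dominates the operator norm, and the
  mean value inequality applies on a convex ball.\<close>

lemma lip_near_C1:
  fixes f :: "'a::euclidean_space \<Rightarrow> 'b::real_normed_vector"
  assumes "open U" "x \<in> U" "ck_on (Suc 0) U f"
  shows "lip_near x f"
proof -
  let ?D = "\<lambda>y. frechet_derivative f (at y)"
  have D: "(f has_derivative ?D y) (at y)" if "y \<in> U" for y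
    using assms(3) that by (simp add: frechet_derivative_works)
  have cD: "continuous_on U (\<lambda>y. ?D y v)" for v
    using assms(3) by simp
  let ?B = "\<lambda>y. \<Sum>b\<in>Basis. norm (?D y b)"
  have "continuous_on U ?B" by (intro continuous_intros cD)
  then have "isCont ?B x" using assms(1,2) by (simp add: continuous_on_eq_continuous_at)
  then have "\<forall>\<^sub>F y in nhds x. ?B y < ?B x + 1"
    by (intro order_tendstoD(2)[OF isCont_tendsto_nhds]) auto
  moreover have "isCont f x"
    using D[OF assms(2)] has_derivative_continuous by blast
  then have "\<forall>\<^sub>F y in nhds x. norm (f y) < norm (f x) + 1"
    by (intro order_tendstoD(2)[OF tendsto_norm[OF isCont_tendsto_nhds]]) auto
  moreover have "\<forall>\<^sub>F y in nhds x. y \<in> U" using assms(1,2) by (rule eventually_nhds_in_open)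
  ultimately have "\<forall>\<^sub>F y in nhds x. ?B y < ?B x + 1 \<and> norm (f y) < norm (f x) + 1 \<and> y \<in> U"
    by eventually_elim simp
  then obtain r where r: "r > 0"
      "\<And>y. dist y x < r \<Longrightarrow> ?B y < ?B x + 1 \<and> norm (f y) < norm (f x) + 1 \<and> y \<in> U"
    unfolding eventually_nhds_metric by blast
  have on: "onorm (?D y) \<le> ?B x + 1" if "y \<in> ball x r" for y
  proof (rule onorm_bound)
    have yr: "dist y x < r" using that by (simp add: dist_commute)
    show "0 \<le> ?B x + 1" by (simp add: sum_nonneg add_nonneg_nonneg)
    fix v
    have lin: "linear (?D y)"
      using D[of y] r(2)[OF yr] has_derivative_linear by blast
    have "?D y v = ?D y (\<Sum>b\<in>Basis. (v \<bullet> b) *\<^sub>R b)" by (simp add: euclidean_representation)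
    also have "\<dots> = (\<Sum>b\<in>Basis. (v \<bullet> b) *\<^sub>R ?D y b)"
      by (simp add: linear_sum[OF lin] linear_scale[OF lin])
    also have "norm \<dots> \<le> (\<Sum>b\<in>Basis. norm v * norm (?D y b))"
      by (rule order.trans[OF norm_sum])
        (auto intro!: sum_mono mult_right_mono simp: Basis_le_norm)
    also have "\<dots> = ?B y * norm v" by (simp add: sum_distrib_left mult.commute)
    also have "\<dots> \<le> (?B x + 1) * norm v"
      using r(2)[OF yr] by (intro mult_right_mono) auto
    finally show "norm (?D y v) \<le> (?B x + 1) * norm v" .
  qed
  have lip: "norm (f a - f b) \<le> (?B x + 1) * norm (a - b)" if "a \<in> ball x r" "b \<in> ball x r" for a b
  proof (rule differentiable_bound[of "ball x r"])
    show "(f has_derivative ?D y) (at y within ball x r)" if "y \<in> ball x r" for y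
      using D r(2)[of y] that by (auto simp: dist_commute intro: has_derivative_at_withinI)
  qed (use that on in auto)
  have "\<forall>\<^sub>F y in nhds x. y \<in> ball x r" using r(1) by (intro eventually_nhds_in_open) auto
  from eventually_nhds_pair[OF this]
  have "\<forall>\<^sub>F z in nhds (x, x).
      norm (f (fst z) - f (snd z)) \<le> (?B x + 1 + (norm (f x) + 1)) * dist (fst z) (snd z)
      \<and> norm (f (fst z)) \<le> ?B x + 1 + (norm (f x) + 1) \<and> norm (f (snd z)) \<le> ?B x + 1 + (norm (f x) + 1)"
  proof eventually_elim
    case (elim z)
    have nn: "0 \<le> ?B x" by (simp add: sum_nonneg)
    have "norm (f (fst z) - f (snd z)) \<le> (?B x + 1) * dist (fst z) (snd z)"
      using lip elim by (simp add: dist_norm)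
    also have "\<dots> \<le> (?B x + 1 + (norm (f x) + 1)) * dist (fst z) (snd z)"
      by (intro mult_right_mono) auto
    finally show ?case
      using r(2)[of "fst z"] r(2)[of "snd z"] elim nn by (auto simp: dist_commute)
  qed
  then show ?thesis unfolding lip_near_def by blast
qed

section \<open>Uniqueness for ordinary differential equations\<close>

text \<open>The squared norm of \<open>y\<close>, damped by \<open>exp (- 2 * L * t)\<close>, has
  nonpositive derivative, vanishes at 0 and is nonnegative.\<close>

lemma gronwall_zero_right:
  fixes y :: "real \<Rightarrow> 'a::real_inner"
  assumes d: "\<And>t. 0 \<le> t \<Longrightarrow> t < \<delta> \<Longrightarrow> (y has_vector_derivative y' t) (at t)"
    and b: "\<And>t. 0 \<le> t \<Longrightarrow> t < \<delta> \<Longrightarrow> norm (y' t) \<le> L * norm (y t)"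
    and "y 0 = 0" "0 \<le> t" "t < \<delta>"
  shows "y t = 0"
proof -
  let ?f = "\<lambda>s. exp (- 2 * L * s) * (y s \<bullet> y s)"
  have "?f t \<le> ?f 0"
  proof (rule DERIV_nonpos_imp_nonincreasing[OF \<open>0 \<le> t\<close>])
    fix s assume s: "0 \<le> s" "s \<le> t"
    then have s': "0 \<le> s" "s < \<delta>" using assms by auto
    let ?D = "exp (- 2 * L * s) * (2 * (y s \<bullet> y' s) - 2 * L * (y s \<bullet> y s))"
    have "(?f has_real_derivative ?D) (at s)"
    proof -
      have "((\<lambda>s. y s \<bullet> y s) has_real_derivative (y s \<bullet> y' s + y' s \<bullet> y s)) (at s)"
        using bounded_bilinear.has_vector_derivative[OF bounded_bilinear_inner d[OF s'] d[OF s']]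
        by (simp add: has_real_derivative_iff_has_vector_derivative)
      then show ?thesis
        by (auto intro!: derivative_eq_intros simp: inner_commute algebra_simps)
    qed
    moreover have "y s \<bullet> y' s \<le> L * (y s \<bullet> y s)"
    proof -
      have "y s \<bullet> y' s \<le> norm (y s) * norm (y' s)" by (rule norm_cauchy_schwarz)
      also have "\<dots> \<le> norm (y s) * (L * norm (y s))"
        by (intro mult_left_mono b s') simp
      finally show ?thesis by (simp add: power2_norm_eq_inner[symmetric] power2_eq_square mult.left_commute)
    qed
    then have "?D \<le> 0" by (intro mult_nonneg_nonpos) auto
    ultimately show "\<exists>D. (?f has_real_derivative D) (at s) \<and> D \<le> 0" by blast
  qed
  then have "y t \<bullet> y t \<le> 0"
    using \<open>y 0 = 0\<close> by (simp add: mult_le_0_iff not_le[symmetric])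
  then show ?thesis by (metis inner_eq_zero_iff inner_ge_zero order_antisym)
qed

lemma gronwall_zero:
  fixes y :: "real \<Rightarrow> 'a::real_inner"
  assumes d: "\<And>t. \<bar>t\<bar> < \<delta> \<Longrightarrow> (y has_vector_derivative y' t) (at t)"
    and b: "\<And>t. \<bar>t\<bar> < \<delta> \<Longrightarrow> norm (y' t) \<le> L * norm (y t)"
    and "y 0 = 0" "\<bar>t\<bar> < \<delta>"
  shows "y t = 0"
proof (cases "0 \<le> t")
  case True
  show ?thesis
    by (rule gronwall_zero_right[of \<delta> y y' L]) (use d b assms(3,4) True in \<open>simp_all add: abs_if\<close>)
next
  case False
  \<comment> \<open>Negative times are reached by time reversal.\<close>
  have "(y \<circ> uminus) (- t) = 0"
  proof (rule gronwall_zero_right[of \<delta> _ "\<lambda>s. - y' (- s)" L])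
    fix s assume "0 \<le> s" "s < \<delta>"
    then have s: "\<bar>- s\<bar> < \<delta>" by simp
    show "(y \<circ> uminus has_vector_derivative - y' (- s)) (at s)"
    proof -
      have "(uminus has_vector_derivative - 1) (at s)"
        by (rule has_vector_derivative_minus[OF has_vector_derivative_id, unfolded id_def])
      from vector_diff_chain_at[OF this d[OF s]] show ?thesis by simp
    qed
    show "norm (- y' (- s)) \<le> L * norm ((y \<circ> uminus) s)" using b[OF s] by simp
  qed (use assms(3,4) False in simp_all)
  then show ?thesis by simp
qed

section \<open>Geodesics\<close>

locale riemannian =
  fixes P :: "'v::euclidean_space set" and m :: "'v \<Rightarrow> 'v \<Rightarrow> 'v \<Rightarrow> real"
  assumes open_P: "open P" and metric: "riemannian_metric P m"
begin

lemma bilinear_m: "p \<in> P \<Longrightarrow> bilinear (m p)"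
  and m_sym: "p \<in> P \<Longrightarrow> m p u v = m p v u"
  and m_pos: "p \<in> P \<Longrightarrow> v \<noteq> 0 \<Longrightarrow> m p v v > 0"
  and m_smooth: "smooth_on P (\<lambda>p. m p u v)"
  using metric by (auto simp: riemannian_metric_def)

text \<open>Regularity in the base point is given for fixed vectors only; expanding in a basis turns
  it into statements about all vectors at once.\<close>

lemma m_expand:
  assumes "p \<in> P"
  shows "m p u v = (\<Sum>b\<in>Basis. \<Sum>b'\<in>Basis. (u \<bullet> b) * (v \<bullet> b') * m p b b')"
proof -
  have "m p u v = m p (\<Sum>b\<in>Basis. (u \<bullet> b) *\<^sub>R b) (\<Sum>b\<in>Basis. (v \<bullet> b) *\<^sub>R b)"
    by (simp add: euclidean_representation)
  also have "\<dots> = (\<Sum>b\<in>Basis. \<Sum>b'\<in>Basis. (u \<bullet> b) * (v \<bullet> b') * m p b b')"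
    by (simp add: bilinear_sum[OF bilinear_m[OF assms]] bilinear_lmul[OF bilinear_m[OF assms]]
        bilinear_rmul[OF bilinear_m[OF assms]] sum.cartesian_product mult.assoc mult.left_commute)
  finally show ?thesis .
qed

abbreviation D where "D p u v \<equiv> frechet_derivative (\<lambda>q. m q u v) (at p)"

lemma has_derivative_m: "p \<in> P \<Longrightarrow> ((\<lambda>q. m q u v) has_derivative D p u v) (at p)"
proof -
  assume "p \<in> P"
  moreover have "ck_on (Suc 0) P (\<lambda>p. m p u v)"
    using m_smooth unfolding smooth_on_def by blast
  ultimately show ?thesis
    by (simp add: frechet_derivative_works)
qed

lemma linear_D: "p \<in> P \<Longrightarrow> linear (D p u v)"
  using has_derivative_m has_derivative_linear by blast

lemma D_expand:
  assumes "p \<in> P"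
  shows "D p u v w = (\<Sum>b\<in>Basis. \<Sum>b'\<in>Basis. (u \<bullet> b) * (v \<bullet> b') * D p b b' w)"
proof -
  have "((\<lambda>q. \<Sum>b\<in>Basis. \<Sum>b'\<in>Basis. (u \<bullet> b) * (v \<bullet> b') * m q b b') has_derivative
      (\<lambda>w. \<Sum>b\<in>Basis. \<Sum>b'\<in>Basis. (u \<bullet> b) * (v \<bullet> b') * D p b b' w)) (at p)"
    by (intro has_derivative_sum has_derivative_mult_right has_derivative_m assms)
  then have "((\<lambda>q. m q u v) has_derivative
      (\<lambda>w. \<Sum>b\<in>Basis. \<Sum>b'\<in>Basis. (u \<bullet> b) * (v \<bullet> b') * D p b b' w)) (at p)"
    by (rule has_derivative_transform_within_open[OF _ open_P assms]) (simp add: m_expand[symmetric])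
  then show ?thesis by (rule fun_cong[OF frechet_derivative_at, symmetric])
qed

lemma D_sym: "p \<in> P \<Longrightarrow> D p u v w = D p v u w"
proof -
  assume p: "p \<in> P"
  have "((\<lambda>q. m q u v) has_derivative D p v u) (at p)"
    by (rule has_derivative_transform_within_open[OF has_derivative_m[OF p] open_P p]) (simp add: m_sym)
  then show ?thesis by (rule fun_cong[OF frechet_derivative_at, symmetric])
qed

lemma linear_D_right: "p \<in> P \<Longrightarrow> linear (\<lambda>v. D p u v w)"
proof -
  assume "p \<in> P"
  then have "(\<lambda>v. D p u v w) = (\<lambda>v. \<Sum>b\<in>Basis. \<Sum>b'\<in>Basis. (u \<bullet> b) * (v \<bullet> b') * D p b b' w)"
    by (intro ext D_expand)
  moreover have "linear (\<lambda>v. \<Sum>b\<in>Basis. \<Sum>b'\<in>Basis. (u \<bullet> b) * (v \<bullet> b') * c b b')" for c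
    by (rule linearI)
      (simp_all add: inner_add_left distrib_left distrib_right sum.distrib sum_distrib_left mult_ac)
  ultimately show ?thesis by simp
qed

lemma linear_D_left: "p \<in> P \<Longrightarrow> linear (\<lambda>u. D p u v w)"
proof -
  assume p: "p \<in> P"
  then have "(\<lambda>u. D p u v w) = (\<lambda>u. D p v u w)" by (intro ext D_sym)
  then show ?thesis using linear_D_right[OF p] by simp
qed

definition koszul where "koszul p u v z = D p v z u + D p u z v - D p u v z"

lemma linear_koszul: "p \<in> P \<Longrightarrow> linear (koszul p u v)"
proof -
  assume p: "p \<in> P"
  have "koszul p u v = (\<lambda>z. D p v z u + D p u z v - D p u v z)" by (auto simp: koszul_def)
  moreover have "linear (\<lambda>z. D p v z u + D p u z v - D p u v z)"
    by (rule linear_compose_sub[OF linear_compose_add[OF linear_D_right[OF p] linear_D_right[OF p]] linear_D[OF p]])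
  ultimately show ?thesis by (simp only:)
qed

lemma christoffel_unique:
  assumes "p \<in> P" "\<And>z. 2 * m p w z = koszul p u v z"
  shows "christoffel m p u v = w"
  unfolding christoffel_def koszul_def[symmetric]
proof (rule the_equality)
  show "\<forall>z. 2 * m p w z = koszul p u v z" using assms(2) by blast
  fix w' assume w': "\<forall>z. 2 * m p w' z = koszul p u v z"
  have "m p (w' - w) (w' - w) = m p w' (w' - w) - m p w (w' - w)"
    by (simp add: bilinear_lsub[OF bilinear_m[OF assms(1)]])
  also have "\<dots> = 0" using w'[rule_format, of "w' - w"] assms(2)[of "w' - w"] by simp
  finally show "w' = w" using m_pos[OF assms(1), of "w' - w"] by force
qed

text \<open>This makes the definite description proper: positivity makes the map from
  \<open>w\<close> to its metric coefficients injective, hence onto in finite dimension, so the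
  Koszul functional is represented by a vector.\<close>

lemma christoffel_koszul:
  assumes p: "p \<in> P"
  shows "2 * m p (christoffel m p u v) z = koszul p u v z"
proof -
  let ?A = "\<lambda>w. \<Sum>b\<in>Basis. m p w b *\<^sub>R b"
  note bil = bilinear_m[OF p]
  have linm: "linear (m p w)" "linear (\<lambda>x. m p x w)" for w using bil by (auto simp: bilinear_def)
  have comp: "?A w \<bullet> b = m p w b" if "b \<in> Basis" for w b
    using that by (simp add: inner_sum_left inner_Basis if_distrib cong: if_cong)
  have lin: "linear ?A"
    by (rule linearI) (simp_all add: bilinear_ladd[OF bil] bilinear_lmul[OF bil] scaleR_add_left
        sum.distrib scaleR_right.sum)
  have "inj ?A"
    unfolding linear_injective_0[OF lin]
  proof (intro allI impI)
    fix w assume "?A w = 0"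
    then have "m p w b = 0" if "b \<in> Basis" for b using comp[OF that, of w] by simp
    then have "m p w = (\<lambda>_. 0)"
      by (intro linear_eq_stdbasis linm) (auto simp: linear_iff)
    then show "w = 0" using m_pos[OF p, of w] by (metis less_irrefl)
  qed
  then have "surj ?A" by (rule linear_inj_imp_surj[OF lin])
  from surjD[OF this, of "\<Sum>b\<in>Basis. (koszul p u v b / 2) *\<^sub>R b"]
  obtain w where w: "(\<Sum>b\<in>Basis. (koszul p u v b / 2) *\<^sub>R b) = ?A w" by (rule exE)
  have "(\<lambda>z. 2 * m p w z) = koszul p u v"
  proof (rule linear_eq_stdbasis)
    show "linear (\<lambda>z. 2 * m p w z)"
      using linear_compose_scale_right[OF linm(1), of 2 w] by simp
    fix b :: 'v assume b: "b \<in> Basis"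
    have "m p w b = (\<Sum>b\<in>Basis. (koszul p u v b / 2) *\<^sub>R b) \<bullet> b"
      unfolding w by (rule comp[OF b, symmetric])
    also have "\<dots> = koszul p u v b / 2"
      using b by (simp add: inner_sum_left inner_Basis if_distrib cong: if_cong)
    finally show "2 * m p w b = koszul p u v b" by simp
  qed (rule linear_koszul[OF p])
  then have *: "2 * m p w z = koszul p u v z" for z by (rule fun_cong)
  with christoffel_unique[OF p *] show ?thesis by simp
qed

section \<open>Lipschitz estimates for the metric and its connection\<close>

lemma lip_near_m: "p \<in> P \<Longrightarrow> lip_near p (\<lambda>q. m q u v)"
  using m_smooth open_P unfolding smooth_on_def by (blast intro: lip_near_C1)

lemma lip_near_D: "p \<in> P \<Longrightarrow> lip_near p (\<lambda>q. D q u v w)"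
proof -
  assume p: "p \<in> P"
  have "ck_on (Suc (Suc 0)) P (\<lambda>q. m q u v)" using m_smooth unfolding smooth_on_def by blast
  then have "ck_on (Suc 0) P (\<lambda>q. D q u v w)" by (subst (asm) ck_on.simps) blast
  with open_P p show ?thesis by (rule lip_near_C1)
qed

text \<open>The finitely many estimates on pairs of basis vectors add up to one that is uniform in
  \<open>u\<close> and \<open>v\<close>, as if the metric were an operator-valued function.\<close>

lemma lip_metric:
  assumes "p \<in> P"
  obtains L where "L \<ge> 0" "\<forall>\<^sub>F z in nhds (p, p). \<forall>u v.
     \<bar>m (fst z) u v - m (snd z) u v\<bar> \<le> L * dist (fst z) (snd z) * norm u * norm v"
proof -
  have "\<exists>L. \<forall>\<^sub>F z in nhds (p, p).
    \<bar>m (fst z) (fst c) (snd c) - m (snd z) (fst c) (snd c)\<bar> \<le> L * dist (fst z) (snd z)" for c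
    using lip_near_m[OF assms, of "fst c" "snd c"] unfolding lip_near_def real_norm_def
    by (elim ex_forward eventually_mono) simp
  from choice[OF allI[OF this]] obtain L' where L': "\<forall>c. \<forall>\<^sub>F z in nhds (p, p).
    \<bar>m (fst z) (fst c) (snd c) - m (snd z) (fst c) (snd c)\<bar> \<le> L' c * dist (fst z) (snd z)"
    by (rule exE)
  define L where "L b b' = L' (b, b')" for b b'
  have L: "\<forall>\<^sub>F z in nhds (p, p). \<bar>m (fst z) b b' - m (snd z) b b'\<bar> \<le> L b b' * dist (fst z) (snd z)"
    for b b'
    using L'[rule_format, of "(b, b')"] by (simp add: L_def)
  let ?L = "\<Sum>b\<in>Basis. \<Sum>b'\<in>Basis. \<bar>L b b'\<bar>"
  have "\<forall>\<^sub>F z in nhds (p, p). \<forall>b\<in>Basis. \<forall>b'\<in>Basis.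
    \<bar>m (fst z) b b' - m (snd z) b b'\<bar> \<le> L b b' * dist (fst z) (snd z)"
    using L by (intro eventually_ball_finite ballI finite_Basis)
  moreover have "\<forall>\<^sub>F y in nhds p. y \<in> P" using open_P assms by (rule eventually_nhds_in_open)
  note eventually_nhds_pair[OF this]
  ultimately have "\<forall>\<^sub>F z in nhds (p, p). \<forall>u v.
     \<bar>m (fst z) u v - m (snd z) u v\<bar> \<le> ?L * dist (fst z) (snd z) * norm u * norm v"
  proof (eventually_elim, intro allI)
    fix z u v
    assume z: "\<forall>b\<in>Basis. \<forall>b'\<in>Basis. \<bar>m (fst z) b b' - m (snd z) b b'\<bar> \<le> L b b' * dist (fst z) (snd z)"
      and zP: "fst z \<in> P \<and> snd z \<in> P"
    have "\<bar>m (fst z) u v - m (snd z) u v\<bar> = \<bar>\<Sum>b\<in>Basis. \<Sum>b'\<in>Basis. (u \<bullet> b) * (v \<bullet> b') * (m (fst z) b b' - m (snd z) b b')\<bar>"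
      using zP by (simp add: m_expand[of _ u v] sum_subtractf right_diff_distrib)
    also have "\<dots> \<le> (\<Sum>b\<in>Basis. \<Sum>b'\<in>Basis. \<bar>(u \<bullet> b) * (v \<bullet> b') * (m (fst z) b b' - m (snd z) b b')\<bar>)"
      by (rule order.trans[OF sum_abs], rule sum_mono, rule sum_abs)
    also have "\<dots> \<le> (\<Sum>b\<in>Basis. \<Sum>b'\<in>Basis. norm u * norm v * (\<bar>L b b'\<bar> * dist (fst z) (snd z)))"
    proof (intro sum_mono)
      fix b b' :: 'v assume b: "b \<in> Basis" "b' \<in> Basis"
      have "\<bar>m (fst z) b b' - m (snd z) b b'\<bar> \<le> \<bar>L b b'\<bar> * dist (fst z) (snd z)"
        using z b by (meson abs_ge_self mult_right_mono order.trans zero_le_dist)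
      then show "\<bar>(u \<bullet> b) * (v \<bullet> b') * (m (fst z) b b' - m (snd z) b b')\<bar>
          \<le> norm u * norm v * (\<bar>L b b'\<bar> * dist (fst z) (snd z))"
        unfolding abs_mult by (intro mult_mono Basis_le_norm b) auto
    qed
    also have "\<dots> = ?L * dist (fst z) (snd z) * norm u * norm v"
      by (simp add: sum_distrib_left sum_distrib_right algebra_simps)
    finally show "\<bar>m (fst z) u v - m (snd z) u v\<bar> \<le> ?L * dist (fst z) (snd z) * norm u * norm v" .
  qed
  then show ?thesis by (rule that[rotated]) (simp add: sum_nonneg)
qed

text \<open>At \<open>p\<close> the minimum over the compact unit sphere is a lower bound; close to
  \<open>p\<close> the form changes by at most half of that minimum.\<close>

lemma coercive:
  assumes p: "p \<in> P"
  obtains l where "l > 0" "\<forall>\<^sub>F q in nhds p. \<forall>d. l * (norm d)\<^sup>2 \<le> m q d d"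
proof -
  have "continuous_on (sphere 0 1) (\<lambda>d. \<Sum>b\<in>Basis. \<Sum>b'\<in>Basis. (d \<bullet> b) * (d \<bullet> b') * m p b b')"
    by (intro continuous_intros)
  moreover have "(\<lambda>d. m p d d) = (\<lambda>d. \<Sum>b\<in>Basis. \<Sum>b'\<in>Basis. (d \<bullet> b) * (d \<bullet> b') * m p b b')"
    by (intro ext m_expand p)
  ultimately have "continuous_on (sphere 0 1) (\<lambda>d. m p d d)" by (simp only:)
  then obtain d0 where d0: "d0 \<in> sphere 0 1" "\<And>d. d \<in> sphere 0 1 \<Longrightarrow> m p d0 d0 \<le> m p d d"
    using continuous_attains_inf[of "sphere (0::'v) 1" "\<lambda>d. m p d d"] by auto
  let ?l = "m p d0 d0"
  have l: "?l > 0" using d0(1) by (intro m_pos p) auto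
  have low: "?l * (norm d)\<^sup>2 \<le> m p d d" for d
  proof (cases "d = 0")
    case True then show ?thesis using bilinear_lzero[OF bilinear_m[OF p]] by simp
  next
    case False
    have "?l \<le> m p (d /\<^sub>R norm d) (d /\<^sub>R norm d)" using False by (intro d0(2)) simp
    also have "\<dots> = m p d d / (norm d)\<^sup>2"
      by (simp add: bilinear_lmul[OF bilinear_m[OF p]] bilinear_rmul[OF bilinear_m[OF p]]
          power2_eq_square divide_inverse)
    finally show ?thesis using False by (simp add: field_simps)
  qed
  obtain L where L: "L \<ge> 0" "\<forall>\<^sub>F z in nhds (p, p). \<forall>u v.
     \<bar>m (fst z) u v - m (snd z) u v\<bar> \<le> L * dist (fst z) (snd z) * norm u * norm v"
    using lip_metric[OF p] .
  have "filterlim (\<lambda>q. (q, p)) (nhds (p, p)) (nhds p)"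
    by (intro tendsto_intros filterlim_ident)
  note eventually_compose_filterlim[OF L(2) this]
  \<comment> \<open>This radius makes \<open>L * dist q p\<close> at most \<open>?l / 2\<close>; the
    summand 1 covers the case \<open>L = 0\<close>.\<close>
  moreover have "\<forall>\<^sub>F q in nhds p. dist q p < ?l / (2 * (L + 1))"
    using l L(1) by (intro eventually_nhds_metric[THEN iffD2]) (auto intro!: exI[of _ "?l / (2 * (L + 1))"])
  ultimately have "\<forall>\<^sub>F q in nhds p. \<forall>d. (?l / 2) * (norm d)\<^sup>2 \<le> m q d d"
  proof (eventually_elim, intro allI)
    fix q d assume A: "\<forall>u v. \<bar>m (fst (q, p)) u v - m (snd (q, p)) u v\<bar> \<le> L * dist (fst (q, p)) (snd (q, p)) * norm u * norm v"
      and B: "dist q p < ?l / (2 * (L + 1))"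
    have *: "\<bar>m q d d - m p d d\<bar> \<le> L * dist q p * (norm d)\<^sup>2"
      using A[rule_format, of d d] by (simp add: power2_eq_square algebra_simps)
    have "L * dist q p \<le> (L + 1) * (?l / (2 * (L + 1)))"
      using B L(1) by (intro mult_mono) auto
    moreover have "(L + 1) * (?l / (2 * (L + 1))) = ?l / 2"
      using L(1) by (simp add: divide_simps)
    ultimately have "L * dist q p \<le> ?l / 2" by (simp only:)
    then have "L * dist q p * (norm d)\<^sup>2 \<le> ?l / 2 * (norm d)\<^sup>2"
      by (rule mult_right_mono) simp
    with * show "(?l / 2) * (norm d)\<^sup>2 \<le> m q d d"
      using low[of d] by (simp add: abs_le_iff field_simps)
  qed
  then show ?thesis using l by (intro that[of "?l / 2"]) auto
qed

text \<open>Separates the quadratic dependence on \<open>v\<close> from coefficients that are fixed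
  functions of the base point, so that the Lipschitz rules apply term by term.\<close>

lemma koszul_expand:
  assumes "p \<in> P"
  shows "koszul p v v z = (\<Sum>b\<in>Basis. \<Sum>b'\<in>Basis. (v \<bullet> b) * (v \<bullet> b') *
     (D p b' z b + D p b z b' - D p b b' z))"
proof -
  have A: "D p v z v = (\<Sum>b\<in>Basis. \<Sum>b'\<in>Basis. (v \<bullet> b) * (v \<bullet> b') * D p b z b')"
  proof -
    have "D p v z v = D p (\<Sum>b\<in>Basis. (v \<bullet> b) *\<^sub>R b) z (\<Sum>b\<in>Basis. (v \<bullet> b) *\<^sub>R b)"
      by (simp add: euclidean_representation)
    also have "\<dots> = (\<Sum>b\<in>Basis. \<Sum>b'\<in>Basis. (v \<bullet> b) * (v \<bullet> b') * D p b z b')"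
      by (simp add: linear_sum[OF linear_D[OF assms]] linear_scale[OF linear_D[OF assms]]
          linear_sum[OF linear_D_left[OF assms]] linear_scale[OF linear_D_left[OF assms]]
          sum_distrib_left mult.assoc mult.left_commute)
    finally show ?thesis .
  qed
  have B: "\<dots> = (\<Sum>b\<in>Basis. \<Sum>b'\<in>Basis. (v \<bullet> b) * (v \<bullet> b') * D p b' z b)"
    by (subst sum.swap) (simp add: mult.commute)
  show ?thesis
    unfolding koszul_def by (subst (2) A, subst A[unfolded B], subst D_expand[OF assms])
      (simp add: sum.distrib sum_subtractf algebra_simps)
qed

text \<open>The Christoffel vector solves a linear equation with Lipschitz data: \<open>kv\<close>
  represents the Koszul functional in the ambient inner product and is Lipschitz by expansion, the
  metric is Lipschitz by \<open>lip_metric\<close>, and \<open>coercive\<close> bounds the solution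
  as well as differences of solutions.\<close>

lemma lip_christoffel:
  assumes p: "p \<in> P"
  shows "lip_near (p, v) (\<lambda>a. christoffel m (fst a) (snd a) (snd a))"
proof -
  define kv where "kv a = (\<Sum>b\<in>Basis. koszul (fst a) (snd a) (snd a) b *\<^sub>R b)" for a :: "'v \<times> 'v"
  define g where "g a = christoffel m (fst a) (snd a) (snd a)" for a :: "'v \<times> 'v"
  have evP: "\<forall>\<^sub>F a in nhds (p, v). fst a \<in> P"
    using open_P p unfolding nhds_prod
    by (intro eventually_prod_filter[THEN iffD2] exI[of _ "\<lambda>q. q \<in> P"] exI[of _ "\<lambda>_. True"])
      (auto intro: eventually_nhds_in_open)
  have lipD: "lip_near (p, v) (\<lambda>a. D (fst a) b b' b'')" for b b' b''
    using lip_near_compose_linear[OF bounded_linear_fst, of "(p, v)" "\<lambda>q. D q b b' b''"] lip_near_D[OF p]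
    by (simp only: fst_conv)
  have lipv: "lip_near (p, v) (\<lambda>a. snd a \<bullet> b)" for b
  proof (rule lip_near_compose_linear[OF bounded_linear_snd, of "(p, v)" "\<lambda>w. w \<bullet> b"])
    have "ck_on (Suc 0) UNIV (\<lambda>w::'v. w \<bullet> b)"
    proof -
      have d: "((\<lambda>w. w \<bullet> b) has_derivative (\<lambda>w. w \<bullet> b)) (at x)" for x
        by (rule bounded_linear.has_derivative[OF bounded_linear_inner_left has_derivative_ident])
      from frechet_derivative_at[OF this, symmetric] d show ?thesis
        by (auto simp: differentiable_def)
    qed
    then show "lip_near (snd (p, v)) (\<lambda>w. w \<bullet> b)" by (rule lip_near_C1[OF open_UNIV UNIV_I])
  qed
  have neg: "lip_near x (\<lambda>a. f a - h a)" if "lip_near x f" "lip_near x h" for x and f h :: "'v \<times> 'v \<Rightarrow> real"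
    using lip_near_add[OF that(1) lip_near_bounded_bilinear[OF bounded_bilinear_mult lip_near_const[of x "-1"] that(2)]]
    by simp
  have "lip_near (p, v) (\<lambda>a. \<Sum>c\<in>Basis. (\<Sum>b\<in>Basis. \<Sum>b'\<in>Basis. (snd a \<bullet> b) * (snd a \<bullet> b') *
     (D (fst a) b' c b + D (fst a) b c b' - D (fst a) b b' c)) *\<^sub>R c)"
    by (intro lip_near_sum lip_near_bounded_bilinear[OF bounded_bilinear_scaleR] lip_near_const
        lip_near_bounded_bilinear[OF bounded_bilinear_mult] lipD lipv neg lip_near_add)
  then have "lip_near (p, v) kv"
    by (rule lip_near_cong) (use evP in \<open>eventually_elim, simp add: kv_def koszul_expand\<close>)
  then obtain K where K: "\<forall>\<^sub>F z in nhds ((p, v), (p, v)). norm (kv (fst z) - kv (snd z)) \<le> K * dist (fst z) (snd z)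
      \<and> norm (kv (fst z)) \<le> K \<and> norm (kv (snd z)) \<le> K"
    by (auto simp: lip_near_def)
  obtain L where L: "L \<ge> 0" "\<forall>\<^sub>F z in nhds (p, p). \<forall>u v.
     \<bar>m (fst z) u v - m (snd z) u v\<bar> \<le> L * dist (fst z) (snd z) * norm u * norm v"
    using lip_metric[OF p] .
  obtain l where l: "l > 0" "\<forall>\<^sub>F q in nhds p. \<forall>d. l * (norm d)\<^sup>2 \<le> m q d d"
    using coercive[OF p] .
  have lim: "filterlim (\<lambda>z. (fst (fst z), fst (snd z))) (nhds (p, p)) (nhds ((p, v), (p, v)))"
    by (rule tendsto_eq_intros filterlim_ident | simp)+
  have lim1: "filterlim fst (nhds p) (nhds (p, v))"
    by (rule tendsto_eq_intros filterlim_ident | simp)+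
  have eqg: "2 * m (fst a) (g a) z = kv a \<bullet> z" if "fst a \<in> P" for a z
  proof -
    have "kv a \<bullet> z = (\<Sum>b\<in>Basis. (z \<bullet> b) * koszul (fst a) (snd a) (snd a) b)"
      by (simp add: kv_def inner_sum_left inner_commute[of z] mult.commute)
    also have "\<dots> = koszul (fst a) (snd a) (snd a) (\<Sum>b\<in>Basis. (z \<bullet> b) *\<^sub>R b)"
      by (simp add: linear_sum[OF linear_koszul[OF that]] linear_scale[OF linear_koszul[OF that]])
    finally show ?thesis
      using christoffel_koszul[OF that] by (simp add: g_def euclidean_representation)
  qed
  \<comment> \<open>\<open>?G\<close> bounds the values, obtained by testing the defining equation
    with the solution itself; \<open>?L\<close> is the Lipschitz constant.\<close>
  let ?G = "K / (2 * l)" and ?L = "(K / 2 + L * (K / (2 * l))) / l"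
  have "\<forall>\<^sub>F z in nhds ((p, v), (p, v)). norm (g (fst z) - g (snd z)) \<le> (?L + ?G) * dist (fst z) (snd z)
      \<and> norm (g (fst z)) \<le> ?L + ?G \<and> norm (g (snd z)) \<le> ?L + ?G"
    using K eventually_compose_filterlim[OF L(2) lim] eventually_nhds_pair[OF evP]
      eventually_nhds_pair[OF eventually_compose_filterlim[OF l(2) lim1]]
  proof eventually_elim
    case (elim z)
    obtain a b where z: "z = (a, b)" by (cases z)
    have P: "fst a \<in> P" "fst b \<in> P" using elim z by auto
    have Knn: "0 \<le> K" using elim norm_ge_zero order.trans by blast
    have bd: "norm (g c) \<le> ?G" if c: "c = a \<or> c = b" for c
    proof (cases "g c = 0")
      case False
      have "2 * (l * (norm (g c))\<^sup>2) \<le> 2 * m (fst c) (g c) (g c)" using elim z c by auto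
      also have "\<dots> = kv c \<bullet> g c" using eqg P c by blast
      also have "\<dots> \<le> norm (kv c) * norm (g c)" by (rule norm_cauchy_schwarz)
      also have "\<dots> \<le> K * norm (g c)" using elim z c by (intro mult_right_mono) auto
      finally have "2 * l * norm (g c) \<le> K" using False by (simp add: power2_eq_square)
      then show ?thesis using l(1) by (simp add: field_simps)
    qed (use Knn l(1) in simp)
    let ?d = "g a - g b"
    have dd: "dist (fst a) (fst b) \<le> dist a b" by (rule dist_fst_le)
    have "norm ?d \<le> ?L * dist a b"
    proof (cases "?d = 0")
      case False
      have s1: "l * (norm ?d)\<^sup>2 \<le> m (fst a) ?d ?d" using elim z by auto
      \<comment> \<open>Splits the form of the difference into the change of the right-hand side of
        the equation and the change of the metric at the fixed vector \<open>g b\<close>.\<close>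
      have s2: "m (fst a) ?d ?d = m (fst a) (g a) ?d - m (fst b) (g b) ?d - (m (fst a) (g b) ?d - m (fst b) (g b) ?d)"
        by (simp add: bilinear_lsub[OF bilinear_m[OF P(1)]])
      have s3: "m (fst a) (g a) ?d - m (fst b) (g b) ?d = (kv a - kv b) \<bullet> ?d / 2"
        using eqg[OF P(1), of ?d] eqg[OF P(2), of ?d] by (simp add: inner_diff_left field_simps)
      have s4: "(kv a - kv b) \<bullet> ?d \<le> K * dist a b * norm ?d"
        using elim z by (intro order.trans[OF norm_cauchy_schwarz] mult_right_mono) auto
      have "\<bar>m (fst a) (g b) ?d - m (fst b) (g b) ?d\<bar> \<le> L * dist (fst a) (fst b) * norm (g b) * norm ?d"
        using elim z by auto
      also have "\<dots> \<le> L * dist a b * ?G * norm ?d"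
        using dd L(1) l(1) Knn bd[of b] by (intro mult_mono mult_nonneg_nonneg) auto
      finally have s5: "\<bar>m (fst a) (g b) ?d - m (fst b) (g b) ?d\<bar> \<le> L * dist a b * ?G * norm ?d" .
      have "(K / 2 + L * ?G) * dist a b * norm ?d = K * dist a b * norm ?d / 2 + L * dist a b * ?G * norm ?d"
        by (simp add: algebra_simps)
      then have "l * (norm ?d)\<^sup>2 \<le> (K / 2 + L * ?G) * dist a b * norm ?d"
        using s1 s2 s3 s4 s5 by linarith
      then have "l * norm ?d \<le> (K / 2 + L * ?G) * dist a b"
        using False by (simp add: power2_eq_square)
      then show ?thesis using l(1) by (simp add: field_simps)
    qed (use Knn l(1) L(1) in simp)
    moreover have "0 \<le> ?G" "0 \<le> ?L" using Knn l(1) L(1) by simp_all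
    moreover from this have "?L * dist a b \<le> (?L + ?G) * dist a b" by (intro mult_right_mono) auto
    ultimately show ?case using bd[of a] bd[of b] z by auto
  qed
  then show ?thesis unfolding lip_near_def g_def by blast
qed

text \<open>The pair of position and velocity satisfies a first-order equation, to which Gronwall
  applies. The Lipschitz constant is valid only near the initial value, hence the small \<delta>;
  \<open>totally_geodesic\<close> asks for no more.\<close>

lemma geodesic_unique:
  assumes e: "e > 0"
    and c: "\<And>t. \<bar>t\<bar> < e \<Longrightarrow> c t \<in> P" "\<And>t. \<bar>t\<bar> < e \<Longrightarrow> (c has_vector_derivative c' t) (at t)"
      "\<And>t. \<bar>t\<bar> < e \<Longrightarrow> (c' has_vector_derivative - christoffel m (c t) (c' t) (c' t)) (at t)"
    and k: "\<And>t. \<bar>t\<bar> < e \<Longrightarrow> k t \<in> P" "\<And>t. \<bar>t\<bar> < e \<Longrightarrow> (k has_vector_derivative k' t) (at t)"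
      "\<And>t. \<bar>t\<bar> < e \<Longrightarrow> (k' has_vector_derivative - christoffel m (k t) (k' t) (k' t)) (at t)"
    and init: "c 0 = k 0" "c' 0 = k' 0"
  shows "\<exists>\<delta>>0. \<delta> \<le> e \<and> (\<forall>t. \<bar>t\<bar> < \<delta> \<longrightarrow> c t = k t)"
proof -
  have e0: "\<bar>0::real\<bar> < e" using e by simp
  define X Y where "X t = (c t, c' t)" and "Y t = (k t, k' t)" for t
  let ?G = "\<lambda>a. christoffel m (fst a) (snd a) (snd a)"
  obtain L where L: "\<forall>\<^sub>F z in nhds ((c 0, c' 0), (c 0, c' 0)). norm (?G (fst z) - ?G (snd z)) \<le> L * dist (fst z) (snd z)
      \<and> norm (?G (fst z)) \<le> L \<and> norm (?G (snd z)) \<le> L"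
    using lip_christoffel[OF c(1)[OF e0], of "c' 0"] by (auto simp: lip_near_def)
  have cont: "isCont (\<lambda>t. (X t, Y t)) 0"
    unfolding X_def Y_def
    using c(2,3)[OF e0] k(2,3)[OF e0] has_vector_derivative_continuous by (intro continuous_intros) blast+
  have "filterlim (\<lambda>t. (X t, Y t)) (nhds ((c 0, c' 0), (c 0, c' 0))) (nhds 0)"
    using isCont_tendsto_nhds[OF cont] init by (simp add: X_def Y_def)
  from eventually_compose_filterlim[OF L this] obtain r where r: "r > 0"
    "\<And>t. dist t 0 < r \<Longrightarrow> norm (?G (X t) - ?G (Y t)) \<le> L * dist (X t) (Y t) \<and> norm (?G (X t)) \<le> L"
    unfolding eventually_nhds_metric by auto
  define \<delta> where "\<delta> = min r e"
  have "X t - Y t = 0" if "\<bar>t\<bar> < \<delta>" for t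
  \<comment> \<open>In the constant \<open>1 + L\<close>, the 1 accounts for the position component,
    whose derivative is the velocity, and \<open>L\<close> for the velocity component.\<close>
  proof (rule gronwall_zero[where y' = "\<lambda>t. (c' t, - ?G (X t)) - (k' t, - ?G (Y t))" and L = "1 + L", OF _ _ _ that])
    fix t :: real assume t: "\<bar>t\<bar> < \<delta>"
    then have te: "\<bar>t\<bar> < e" "dist t 0 < r" by (auto simp: \<delta>_def)
    show "((\<lambda>t. X t - Y t) has_vector_derivative (c' t, - ?G (X t)) - (k' t, - ?G (Y t))) (at t)"
      unfolding X_def Y_def using c(2,3)[OF te(1)] k(2,3)[OF te(1)]
      by (intro has_vector_derivative_diff has_vector_derivative_Pair) auto
    have "norm ((c' t, - ?G (X t)) - (k' t, - ?G (Y t))) \<le> norm (c' t - k' t) + norm (?G (Y t) - ?G (X t))"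
      using norm_Pair_le[of "c' t - k' t" "?G (Y t) - ?G (X t)"] by simp
    also have "norm (c' t - k' t) \<le> norm (X t - Y t)"
      using norm_snd_le[of "c' t - k' t" "c t - k t"] by (simp add: X_def Y_def)
    also have "norm (?G (Y t) - ?G (X t)) \<le> L * norm (X t - Y t)"
      using r(2)[OF te(2)] by (simp add: dist_norm norm_minus_commute)
    finally show "norm ((c' t, - ?G (X t)) - (k' t, - ?G (Y t))) \<le> (1 + L) * norm (X t - Y t)"
      by (simp add: algebra_simps)
  qed (use init in \<open>simp add: X_def Y_def\<close>)
  then show ?thesis
    using r(1) e by (intro exI[of _ \<delta>]) (auto simp: \<delta>_def X_def Y_def zero_prod_def)
qed

text \<open>A linear map has no second derivative, so the Christoffel symbols transform like a
  tensor under it. Since \<open>g\<close> is an involution, every test vector \<open>z\<close> has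
  the form \<open>g (g z)\<close>.\<close>

lemma christoffel_isometry:
  assumes lin: "linear g" and inv: "\<And>x. g (g x) = x" and gP: "\<And>p. p \<in> P \<Longrightarrow> g p \<in> P"
    and iso: "\<And>p u v. p \<in> P \<Longrightarrow> m (g p) (g u) (g v) = m p u v"
    and p: "p \<in> P"
  shows "christoffel m (g p) (g u) (g v) = g (christoffel m p u v)"
proof -
  have bl: "bounded_linear g" using lin by (simp add: linear_conv_bounded_linear)
  have D: "D (g p) (g u) (g v) (g w) = D p u v w" for u v w
  proof -
    have "((\<lambda>q. m (g q) (g u) (g v)) has_derivative (\<lambda>w. D (g p) (g u) (g v) (g w))) (at p)"
      using has_derivative_compose[OF bounded_linear_imp_has_derivative[OF bl] has_derivative_m[OF gP[OF p]]]
      by (simp add: o_def)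
    then have "((\<lambda>q. m q u v) has_derivative (\<lambda>w. D (g p) (g u) (g v) (g w))) (at p)"
      by (rule has_derivative_transform_within_open[OF _ open_P p]) (simp add: iso)
    then show ?thesis by (rule fun_cong[OF frechet_derivative_at])
  qed
  show ?thesis
  proof (rule christoffel_unique[OF gP[OF p]])
    fix z
    have "2 * m (g p) (g (christoffel m p u v)) (g (g z)) = koszul p u v (g z)"
      using christoffel_koszul[OF p] iso[OF p] by metis
    also have "\<dots> = koszul (g p) (g u) (g v) z"
      using D[of v "g z" u] D[of u "g z" v] D[of u v "g z"] by (simp add: koszul_def inv)
    finally show "2 * m (g p) (g (christoffel m p u v)) z = koszul (g p) (g u) (g v) z"
      by (simp add: inv)
  qed
qed

section \<open>Fixed point sets of linear isometries\<close>

lemma ck_on_const: "ck_on k U (\<lambda>_. c :: 'b::real_normed_vector)"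
  by (induction k arbitrary: c) (simp_all add: frechet_derivative_const)

lemma smooth_on_id: "smooth_on U (\<lambda>x. x)"
  unfolding smooth_on_def
proof
  show "ck_on k U (\<lambda>x. x)" for k
    by (cases k) (simp_all add: ck_on_const frechet_derivative_ident)
qed

text \<open>Linearity of the isometries makes the fixed point set open in a linear subspace, so the
  identity parametrises it. Each isometry yields its own time interval of coincidence, and
  finiteness of \<open>\<G>\<close> gives a common one.\<close>

theorem totally_geodesic_fixed_points:
  assumes fin: "finite \<G>"
    and lin: "\<And>g. g \<in> \<G> \<Longrightarrow> linear g" and inv: "\<And>g x. g \<in> \<G> \<Longrightarrow> g (g x) = x"
    and gP: "\<And>g p. g \<in> \<G> \<Longrightarrow> p \<in> P \<Longrightarrow> g p \<in> P"
    and iso: "\<And>g p u v. g \<in> \<G> \<Longrightarrow> p \<in> P \<Longrightarrow> m (g p) (g u) (g v) = m p u v"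
    and T: "T = {x. \<forall>g\<in>\<G>. g x = x}"
  shows "totally_geodesic_submanifold P m (P \<inter> T)"
proof -
  have sub: "subspace T"
    by (auto simp: T subspace_def linear_0[OF lin] linear_add[OF lin] linear_scale[OF lin])
  have "embedded_submanifold (dim T) (P \<inter> T)"
    unfolding embedded_submanifold_def
  proof
    fix p assume "p \<in> P \<inter> T"
    then show "\<exists>U W T'. \<exists>\<phi> :: 'v \<Rightarrow> 'v. \<exists>\<psi>.
     open U \<and> p \<in> U \<and> open W \<and> subspace T' \<and> dim T' = dim T
     \<and> smooth_on W \<phi> \<and> (\<forall>x\<in>W \<inter> T'. inj_on (frechet_derivative \<phi> (at x)) T')
     \<and> homeomorphism (W \<inter> T') (U \<inter> (P \<inter> T)) \<phi> \<psi>"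
      using open_P sub
      by (intro exI[of _ P] exI[of _ T] exI[of _ "\<lambda>x. x"])
        (auto simp: smooth_on_id frechet_derivative_ident homeomorphism_def)
  qed
  moreover have "totally_geodesic P m (P \<inter> T)"
    unfolding totally_geodesic_def
  proof (intro allI impI, elim conjE)
    fix c e assume e: "(e::real) > 0" and geo: "geodesic_on P m {-e<..<e} c" and c0: "c 0 \<in> P \<inter> T"
      and tan: "vector_derivative c (at 0) \<in> tangent_space (P \<inter> T) (c 0)"
    from geo obtain c' where "\<forall>t\<in>{-e<..<e}. c t \<in> P \<and> (c has_vector_derivative c' t) (at t)
      \<and> (c' has_vector_derivative - christoffel m (c t) (c' t) (c' t)) (at t)"
      unfolding geodesic_on_def by blast
    then have c: "\<And>t. \<bar>t\<bar> < e \<Longrightarrow> c t \<in> P" "\<And>t. \<bar>t\<bar> < e \<Longrightarrow> (c has_vector_derivative c' t) (at t)"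
      "\<And>t. \<bar>t\<bar> < e \<Longrightarrow> (c' has_vector_derivative - christoffel m (c t) (c' t) (c' t)) (at t)"
      by (auto simp: abs_less_iff)
    have "c' 0 \<in> T"
    proof -
      have vd: "vector_derivative c (at 0) = c' 0"
        using c(2)[of 0] e by (intro vector_derivative_at) auto
      obtain b r where b: "(r::real) > 0" "b ` {-r<..<r} \<subseteq> P \<inter> T" "b 0 = c 0" "(b has_vector_derivative c' 0) (at 0)"
        using tan unfolding tangent_space_def vd by blast
      \<comment> \<open>A curve realising the tangent vector consists of fixed points, so
        differentiating it and its image under \<open>g\<close> gives the same velocity.\<close>
      have "g (c' 0) = c' 0" if g: "g \<in> \<G>" for g
      proof (rule vector_derivative_unique_at)
        have bl: "bounded_linear g" using lin[OF g] by (simp add: linear_conv_bounded_linear)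
        show "((\<lambda>t. g (b t)) has_vector_derivative g (c' 0)) (at 0)"
          by (rule bounded_linear.has_vector_derivative[OF bl b(4)])
        show "((\<lambda>t. g (b t)) has_vector_derivative c' 0) (at 0)"
          by (rule has_vector_derivative_transform_within_open[OF b(4), of "{-r<..<r}"])
            (use b(1,2) g in \<open>force simp: T image_subset_iff\<close>)+
      qed
      then show ?thesis by (simp add: T)
    qed
    have "\<exists>\<delta>>0. \<delta> \<le> e \<and> (\<forall>t. \<bar>t\<bar> < \<delta> \<longrightarrow> c t = g (c t))" if g: "g \<in> \<G>" for g
    proof (rule geodesic_unique[OF e c, where k' = "\<lambda>t. g (c' t)"])
      fix t assume t: "\<bar>t\<bar> < e"
      have bl: "bounded_linear g" using lin[OF g] by (simp add: linear_conv_bounded_linear)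
      show "g (c t) \<in> P" using gP[OF g] c(1)[OF t] .
      show "((\<lambda>t. g (c t)) has_vector_derivative g (c' t)) (at t)"
        by (rule bounded_linear.has_vector_derivative[OF bl c(2)[OF t]])
      show "((\<lambda>t. g (c' t)) has_vector_derivative - christoffel m (g (c t)) (g (c' t)) (g (c' t))) (at t)"
        using bounded_linear.has_vector_derivative[OF bl c(3)[OF t]]
        by (simp add: christoffel_isometry[OF lin[OF g] inv[OF g] gP[OF g] iso[OF g] c(1)[OF t]]
            linear_neg[OF lin[OF g]])
    qed (use c0 \<open>c' 0 \<in> T\<close> g in \<open>auto simp: T\<close>)
    then have "\<forall>g\<in>\<G>. \<exists>\<delta>. \<delta> > 0 \<and> \<delta> \<le> e \<and> (\<forall>t. \<bar>t\<bar> < \<delta> \<longrightarrow> c t = g (c t))" by blast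
    from bchoice[OF this] obtain \<delta> where
      \<delta>: "\<And>g. g \<in> \<G> \<Longrightarrow> \<delta> g > 0 \<and> \<delta> g \<le> e \<and> (\<forall>t. \<bar>t\<bar> < \<delta> g \<longrightarrow> c t = g (c t))"
      by blast
    \<comment> \<open>Inserting \<open>e\<close> keeps the minimum meaningful for empty
      \<open>\<G>\<close> and bounded by \<open>e\<close>.\<close>
    let ?d = "Min (insert e (\<delta> ` \<G>))"
    have "?d > 0" using fin e \<delta> by auto
    moreover have "?d \<le> e" using fin by simp
    moreover have "c t \<in> P \<inter> T" if "\<bar>t\<bar> < ?d" for t
    proof
      show "c t \<in> P" using that fin by (intro c) simp
      have "g (c t) = c t" if g: "g \<in> \<G>" for g
      proof -
        have "?d \<le> \<delta> g" using fin g by (intro Min_le) auto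
        with \<open>\<bar>t\<bar> < ?d\<close> have "c t = g (c t)" using \<delta>[OF g] by simp
        then show ?thesis by (rule sym)
      qed
      then show "c t \<in> T" by (simp add: T)
    qed
    then have "c ` {-?d<..<?d} \<subseteq> P \<inter> T" by (auto simp: abs_less_iff)
    ultimately show "\<exists>\<delta>>0. \<delta> \<le> e \<and> c ` {-\<delta><..<\<delta>} \<subseteq> P \<inter> T" by blast
  qed
  ultimately show ?thesis unfolding totally_geodesic_submanifold_def by auto
qed

end

section \<open>Open positivity sets\<close>

text \<open>The complement is the projection of a closed set along the compact factor
  \<open>K\<close>, hence closed.\<close>

lemma open_positive_on_compact:
  fixes f :: "'a::euclidean_space \<times> 'b::euclidean_space \<Rightarrow> real"
  assumes "compact K" "continuous_on UNIV f"
  shows "open {a. \<forall>y\<in>K. f (a, y) > 0}"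
proof -
  have "closed {(y, a). f (a, y) \<le> 0}"
  proof -
    have "continuous_on UNIV (\<lambda>z. f (snd z, fst z))"
      by (intro continuous_on_compose2[OF assms(2)] continuous_intros) auto
    then have "closed {z. f (snd z, fst z) \<le> 0}" by (intro closed_Collect_le continuous_intros)
    moreover have "{z. f (snd z, fst z) \<le> 0} = {(y, a). f (a, y) \<le> 0}" by auto
    ultimately show ?thesis by simp
  qed
  from closed_compact_projection[OF assms(1) this]
  have "closed {a. \<exists>y. y \<in> K \<and> f (a, y) \<le> 0}" by simp
  moreover have "- {a. \<exists>y. y \<in> K \<and> f (a, y) \<le> 0} = {a. \<forall>y\<in>K. f (a, y) > 0}" by (auto simp: not_le)
  ultimately show ?thesis by (simp only: closed_def)
qed

lemma positive_quadratic_iff_sphere: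
  fixes q :: "'b::real_normed_vector \<Rightarrow> real"
  assumes "\<And>s y. q (s *\<^sub>R y) = s\<^sup>2 * q y"
  shows "(\<forall>y. y \<noteq> 0 \<longrightarrow> q y > 0) \<longleftrightarrow> (\<forall>y\<in>sphere 0 1. q y > 0)"
proof safe
  fix y :: 'b assume "\<forall>y. y \<noteq> 0 \<longrightarrow> q y > 0" "y \<in> sphere 0 1"
  then show "q y > 0" by (cases "y = 0") auto
next
  fix y :: 'b assume *: "\<forall>y\<in>sphere 0 1. q y > 0" and y: "y \<noteq> 0"
  have "q (y /\<^sub>R norm y) > 0" using y by (intro *[rule_format]) simp
  moreover have "q y = (norm y)\<^sup>2 * q (y /\<^sub>R norm y)" using y assms[of "norm y" "y /\<^sub>R norm y"] by simp
  ultimately show "q y > 0" using y by simp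
qed

section \<open>Diagonal matrices\<close>

definition dg :: "('n \<Rightarrow> 'a::zero) \<Rightarrow> 'a^'n^'n" where
  "dg f = (\<chi> i j. if i = j then f i else 0)"

lemma dg_nth: "dg f $ i $ j = (if i = j then f i else 0)"
  by (simp add: dg_def)

lemma dg_mult_left: "(dg f ** A) $ i $ j = f i * A $ i $ j" for A :: "'a::semiring_1^'m^'n::finite"
  by (simp add: matrix_matrix_mult_def dg_nth if_distrib[of "\<lambda>x. x * _"] cong: if_cong)

lemma dg_mult_right: "(A ** dg f) $ i $ j = A $ i $ j * f j" for A :: "'a::semiring_1^'n::finite^'m"
  by (simp add: matrix_matrix_mult_def dg_nth if_distrib cong: if_cong)

lemma dg_mult: "dg f ** dg g = dg (\<lambda>i. f i * g i :: 'a::semiring_1)"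
  by (simp add: vec_eq_iff dg_mult_left dg_nth)

lemma mat_1_dg: "mat 1 = dg (\<lambda>_. 1)"
  by (simp add: mat_def dg_def)

lemma adj_dg: "adj (dg f) = dg (\<lambda>i. conjg (f i))"
  by (auto simp: adj_def dg_def vec_eq_iff)

lemma scaleR_dg: "r *\<^sub>R dg f = dg (\<lambda>i. r *\<^sub>R f i :: 'a::real_vector)"
  by (auto simp: dg_def vec_eq_iff)

lemma add_dg: "dg f + dg g = dg (\<lambda>i. f i + g i :: 'a::monoid_add)"
  by (auto simp: dg_def vec_eq_iff)

lemma sums_vec:
  fixes f :: "nat \<Rightarrow> 'a::real_normed_vector^'n"
  assumes "\<And>i. (\<lambda>n. f n $ i) sums (g $ i)"
  shows "f sums g"
  using assms unfolding sums_def by (intro vec_tendstoI) (simp add: sum_component)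

lemma Rep_herm_conjg: "conjg (Rep_herm A $ i $ j) = Rep_herm A $ j $ i"
  using Rep_herm[of A] by (simp add: adj_def vec_eq_iff)

lemma linear_Rep_herm: "linear Rep_herm"
  by (rule linearI) (simp_all add: plus_herm.rep_eq scaleR_herm.rep_eq)

lemma conjg_of_real [simp]: "conjg (of_real r :: 'a::{conjugation, real_algebra_1}) = of_real r"
  by (simp add: of_real_def conjg_scaleR)

lemma inner_matrix_vector:
  "inner x (A *v y) = (\<Sum>i\<in>UNIV. \<Sum>j\<in>UNIV. inner (x $ i) (A $ i $ j * y $ j))"
  for A :: "'a::{euclidean_space, ring_1}^'n^'n"
  by (simp add: inner_vec_def matrix_vector_mult_def inner_sum_right)

lemma bounded_bilinear_times: "bounded_bilinear ((*) :: 'a::{euclidean_space, real_algebra_1} \<Rightarrow> _)"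
  by (intro bilinear_conv_bounded_bilinear[THEN iffD1])
    (simp add: bilinear_def linear_iff distrib_left distrib_right)

lemma posdef_sphere:
  "(posdef :: ('a::{conjugation, real_algebra_1}, 'n::finite) herm set)
     = {A. \<forall>x\<in>sphere 0 1. inner x (Rep_herm A *v x) > 0}"
  unfolding posdef_def
  by (subst positive_quadratic_iff_sphere)
    (simp_all add: inner_matrix_vector sum_distrib_left power2_eq_square mult.assoc)

lemma open_posdef: "open (posdef :: ('a::{conjugation, real_algebra_1}, 'n::finite) herm set)"
proof -
  have "continuous_on UNIV (\<lambda>z :: ('a, 'n) herm \<times> ('a^'n). inner (snd z) (Rep_herm (fst z) *v snd z))"
    unfolding inner_matrix_vector
    by (intro continuous_intros bounded_bilinear.continuous_on[OF bounded_bilinear_times]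
        continuous_on_component linear_continuous_on_compose[OF _ linear_Rep_herm])
  from open_positive_on_compact[OF compact_sphere this, of 0 1] show ?thesis
    unfolding posdef_sphere by simp
qed

section \<open>Sign changes of coordinates\<close>

definition csign :: "'n \<Rightarrow> 'n \<Rightarrow> real" where
  "csign i k = (if k = i then - 1 else 1)"

lemma csign_csign [simp]: "csign i k * csign i k = 1"
  by (simp_all add: csign_def)

definition flip_matrix :: "'n \<Rightarrow> 'a::real_algebra_1^'n^'n" where
  "flip_matrix i = dg (\<lambda>k. of_real (csign i k))"

abbreviation flip_act :: "'n \<Rightarrow> ('a::{conjugation, real_algebra_1}, 'n::finite) herm \<Rightarrow> ('a, 'n) herm" where
  "flip_act i \<equiv> act matrix_space (flip_matrix i)"

lemma flip_matrix_grp: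
  "(flip_matrix i :: 'a::{conjugation, real_algebra_1}^'n::finite^'n) \<in> grp matrix_space"
proof -
  have "flip_matrix i ** flip_matrix i = (mat 1 :: 'a^'n^'n)"
    by (simp add: flip_matrix_def dg_mult mat_1_dg flip: of_real_mult)
  then show ?thesis by (auto simp: matrix_space_def invertible_def)
qed

lemma Rep_flip_act: "Rep_herm (flip_act i A) $ k $ l = (csign i k * csign i l) *\<^sub>R Rep_herm A $ k $ l"
proof -
  let ?B = "flip_matrix i ** Rep_herm A ** adj (flip_matrix i)"
  have B: "?B $ k $ l = (csign i k * csign i l) *\<^sub>R Rep_herm A $ k $ l" for k l
    by (simp add: flip_matrix_def adj_dg dg_mult_left dg_mult_right)
      (simp add: of_real_def)
  have "adj ?B = ?B"
    unfolding vec_eq_iff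
  proof (intro allI)
    fix k l
    have "adj ?B $ k $ l = conjg (?B $ l $ k)" by (simp add: adj_def[of ?B])
    then show "adj ?B $ k $ l = ?B $ k $ l"
      by (simp only: B conjg_scaleR Rep_herm_conjg mult.commute)
  qed
  then have "Rep_herm (flip_act i A) = ?B"
    by (simp add: matrix_space_def Abs_herm_inverse)
  then show ?thesis by (simp only: B)
qed

lemma herm_eqI: "(\<And>k l. Rep_herm A $ k $ l = Rep_herm B $ k $ l) \<Longrightarrow> A = B"
  by (simp add: Rep_herm_inject[symmetric] vec_eq_iff)

lemma linear_flip_act: "linear (flip_act i)"
  by (rule linearI; rule herm_eqI)
    (simp_all add: Rep_flip_act plus_herm.rep_eq scaleR_herm.rep_eq scaleR_add_right mult_ac)

lemma flip_act_involution: "flip_act i (flip_act i A) = A"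
  by (rule herm_eqI) (simp add: Rep_flip_act csign_def)

lemma flip_act_posdef:
  fixes A :: "('a::{conjugation, real_algebra_1}, 'n::finite) herm"
  assumes "A \<in> posdef"
  shows "flip_act i A \<in> posdef"
  unfolding posdef_def
proof (clarsimp)
  fix x :: "'a^'n" assume "x \<noteq> 0"
  \<comment> \<open>The form of the flipped matrix at \<open>x\<close> is the form of
    \<open>A\<close> at the flipped vector.\<close>
  let ?y = "\<chi> k. csign i k *\<^sub>R x $ k"
  have "?y \<noteq> 0"
  proof
    assume "?y = 0"
    then have "csign i k *\<^sub>R x $ k = 0" for k by (simp add: vec_eq_iff)
    moreover have "csign i k \<noteq> 0" for k by (simp add: csign_def)
    ultimately have "x = 0" by (simp add: vec_eq_iff)
    with \<open>x \<noteq> 0\<close> show False by simp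
  qed
  with assms have "inner ?y (Rep_herm A *v ?y) > 0" by (auto simp: posdef_def)
  also have "inner ?y (Rep_herm A *v ?y) = inner x (Rep_herm (flip_act i A) *v x)"
    by (simp add: inner_matrix_vector Rep_flip_act mult_ac)
  finally show "inner x (Rep_herm (flip_act i A) *v x) > 0" .
qed

lemma flip_act_fixed_iff:
  fixes A :: "('a::{conjugation, real_algebra_1}, 'n::finite) herm"
  shows "(\<forall>i. flip_act i A = A) \<longleftrightarrow> (\<forall>k l. k \<noteq> l \<longrightarrow> Rep_herm A $ k $ l = 0)"
proof safe
  fix k l :: 'n assume "\<forall>i. flip_act i A = A" and kl: "k \<noteq> l"
  then have "Rep_herm (flip_act k A) $ k $ l = Rep_herm A $ k $ l" by simp
  then have "- Rep_herm A $ k $ l = Rep_herm A $ k $ l" using kl by (simp add: Rep_flip_act csign_def)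
  then have "2 *\<^sub>R Rep_herm A $ k $ l = 0" by (metis scaleR_2 add.left_inverse)
  then show "Rep_herm A $ k $ l = 0" by simp
next
  fix i assume *: "\<forall>k l. k \<noteq> l \<longrightarrow> Rep_herm A $ k $ l = 0"
  show "flip_act i A = A"
  proof (rule herm_eqI)
    fix k l show "Rep_herm (flip_act i A) $ k $ l = Rep_herm A $ k $ l"
      using * by (cases "k = l") (simp_all add: Rep_flip_act)
  qed
qed

section \<open>Cartan subalgebras of matrix algebras\<close>

text \<open>\<open>C\<close> is a Cartan subalgebra of the coefficient algebra itself, with
  exponential \<open>E\<close>: everything for the real and complex numbers, a copy of the complex
  numbers inside the quaternions. \<open>C_self_normalizing\<close> lifts to diagonal matrices, and
  \<open>E_conjg\<close> expresses that \<open>C\<close> moves the base point only along positive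
  reals.\<close>

locale algebra_torus =
  fixes C :: "'a::{conjugation, real_algebra_1} set" and E :: "'a \<Rightarrow> 'a"
  assumes C_subspace: "subspace C"
    and C_real: "of_real r \<in> C"
    and C_comm: "x \<in> C \<Longrightarrow> y \<in> C \<Longrightarrow> x * y = y * x"
    and C_self_normalizing: "(\<And>c. c \<in> C \<Longrightarrow> x * c - c * x \<in> C) \<Longrightarrow> x \<in> C"
    and E_sums: "c \<in> C \<Longrightarrow> (\<lambda>n. c ^ n /\<^sub>R fact n) sums E c"
    and E_inverse: "c \<in> C \<Longrightarrow> E c * E (- c) = 1"
    and E_conjg: "c \<in> C \<Longrightarrow> \<exists>r>0. E c * conjg (E c) = of_real r"
    and E_real: "E (of_real r) = of_real (exp r)"
    and conjg_fixed: "conjg x = x \<Longrightarrow> x \<in> range of_real"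
begin

definition diagonals :: "('a^'n::finite^'n) set" where
  "diagonals = {dg f | f. \<forall>i. f i \<in> C}"

definition real_diagonals :: "('a^'n::finite^'n) set" where
  "real_diagonals = range (\<lambda>r. dg (\<lambda>i. of_real (r i)))"

lemma gexp_dg:
  assumes "\<And>i. f i \<in> C"
  shows "gexp matrix_space (dg f :: 'a^'n::finite^'n) = dg (\<lambda>i. E (f i))"
proof -
  have pow: "((**) (dg f) ^^ n) (mat 1) = (dg (\<lambda>i. f i ^ n) :: 'a^'n^'n)" for n
    by (induction n) (simp_all add: mat_1_dg dg_mult)
  have "(\<lambda>n. (1 / fact n) *\<^sub>R dg (\<lambda>i. f i ^ n) :: 'a^'n^'n) sums dg (\<lambda>i. E (f i))"
    by (intro sums_vec) (use E_sums[OF assms] in \<open>simp add: dg_nth divide_inverse\<close>)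
  from sums_unique[OF this] show ?thesis
    by (simp add: gexp_def matrix_space_def pow)
qed

lemma diagonals_lie_algebra: "diagonals \<subseteq> lie_algebra (matrix_space :: ('a^'n^'n, ('a, 'n::finite) herm) cone_space)"
proof (clarsimp simp: diagonals_def lie_algebra_def)
  fix f :: "'n \<Rightarrow> 'a" and t :: real
  assume "\<forall>i. f i \<in> C"
  then have C: "t *\<^sub>R f i \<in> C" "- (t *\<^sub>R f i) \<in> C" for i
    by (simp_all add: subspace_scale[OF C_subspace] subspace_neg[OF C_subspace])
  have "dg (\<lambda>i. E (t *\<^sub>R f i)) ** dg (\<lambda>i. E (- (t *\<^sub>R f i))) = (mat 1 :: 'a^'n^'n)"
    "dg (\<lambda>i. E (- (t *\<^sub>R f i))) ** dg (\<lambda>i. E (t *\<^sub>R f i)) = (mat 1 :: 'a^'n^'n)"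
    using E_inverse[OF C(1)] E_inverse[OF C(2)] by (simp_all add: dg_mult mat_1_dg)
  then have "invertible (dg (\<lambda>i. E (t *\<^sub>R f i)) :: 'a^'n^'n)"
    unfolding invertible_def by blast
  then show "gexp matrix_space (t *\<^sub>R dg f :: 'a^'n^'n) \<in> grp (matrix_space :: ('a^'n^'n, ('a, 'n) herm) cone_space)"
    by (simp add: scaleR_dg gexp_dg C(1)) (simp add: matrix_space_def)
qed

lemma bracket_dg:
  "bracket matrix_space X (dg f) $ i $ j = X $ i $ j * f j - f i * X $ i $ j" for X :: "'a^'n::finite^'n"
  by (simp add: bracket_def matrix_space_def dg_mult_left dg_mult_right)

lemma bracket_diagonals:
  "X \<in> diagonals \<Longrightarrow> Y \<in> diagonals \<Longrightarrow> bracket matrix_space X Y = (0 :: 'a^'n::finite^'n)"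
  by (auto simp: diagonals_def bracket_dg dg_nth C_comm intro!: vec_eq_iff[THEN iffD2])

lemma subspace_diagonals: "subspace (diagonals :: ('a^'n::finite^'n) set)"
  unfolding subspace_def
proof (intro conjI ballI allI)
  show "0 \<in> diagonals"
    unfolding diagonals_def using subspace_0[OF C_subspace]
    by (auto simp: dg_def vec_eq_iff intro!: exI[of _ "\<lambda>_. 0"])
qed (use subspace_add[OF C_subspace] subspace_scale[OF C_subspace] in
    \<open>auto simp: diagonals_def add_dg scaleR_dg\<close>)

lemma eq_dg: "(\<And>i j. i \<noteq> j \<Longrightarrow> X $ i $ j = 0) \<Longrightarrow> X = dg (\<lambda>i. X $ i $ i)"
  by (auto simp: vec_eq_iff dg_nth)

lemma cartan_subalgebra_diagonals:
  "cartan_subalgebra (matrix_space :: ('a^'n^'n, ('a, 'n::finite) herm) cone_space) diagonals"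
  unfolding cartan_subalgebra_def
proof (intro conjI ballI impI)
  have "lower_central matrix_space diagonals (Suc 0) = {0 :: 'a^'n^'n}"
  proof -
    have "{bracket matrix_space X Y | X Y. X \<in> diagonals \<and> Y \<in> (diagonals :: ('a^'n^'n) set)} \<subseteq> {0}"
      using bracket_diagonals by auto
    from span_mono[OF this] show ?thesis using span_zero by (auto simp: subset_singleton_iff)
  qed
  then show "\<exists>n. lower_central matrix_space diagonals n = {0 :: 'a^'n^'n}" ..
next
  fix X :: "'a^'n^'n" assume X: "\<forall>Y\<in>diagonals. bracket matrix_space X Y \<in> diagonals"
  have off: "X $ i $ j = 0" if "i \<noteq> j" for i j
  proof -
    \<comment> \<open>The bracket of \<open>X\<close> with the matrix unit at (j, j) has the entry
      \<open>X $ i $ j\<close> at (i, j), which has to vanish in a diagonal matrix.\<close>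
    have "dg (\<lambda>k. if k = j then 1 else 0) \<in> diagonals"
      unfolding diagonals_def using C_real[of 1] C_real[of 0] by auto
    with X obtain g where "bracket matrix_space X (dg (\<lambda>k. if k = j then 1 else 0)) = dg g"
      unfolding diagonals_def by blast
    then have "bracket matrix_space X (dg (\<lambda>k. if k = j then 1 else 0)) $ i $ j = dg g $ i $ j" by simp
    then show ?thesis using that by (simp add: bracket_dg dg_nth)
  qed
  have "X $ i $ i \<in> C" for i
  \<comment> \<open>Scalar matrices with an entry from \<open>C\<close> reduce the diagonal entries
    to self-normalisation inside the coefficient algebra.\<close>
  proof (rule C_self_normalizing)
    fix c assume "c \<in> C"
    then have "dg (\<lambda>_. c) \<in> diagonals" by (auto simp: diagonals_def)
    with X obtain g where g: "\<forall>i. g i \<in> C" "bracket matrix_space X (dg (\<lambda>_. c)) = dg g"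
      unfolding diagonals_def by blast
    then have "bracket matrix_space X (dg (\<lambda>_. c)) $ i $ i = dg g $ i $ i" by simp
    then show "X $ i $ i * c - c * X $ i $ i \<in> C" using g(1) by (simp add: bracket_dg dg_nth)
  qed
  with eq_dg[OF off] show "X \<in> diagonals" unfolding diagonals_def by blast
qed (auto simp: subspace_diagonals diagonals_lie_algebra[THEN subsetD] bracket_diagonals
    subspace_0[OF subspace_diagonals])

lemma diagonals_cartan_t:
  "diagonals \<inter> cartan_t (matrix_space :: ('a^'n^'n, ('a, 'n::finite) herm) cone_space) = real_diagonals"
proof (intro equalityI subsetI)
  fix X :: "'a^'n^'n" assume X: "X \<in> diagonals \<inter> cartan_t (matrix_space :: ('a^'n^'n, ('a, 'n) herm) cone_space)"
  then obtain f where f: "X = dg f" by (auto simp: diagonals_def)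
  have "dg (\<lambda>i. conjg (f i)) = dg f"
    using X by (simp add: f cartan_t_def matrix_space_def adj_dg)
  then have "dg (\<lambda>i. conjg (f i)) $ i $ i = dg f $ i $ i" for i by simp
  then have "f i \<in> range of_real" for i by (intro conjg_fixed) (simp add: dg_nth)
  then have "\<forall>i. \<exists>r. f i = of_real r" by auto
  from choice[OF this] obtain r where "\<forall>i. f i = of_real (r i)" ..
  then have "f = (\<lambda>i. of_real (r i))" by auto
  then show "X \<in> real_diagonals" by (auto simp: f real_diagonals_def)
next
  fix X :: "'a^'n^'n" assume "X \<in> real_diagonals"
  then have "X \<in> diagonals" "adj X = X"
    using C_real by (auto simp: real_diagonals_def diagonals_def adj_dg)
  then show "X \<in> diagonals \<inter> cartan_t (matrix_space :: ('a^'n^'n, ('a, 'n) herm) cone_space)"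
    using diagonals_lie_algebra by (auto simp: cartan_t_def matrix_space_def)
qed

lemma maximal_abelian_real_diagonals:
  "maximal_abelian_subspace (matrix_space :: ('a^'n^'n, ('a, 'n::finite) herm) cone_space) real_diagonals"
  unfolding maximal_abelian_subspace_def
proof (intro conjI allI impI)
  have sub: "subspace (real_diagonals :: ('a^'n^'n) set)"
    unfolding subspace_def real_diagonals_def
  proof (intro conjI ballI allI)
    show "0 \<in> range (\<lambda>r. dg (\<lambda>i :: 'n. of_real (r i) :: 'a))"
      by (rule range_eqI[of _ _ "\<lambda>_. 0"]) (auto simp: dg_def vec_eq_iff)
  next
    fix x y :: "'a^'n^'n" assume "x \<in> range (\<lambda>r. dg (\<lambda>i. of_real (r i)))" "y \<in> range (\<lambda>r. dg (\<lambda>i. of_real (r i)))"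
    then obtain r s where "x = dg (\<lambda>i. of_real (r i))" "y = dg (\<lambda>i. of_real (s i))" by auto
    then show "x + y \<in> range (\<lambda>r. dg (\<lambda>i. of_real (r i)))"
      by (intro range_eqI[of _ _ "\<lambda>i. r i + s i"]) (simp add: add_dg)
  next
    fix x :: "'a^'n^'n" and c :: real assume "x \<in> range (\<lambda>r. dg (\<lambda>i. of_real (r i)))"
    then obtain r where "x = dg (\<lambda>i. of_real (r i))" by auto
    then show "c *\<^sub>R x \<in> range (\<lambda>r. dg (\<lambda>i. of_real (r i)))"
      by (intro range_eqI[of _ _ "\<lambda>i. c * r i"]) (simp add: scaleR_dg of_real_def)
  qed
  show "abelian_subspace (matrix_space :: ('a^'n^'n, ('a, 'n) herm) cone_space) real_diagonals"
    unfolding abelian_subspace_def using sub diagonals_cartan_t bracket_diagonals by auto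
  fix \<bb> assume "abelian_subspace (matrix_space :: ('a^'n^'n, ('a, 'n) herm) cone_space) \<bb> \<and> real_diagonals \<subseteq> \<bb>"
  then have b: "real_diagonals \<subseteq> \<bb>" "\<bb> \<subseteq> cartan_t (matrix_space :: ('a^'n^'n, ('a, 'n) herm) cone_space)"
    "\<And>X Y. X \<in> \<bb> \<Longrightarrow> Y \<in> \<bb> \<Longrightarrow> bracket matrix_space X Y = 0"
    by (auto simp: abelian_subspace_def)
  have "X \<in> real_diagonals" if X: "X \<in> \<bb>" for X
  proof -
    have "X $ i $ j = 0" if "i \<noteq> j" for i j
    proof -
      have "(\<lambda>k. if k = j then 1 else 0) = (\<lambda>k. of_real (if k = j then 1 else 0) :: 'a)" by auto
      then have "dg (\<lambda>k. if k = j then 1 else 0) \<in> real_diagonals"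
        by (auto simp: real_diagonals_def)
      then have "bracket matrix_space X (dg (\<lambda>k. if k = j then 1 else 0)) = 0" using b X by blast
      then have "bracket matrix_space X (dg (\<lambda>k. if k = j then 1 else 0)) $ i $ j = 0" by simp
      then show ?thesis using that by (simp add: bracket_dg)
    qed
    from eq_dg[OF this] have dgX: "X = dg (\<lambda>i. X $ i $ i)" .
    have Xt: "X \<in> cartan_t (matrix_space :: ('a^'n^'n, ('a, 'n) herm) cone_space)" using X b by blast
    then have "adj X = X" by (simp add: cartan_t_def matrix_space_def)
    then have "adj X $ i $ i = X $ i $ i" for i by simp
    then have "conjg (X $ i $ i) = X $ i $ i" for i by (simp add: adj_def)
    then have "X $ i $ i \<in> C" for i using conjg_fixed[of "X $ i $ i"] C_real by auto
    with dgX have "X \<in> diagonals" unfolding diagonals_def by blast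
    with Xt show ?thesis using diagonals_cartan_t by blast
  qed
  with b(1) show "\<bb> = real_diagonals" by blast
qed

lemma real_diagonals_subset: "real_diagonals \<subseteq> diagonals"
  using C_real by (auto simp: real_diagonals_def diagonals_def)

definition positive_diagonals :: "('a, 'n::finite) herm set" where
  "positive_diagonals = {Abs_herm (dg (\<lambda>i. of_real (r i))) | r. \<forall>i. r i > 0}"

lemma act_gexp_dg:
  assumes "\<And>i. f i \<in> C"
  shows "act matrix_space (gexp matrix_space (dg f)) (base matrix_space)
     = (Abs_herm (dg (\<lambda>i. E (f i) * conjg (E (f i)))) :: ('a, 'n::finite) herm)"
proof -
  have "Rep_herm (Abs_herm (mat 1)) = (mat 1 :: 'a^'n^'n)" by (simp add: Abs_herm_inverse)
  then show ?thesis
    unfolding gexp_dg[OF assms] by (simp add: matrix_space_def adj_dg dg_mult)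
qed

text \<open>The group element acts on the identity matrix through \<open>E c * conjg (E c)\<close>,
  which is a positive real; the non-real directions of \<open>C\<close> therefore contribute no new
  points to the orbit.\<close>

lemma exp_orbit_diagonals:
  "exp_orbit matrix_space diagonals \<subseteq> (positive_diagonals :: ('a, 'n::finite) herm set)"
proof
  fix x :: "('a, 'n) herm" assume "x \<in> exp_orbit matrix_space diagonals"
  then obtain f where f: "\<And>i. f i \<in> C" "x = act matrix_space (gexp matrix_space (dg f)) (base matrix_space)"
    by (auto simp: exp_orbit_def diagonals_def)
  have "\<forall>i. \<exists>r>0. E (f i) * conjg (E (f i)) = of_real r" using E_conjg f(1) by blast
  from choice[OF this] obtain r where "\<forall>i. r i > 0 \<and> E (f i) * conjg (E (f i)) = of_real (r i)" by blast
  then show "x \<in> positive_diagonals"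
    unfolding positive_diagonals_def f(2) act_gexp_dg[OF f(1)] by auto
qed

lemma exp_orbit_real_diagonals:
  "positive_diagonals \<subseteq> (exp_orbit matrix_space real_diagonals :: ('a, 'n::finite) herm set)"
proof
  fix x :: "('a, 'n) herm" assume "x \<in> positive_diagonals"
  then obtain r where r: "\<And>i. r i > 0" "x = Abs_herm (dg (\<lambda>i. of_real (r i)))"
    by (auto simp: positive_diagonals_def)
  \<comment> \<open>The half compensates for the action \<open>g A g\<^sup>*\<close>, which squares
    real diagonal entries.\<close>
  let ?f = "\<lambda>i. of_real (ln (r i) / 2) :: 'a"
  have "exp (ln (r i) / 2) * exp (ln (r i) / 2) = r i" for i
    using r(1)[of i] by (simp flip: exp_add)
  then have "x = act matrix_space (gexp matrix_space (dg ?f)) (base matrix_space)"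
    by (subst act_gexp_dg) (simp_all add: C_real E_real r(2) del: of_real_divide flip: of_real_mult)
  moreover have "dg ?f \<in> real_diagonals" unfolding real_diagonals_def by (rule rangeI)
  ultimately show "x \<in> exp_orbit matrix_space real_diagonals"
    unfolding exp_orbit_def by blast
qed

lemma exp_orbit_eq:
  "exp_orbit matrix_space diagonals = (positive_diagonals :: ('a, 'n::finite) herm set)"
  "exp_orbit matrix_space real_diagonals = (positive_diagonals :: ('a, 'n::finite) herm set)"
proof -
  have "exp_orbit matrix_space real_diagonals \<subseteq> (exp_orbit matrix_space diagonals :: ('a, 'n) herm set)"
    using real_diagonals_subset by (auto simp: exp_orbit_def)
  with exp_orbit_diagonals exp_orbit_real_diagonals
  show "exp_orbit matrix_space diagonals = (positive_diagonals :: ('a, 'n) herm set)"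
    "exp_orbit matrix_space real_diagonals = (positive_diagonals :: ('a, 'n) herm set)"
    by blast+
qed

lemma adapted_cartan_subalgebra_diagonals:
  "adapted_cartan_subalgebra (matrix_space :: ('a^'n^'n, ('a, 'n::finite) herm) cone_space) diagonals"
  unfolding adapted_cartan_subalgebra_def diagonals_cartan_t exp_orbit_eq
  using cartan_subalgebra_diagonals maximal_abelian_real_diagonals by blast

lemma positive_diagonals_eq:
  "(positive_diagonals :: ('a, 'n::finite) herm set) = posdef \<inter> {A. \<forall>g\<in>range flip_act. g A = A}"
proof -
  have quad: "inner x (dg (\<lambda>i. of_real (r i)) *v x) = (\<Sum>i\<in>UNIV. r i * (norm (x $ i))\<^sup>2)"
    for r and x :: "'a^'n"
    by (simp add: inner_matrix_vector dg_nth of_real_def power2_norm_eq_inner if_distrib[of "\<lambda>y. y * _"]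
        if_distrib[of "inner _"] cong: if_cong)
  have Rep: "Rep_herm (Abs_herm (dg (\<lambda>i. of_real (r i)))) = (dg (\<lambda>i. of_real (r i)) :: 'a^'n^'n)" for r
    by (simp add: Abs_herm_inverse adj_dg)
  show ?thesis
  proof (intro equalityI subsetI)
    fix A :: "('a, 'n) herm" assume "A \<in> positive_diagonals"
    then obtain r where r: "\<And>i. r i > 0" "A = Abs_herm (dg (\<lambda>i. of_real (r i)))"
      by (auto simp: positive_diagonals_def)
    have "(\<Sum>i\<in>UNIV. r i * (norm (x $ i))\<^sup>2) > 0" if "x \<noteq> 0" for x :: "'a^'n"
    proof -
      from that obtain i where "x $ i \<noteq> 0" by (auto simp: vec_eq_iff)
      then show ?thesis using r(1) less_imp_le[OF r(1)] by (intro sum_pos2[of _ i]) auto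
    qed
    then have "A \<in> posdef" by (simp add: posdef_def r(2) Rep quad)
    moreover have "\<forall>i. flip_act i A = A" unfolding flip_act_fixed_iff by (simp add: r(2) Rep dg_nth)
    ultimately show "A \<in> posdef \<inter> {A. \<forall>g\<in>range flip_act. g A = A}" by simp
  next
    fix A :: "('a, 'n) herm" assume A: "A \<in> posdef \<inter> {A. \<forall>g\<in>range flip_act. g A = A}"
    then have "\<forall>i. flip_act i A = A" by auto
    then have "Rep_herm A = dg (\<lambda>i. Rep_herm A $ i $ i)"
      unfolding flip_act_fixed_iff by (intro eq_dg) auto
    moreover have "\<forall>i. \<exists>r. Rep_herm A $ i $ i = of_real r"
      using conjg_fixed[OF Rep_herm_conjg] by blast
    from choice[OF this] obtain r where "\<forall>i. Rep_herm A $ i $ i = of_real (r i)" ..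
    ultimately have R: "Rep_herm A = dg (\<lambda>i. of_real (r i))" by simp
    then have "A = Abs_herm (dg (\<lambda>i. of_real (r i)))" by (metis Rep_herm_inverse)
    moreover have "r i > 0" for i
    proof -
      have "axis i 1 \<noteq> (0 :: 'a^'n)" by (simp add: axis_eq_0_iff)
      with A have "inner (axis i 1) (Rep_herm A *v axis i (1 :: 'a)) > 0" by (auto simp: posdef_def)
      then have "(\<Sum>k\<in>UNIV. r k * (norm (axis i (1 :: 'a) $ k))\<^sup>2) > 0" by (simp only: R quad)
      also have "(\<Sum>k\<in>UNIV. r k * (norm (axis i (1 :: 'a) $ k))\<^sup>2) = r i * (norm (1 :: 'a))\<^sup>2"
        by (subst sum.remove[of _ i]) (auto simp: axis_def intro!: sum.neutral)
      finally show ?thesis by (simp add: zero_less_mult_iff)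
    qed
    ultimately show "A \<in> positive_diagonals" by (auto simp: positive_diagonals_def)
  qed
qed

theorem totally_geodesic_exp_diagonals:
  assumes "invariant_metric (matrix_space :: ('a^'n^'n, ('a, 'n::finite) herm) cone_space) m"
  shows "\<exists>\<aa>. adapted_cartan_subalgebra matrix_space \<aa> \<and>
    totally_geodesic_submanifold posdef m (exp_orbit (matrix_space :: ('a^'n^'n, _) cone_space) \<aa>)"
proof (intro exI conjI)
  have cone: "cone (matrix_space :: ('a^'n^'n, ('a, 'n) herm) cone_space) = posdef"
    by (simp add: matrix_space_def)
  interpret riemannian posdef m
    using assms open_posdef by unfold_locales (simp_all add: invariant_metric_def cone)
  have "totally_geodesic_submanifold posdef m (posdef \<inter> {A. \<forall>g\<in>range flip_act. g A = A})"
  proof (rule totally_geodesic_fixed_points)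
    fix g and p u v :: "('a, 'n) herm" assume "g \<in> range (flip_act :: 'n \<Rightarrow> ('a, 'n) herm \<Rightarrow> _)" "p \<in> posdef"
    moreover have "\<forall>h\<in>grp (matrix_space :: ('a^'n^'n, ('a, 'n) herm) cone_space). \<forall>p\<in>posdef. \<forall>u v.
        m (act matrix_space h p) (act matrix_space h u) (act matrix_space h v) = m p u v"
      using assms by (simp add: invariant_metric_def cone)
    ultimately show "m (g p) (g u) (g v) = m p u v"
      using flip_matrix_grp by blast
  qed (auto simp: linear_flip_act flip_act_involution flip_act_posdef)
  then show "totally_geodesic_submanifold posdef m (exp_orbit (matrix_space :: ('a^'n^'n, _) cone_space) diagonals)"
    unfolding exp_orbit_eq positive_diagonals_eq .
qed (rule adapted_cartan_subalgebra_diagonals)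

end

section \<open>The three associative coefficient algebras\<close>

interpretation real_torus: algebra_torus "UNIV :: real set" exp
proof
  fix c :: real
  show "(\<lambda>n. c ^ n /\<^sub>R fact n) sums exp c" by (rule exp_converges)
  show "\<exists>r>0. exp c * conjg (exp c) = of_real r"
    by (rule exI[of _ "exp c * exp c"]) (simp add: conjg_real_def)
qed (auto simp: conjg_real_def simp flip: exp_add)

interpretation complex_torus: algebra_torus "UNIV :: complex set" exp
proof
  fix c :: complex
  show "\<exists>r>0. exp c * conjg (exp c) = of_real r"
    by (rule exI[of _ "(norm (exp c))\<^sup>2"]) (simp only: conjg_complex_def complex_norm_square[symmetric], simp)
  show "conjg c = c \<Longrightarrow> c \<in> range of_real"
    by (simp add: conjg_complex_def Reals_cnj_iff[symmetric] flip: Reals_def)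
  show "(\<lambda>n. c ^ n /\<^sub>R fact n) sums exp c" by (rule exp_converges)
qed (auto simp: exp_of_real simp flip: exp_add)

instance cd :: ("{comm_conjugation, real_algebra_1}") real_algebra_1
  by standard (simp_all add: times_cd_def scaleR_cd_def conjg_scaleR scaleR_add_right scaleR_diff_right)

lemma of_real_cd: "of_real r = CD (of_real r) (0 :: 'a::{comm_conjugation, real_algebra_1})"
  by (simp add: of_real_def one_cd_def scaleR_cd_def)

lemma bounded_linear_CD:
  "bounded_linear (\<lambda>c. CD c (0 :: 'a::euclidean_space))" "bounded_linear (\<lambda>c. CD (0 :: 'a::euclidean_space) c)"
  by (simp_all add: linear_iff plus_cd_def scaleR_cd_def flip: linear_conv_bounded_linear)

interpretation quaternion_torus: algebra_torus "{CD c 0 | c. True} :: quaternion set" "\<lambda>q. CD (exp (cd_fst q)) 0"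
proof
  show "subspace {CD c 0 | c. True :: bool}"
    by (auto simp: subspace_def zero_cd_def plus_cd_def scaleR_cd_def)
  fix r :: real show "of_real r \<in> {CD c 0 | c. True}" by (auto simp: of_real_cd)
  show "CD (exp (cd_fst (of_real r))) 0 = (of_real (exp r) :: quaternion)"
    by (simp add: of_real_cd exp_of_real)
next
  fix x y :: quaternion assume "x \<in> {CD c 0 | c. True}" "y \<in> {CD c 0 | c. True}"
  then show "x * y = y * x" by (auto simp: times_cd_def)
next
  fix x :: quaternion assume *: "\<And>c. c \<in> {CD c 0 | c. True} \<Longrightarrow> x * c - c * x \<in> {CD c 0 | c. True}"
  obtain a b where x: "x = CD a b" by (cases x)
  \<comment> \<open>The second component of this commutator is \<open>-2 * \<i> * b\<close>, so
    lying in the complex numbers forces \<open>b = 0\<close>.\<close>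
  have "x * CD \<i> 0 - CD \<i> 0 * x \<in> {CD c 0 | c. True}" by (rule *) auto
  then have "b = 0" by (auto simp: x times_cd_def minus_cd_def conjg_complex_def)
  then show "x \<in> {CD c 0 | c. True}" by (simp add: x)
next
  fix c :: quaternion assume "c \<in> {CD c 0 | c. True}"
  then obtain d where c: "c = CD d 0" by auto
  have "CD d 0 ^ n = CD (d ^ n) 0" for n
    by (induction n) (simp_all add: one_cd_def times_cd_def)
  moreover have "(\<lambda>n. CD (d ^ n /\<^sub>R fact n) 0) sums CD (exp d) 0"
    by (rule bounded_linear.sums[OF bounded_linear_CD(1) exp_converges])
  ultimately show "(\<lambda>n. c ^ n /\<^sub>R fact n) sums CD (exp (cd_fst c)) 0"
    by (simp add: c scaleR_cd_def)
  show "CD (exp (cd_fst c)) 0 * CD (exp (cd_fst (- c))) 0 = (1 :: quaternion)"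
    by (simp add: c uminus_cd_def times_cd_def one_cd_def flip: exp_add)
  show "\<exists>r>0. CD (exp (cd_fst c)) 0 * conjg (CD (exp (cd_fst c)) 0) = (of_real r :: quaternion)"
    by (rule exI[of _ "(norm (exp d))\<^sup>2"])
      (simp add: c times_cd_def conjg_cd_def conjg_complex_def of_real_cd del: norm_exp_eq_Re
        flip: complex_norm_square)
next
  fix x :: quaternion assume "conjg x = x"
  then have "cnj (cd_fst x) = cd_fst x" "- cd_snd x = cd_snd x"
    by (cases x; simp add: conjg_cd_def conjg_complex_def)+
  then have "x = of_real (Re (cd_fst x))"
    by (cases x) (auto simp: of_real_cd complex_eq_iff)
  then show "x \<in> range of_real" by blast
qed

section \<open>Octonions\<close>

text \<open>In the absence of associativity the basic octonion laws are verified as polynomial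
  identities in eight real coordinates.\<close>

lemma octonion_cases:
  obtains x1 x2 x3 x4 x5 x6 x7 x8
  where "(x :: octonion) = CD (CD (Complex x1 x2) (Complex x3 x4)) (CD (Complex x5 x6) (Complex x7 x8))"
proof -
  have "x = CD (CD (cd_fst (cd_fst x)) (cd_snd (cd_fst x))) (CD (cd_fst (cd_snd x)) (cd_snd (cd_snd x)))"
    by simp
  with that complex.exhaust show ?thesis by metis
qed

lemmas oct_simps = times_cd_def conjg_cd_def conjg_complex_def inner_cd_def plus_cd_def minus_cd_def
  uminus_cd_def scaleR_cd_def zero_cd_def one_cd_def inner_complex_def complex_eq_iff

context
  fixes x y z :: octonion
begin

lemma oct_distrib_left: "x * (y + z) = x * y + x * z"
  and oct_distrib_right: "(x + y) * z = x * z + y * z"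
  by (simp_all add: times_cd_def[where 'a = quaternion] plus_cd_def[where 'a = quaternion] conjg_add algebra_simps)

lemma oct_scaleR_left: "(r *\<^sub>R x) * y = r *\<^sub>R (x * y)"
  and oct_scaleR_right: "x * (r *\<^sub>R y) = r *\<^sub>R (x * y)"
  by (simp_all add: times_cd_def[where 'a = quaternion] scaleR_cd_def[where 'a = quaternion] conjg_scaleR
      scaleR_add_right scaleR_diff_right)

text \<open>Multiplication by an octonion has multiplication by its conjugate as adjoint. This and
  the alternative laws take over the role of associativity in what follows.\<close>

lemma oct_inner_left: "inner (x * y) z = inner y (conjg x * z)"
  by (rule octonion_cases[of x], rule octonion_cases[of y], rule octonion_cases[of z])
    (simp add: oct_simps algebra_simps)

lemma oct_inner_right: "inner (x * y) z = inner x (z * conjg y)"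
  by (rule octonion_cases[of x], rule octonion_cases[of y], rule octonion_cases[of z])
    (simp add: oct_simps algebra_simps)

lemma oct_alternative_left: "conjg x * (x * y) = inner x x *\<^sub>R y"
  by (rule octonion_cases[of x], rule octonion_cases[of y])
    (simp add: oct_simps algebra_simps)

lemma oct_conjg_mult: "conjg (x * y) = conjg y * conjg x"
  by (rule octonion_cases[of x], rule octonion_cases[of y])
    (simp add: oct_simps algebra_simps)

lemma oct_inner_conjg: "inner (conjg x) (conjg y) = inner x y"
  by (rule octonion_cases[of x], rule octonion_cases[of y]) (simp add: oct_simps)

lemma oct_mult_conjg_sum: "x * conjg y + y * conjg x = (2 * inner x y) *\<^sub>R 1"
  by (rule octonion_cases[of x], rule octonion_cases[of y])
    (simp add: oct_simps algebra_simps)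

lemma oct_one: "x * 1 = x" "1 * x = x"
  by (rule octonion_cases[of x], simp add: oct_simps)+

lemma conjg_eq_self_octonion: "conjg x = x \<Longrightarrow> x = inner 1 x *\<^sub>R 1"
  by (rule octonion_cases[of x]) (simp add: oct_simps)

lemma oct_inner_one: "inner (1 :: octonion) 1 = 1"
  by (simp add: oct_simps)

end

lemma oct_mult_zero: "x * 0 = (0 :: octonion)" "0 * x = (0 :: octonion)" for x :: octonion
  using oct_scaleR_right[of x 0 0] oct_scaleR_left[of 0 0 x] by simp_all

lemma oct_alternative_right: "(y * x) * conjg x = inner x x *\<^sub>R y" for x y :: octonion
proof -
  have "conjg (conjg ((y * x) * conjg x)) = conjg (conjg (conjg x) * (conjg x * conjg y))"
    by (simp add: oct_conjg_mult)
  then show ?thesis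
    by (simp add: oct_alternative_left[of "conjg x" "conjg y"] oct_inner_conjg conjg_scaleR del: conjg_conj)
      (simp add: conjg_scaleR)
qed

lemma oct_alternative_left': "x * (conjg x * y) = inner x x *\<^sub>R y"
  and oct_alternative_right': "(y * conjg x) * x = inner x x *\<^sub>R y" for x y :: octonion
  using oct_alternative_left[of "conjg x" y] oct_alternative_right[of y "conjg x"]
  by (simp_all add: oct_inner_conjg)

lemma oct_inner_mult_self: "inner (x * y) (x * y) = inner x x * inner y y" for x y :: octonion
  by (simp add: oct_inner_left oct_alternative_left)

section \<open>Self-adjoint octonionic matrices\<close>

definition H3 :: "real \<Rightarrow> real \<Rightarrow> real \<Rightarrow> octonion \<Rightarrow> octonion \<Rightarrow> octonion \<Rightarrow> (octonion, 3) herm" where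
  "H3 a b c x z w = Abs_herm (vector
     [vector [a *\<^sub>R 1, x, z], vector [conjg x, b *\<^sub>R 1, w], vector [conjg z, conjg w, c *\<^sub>R 1]])"

lemma Rep_H3:
  "Rep_herm (H3 a b c x z w) = vector
     [vector [a *\<^sub>R 1, x, z], vector [conjg x, b *\<^sub>R 1, w], vector [conjg z, conjg w, c *\<^sub>R 1]]"
  unfolding H3_def
  by (rule Abs_herm_inverse) (simp add: adj_def vec_eq_iff forall_3 vector_3 conjg_scaleR)

lemma Rep_H3_nth [simp]:
  "Rep_herm (H3 a b c x z w) $ 1 $ 1 = a *\<^sub>R 1" "Rep_herm (H3 a b c x z w) $ 1 $ 2 = x"
  "Rep_herm (H3 a b c x z w) $ 1 $ 3 = z" "Rep_herm (H3 a b c x z w) $ 2 $ 1 = conjg x"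
  "Rep_herm (H3 a b c x z w) $ 2 $ 2 = b *\<^sub>R 1" "Rep_herm (H3 a b c x z w) $ 2 $ 3 = w"
  "Rep_herm (H3 a b c x z w) $ 3 $ 1 = conjg z" "Rep_herm (H3 a b c x z w) $ 3 $ 2 = conjg w"
  "Rep_herm (H3 a b c x z w) $ 3 $ 3 = c *\<^sub>R 1"
  by (simp_all add: Rep_H3 vector_3)

lemma H3_eq_iff [simp]:
  "H3 a b c x z w = H3 a' b' c' x' z' w' \<longleftrightarrow> a = a' \<and> b = b' \<and> c = c' \<and> x = x' \<and> z = z' \<and> w = w'"
proof
  assume *: "H3 a b c x z w = H3 a' b' c' x' z' w'"
  have nth: "Rep_herm (H3 a b c x z w) $ i $ j = Rep_herm (H3 a' b' c' x' z' w') $ i $ j" for i j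
    by (simp only: *)
  have one: "(1 :: octonion) \<noteq> 0" by simp
  show "a = a' \<and> b = b' \<and> c = c' \<and> x = x' \<and> z = z' \<and> w = w'"
    using nth[of 1 1] nth[of 2 2] nth[of 3 3] nth[of 1 2] nth[of 1 3] nth[of 2 3] one by simp
qed simp

lemma H3_cases:
  obtains a b c x z w where "A = H3 a b c x z w"
proof
  have diag: "Rep_herm A $ i $ i = inner 1 (Rep_herm A $ i $ i) *\<^sub>R 1" for i
    using conjg_eq_self_octonion[OF Rep_herm_conjg] .
  show "A = H3 (inner 1 (Rep_herm A $ 1 $ 1)) (inner 1 (Rep_herm A $ 2 $ 2)) (inner 1 (Rep_herm A $ 3 $ 3))
     (Rep_herm A $ 1 $ 2) (Rep_herm A $ 1 $ 3) (Rep_herm A $ 2 $ 3)"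
    using diag by (simp add: Rep_herm_inject[symmetric] vec_eq_iff forall_3 Rep_herm_conjg)
qed

lemma H3_add: "H3 a b c x z w + H3 a' b' c' x' z' w' = H3 (a + a') (b + b') (c + c') (x + x') (z + z') (w + w')"
  and H3_diff: "H3 a b c x z w - H3 a' b' c' x' z' w' = H3 (a - a') (b - b') (c - c') (x - x') (z - z') (w - w')"
  and H3_scaleR: "r *\<^sub>R H3 a b c x z w = H3 (r * a) (r * b) (r * c) (r *\<^sub>R x) (r *\<^sub>R z) (r *\<^sub>R w)"
  and H3_zero: "0 = H3 0 0 0 0 0 0"
  by (simp_all add: Rep_herm_inject[symmetric] vec_eq_iff forall_3 plus_herm.rep_eq minus_herm.rep_eq
      scaleR_herm.rep_eq zero_herm.rep_eq conjg_add conjg_diff conjg_scaleR scaleR_add_left scaleR_diff_left)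

lemma H3_inner:
  "inner (H3 a b c x z w) (H3 a' b' c' x' z' w')
     = a * a' + b * b' + c * c' + 2 * (inner x x' + inner z z' + inner w w')"
  by (simp add: inner_herm.rep_eq inner_vec_def sum_3 oct_inner_conjg oct_inner_one)

lemma H3_one: "Abs_herm (mat 1) = H3 1 1 1 0 0 0"
proof -
  have "Rep_herm (Abs_herm (mat 1)) = (mat 1 :: octonion^3^3)" by (simp add: Abs_herm_inverse)
  then show ?thesis
    by (simp add: Rep_herm_inject[symmetric] vec_eq_iff forall_3 mat_def)
qed

lemma jordan_H3:
  "jordan (H3 a1 a2 a3 x z w) (H3 b1 b2 b3 p q s) =
     H3 (a1 * b1 + inner x p + inner z q) (a2 * b2 + inner x p + inner w s) (a3 * b3 + inner z q + inner w s)
       ((1/2) *\<^sub>R ((a1 + a2) *\<^sub>R p + (b1 + b2) *\<^sub>R x + z * conjg s + q * conjg w))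
       ((1/2) *\<^sub>R ((a1 + a3) *\<^sub>R q + (b1 + b3) *\<^sub>R z + x * s + p * w))
       ((1/2) *\<^sub>R ((a2 + a3) *\<^sub>R s + (b2 + b3) *\<^sub>R w + conjg x * q + conjg p * z))"
    (is "_ = ?J")
proof -
  \<comment> \<open>Reversing one of the two products cancels the imaginary parts in the diagonal
    entries of the Jordan product.\<close>
  have two: "u * conjg v = (2 * inner u v) *\<^sub>R 1 - v * conjg u" for u v :: octonion
    using oct_mult_conjg_sum[of u v] by (simp add: algebra_simps)
  have two': "conjg u * v = (2 * inner u v) *\<^sub>R 1 - conjg v * u" for u v :: octonion
    using oct_mult_conjg_sum[of "conjg u" "conjg v"] by (simp add: oct_inner_conjg algebra_simps)
  have "(\<chi> i j. (1 / 2) *\<^sub>R (\<Sum>k\<in>UNIV. Rep_herm (H3 a1 a2 a3 x z w) $ i $ k * Rep_herm (H3 b1 b2 b3 p q s) $ k $ j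
      + Rep_herm (H3 b1 b2 b3 p q s) $ i $ k * Rep_herm (H3 a1 a2 a3 x z w) $ k $ j)) = Rep_herm ?J"
    by (simp add: vec_eq_iff forall_3 sum_3 oct_scaleR_left oct_scaleR_right oct_one conjg_add
        conjg_scaleR oct_conjg_mult two[of x p] two[of z q] two[of w s] two'[of x p] two'[of z q] two'[of w s])
      (simp add: algebra_simps flip: scaleR_add_left)
  then show ?thesis
    unfolding jordan_def by (simp only: Rep_herm_inverse)
qed

text \<open>The matrices \<open>u u\<^sup>*\<close> for column vectors \<open>u\<close> with one real entry.\<close>

definition "R1 u p q = H3 (u\<^sup>2) (inner p p) (inner q q) (u *\<^sub>R p) (u *\<^sub>R q) (conjg p * q)"
definition "R2 p u q = H3 (inner p p) (u\<^sup>2) (inner q q) (u *\<^sub>R p) (p * q) (u *\<^sub>R q)"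
definition "R3 p q u = H3 (inner p p) (inner q q) (u\<^sup>2) (p * conjg q) (u *\<^sub>R p) (u *\<^sub>R q)"

text \<open>Nonzero elements span the extreme rays of the symmetric cone. With one entry real, the
  other two generate an associative subalgebra by Artin's theorem, so that
  \<open>u u\<^sup>*\<close> behaves as it does over an associative algebra.\<close>

definition rank_one :: "(octonion, 3) herm set" where
  "rank_one = {R1 u p q | u p q. True} \<union> {R2 p u q | p u q. True} \<union> {R3 p q u | p q u. True}"

lemma rank_one_R [simp]: "R1 u p q \<in> rank_one" "R2 p u q \<in> rank_one" "R3 p q u \<in> rank_one"
  unfolding rank_one_def by blast+

lemma rank_one_cases:
  assumes "B \<in> rank_one"
  obtains u p q where "B = R1 u p q" | u p q where "B = R2 p u q" | u p q where "B = R3 p q u"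
  using assms unfolding rank_one_def by blast

lemma R_eq_zero_iff:
  "R1 u p q = 0 \<longleftrightarrow> u = 0 \<and> p = 0 \<and> q = 0" "R2 p u q = 0 \<longleftrightarrow> p = 0 \<and> u = 0 \<and> q = 0"
  "R3 p q u = 0 \<longleftrightarrow> p = 0 \<and> q = 0 \<and> u = 0"
  by (auto simp: R1_def R2_def R3_def H3_zero oct_mult_zero)

text \<open>The square of a self-adjoint matrix is the sum of its columns times their adjoints, and the
  diagonal entries are real.\<close>

lemma inner_jordan:
  "inner (H3 b1 b2 b3 p q s) (jordan A (H3 b1 b2 b3 p q s))
     = inner A (R1 b1 p q) + inner A (R2 p b2 s) + inner A (R3 q s b3)"
proof -
  obtain a1 a2 a3 x z w where A: "A = H3 a1 a2 a3 x z w" by (rule H3_cases)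
  have 1: "inner p (z * conjg s) = inner z (p * s)" "inner p (q * conjg w) = inner w (conjg p * q)"
    "inner q (x * s) = inner x (q * conjg s)" "inner q (p * w) = inner w (conjg p * q)"
    "inner s (conjg x * q) = inner x (q * conjg s)" "inner s (conjg p * z) = inner z (p * s)"
    using oct_inner_right[of p s z] oct_inner_right[of p w q] oct_inner_left[of p w q]
      oct_inner_right[of x s q] oct_inner_left[of x s q] oct_inner_left[of p s z]
    by (simp_all add: inner_commute)
  show ?thesis
    by (simp add: A jordan_H3 H3_inner R1_def R2_def R3_def inner_add_right 1 inner_commute[of p x]
        inner_commute[of q z] inner_commute[of s w] power2_eq_square)
      (simp add: field_simps)
qed

text \<open>The columns of a rank-one matrix are proportional, so each column times its adjoint is a
  multiple of that matrix. The alternative laws and multiplicativity of the norm are enough to see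
  this over the octonions.\<close>

lemma R1_square:
  "R1 (u\<^sup>2) (u *\<^sub>R p) (u *\<^sub>R q) = u\<^sup>2 *\<^sub>R R1 u p q"
  "R2 (u *\<^sub>R p) (inner p p) (conjg p * q) = inner p p *\<^sub>R R1 u p q"
  "R3 (u *\<^sub>R q) (conjg p * q) (inner q q) = inner q q *\<^sub>R R1 u p q"
  by (simp_all add: R1_def R2_def R3_def H3_scaleR oct_scaleR_left oct_scaleR_right oct_inner_mult_self
      oct_inner_conjg oct_alternative_left' oct_alternative_left oct_conjg_mult conjg_scaleR power2_eq_square mult_ac)

lemma R2_square:
  "R1 (inner p p) (u *\<^sub>R p) (p * q) = inner p p *\<^sub>R R2 p u q"
  "R2 (u *\<^sub>R p) (u\<^sup>2) (u *\<^sub>R q) = u\<^sup>2 *\<^sub>R R2 p u q"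
  "R3 (p * q) (u *\<^sub>R q) (inner q q) = inner q q *\<^sub>R R2 p u q"
  by (simp_all add: R1_def R2_def R3_def H3_scaleR oct_scaleR_left oct_scaleR_right oct_inner_mult_self
      oct_inner_conjg oct_alternative_left oct_alternative_right conjg_scaleR power2_eq_square mult_ac)

lemma R3_square:
  "R1 (inner p p) (p * conjg q) (u *\<^sub>R p) = inner p p *\<^sub>R R3 p q u"
  "R2 (p * conjg q) (inner q q) (u *\<^sub>R q) = inner q q *\<^sub>R R3 p q u"
  "R3 (u *\<^sub>R p) (u *\<^sub>R q) (u\<^sup>2) = u\<^sup>2 *\<^sub>R R3 p q u"
  by (simp_all add: R1_def R2_def R3_def H3_scaleR oct_scaleR_left oct_scaleR_right oct_inner_mult_self
      oct_inner_conjg oct_alternative_right' oct_conjg_mult conjg_scaleR power2_eq_square mult_ac)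

lemma inner_jordan_R:
  "inner (R1 u p q) (jordan A (R1 u p q)) = (u\<^sup>2 + inner p p + inner q q) * inner A (R1 u p q)"
  "inner (R2 p u q) (jordan A (R2 p u q)) = (u\<^sup>2 + inner p p + inner q q) * inner A (R2 p u q)"
  "inner (R3 p q u) (jordan A (R3 p q u)) = (u\<^sup>2 + inner p p + inner q q) * inner A (R3 p q u)"
  using inner_jordan[of "u\<^sup>2" "inner p p" "inner q q" "u *\<^sub>R p" "u *\<^sub>R q" "conjg p * q" A, folded R1_def[of u p q]]
    inner_jordan[of "inner p p" "u\<^sup>2" "inner q q" "u *\<^sub>R p" "p * q" "u *\<^sub>R q" A, folded R2_def[of p u q]]
    inner_jordan[of "inner p p" "inner q q" "u\<^sup>2" "p * conjg q" "u *\<^sub>R p" "u *\<^sub>R q" A, folded R3_def[of p q u]]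
  by (simp_all add: R1_square R2_square R3_square algebra_simps)

text \<open>Self-duality of the cone, tested on extreme rays. By \<open>inner_jordan\<close> the
  quadratic form at \<open>Y\<close> is a sum of pairings with three rank-one matrices, one for each
  column of \<open>Y\<close>; at a rank-one \<open>Y\<close> it reduces to a nonnegative multiple of
  the single pairing with \<open>Y\<close>.\<close>

lemma posdef_oct_rank_one: "posdef_oct = {A. \<forall>B\<in>rank_one. B \<noteq> 0 \<longrightarrow> inner A B > 0}"
proof (intro equalityI subsetI CollectI ballI impI)
  fix A B assume A: "A \<in> posdef_oct" and "B \<in> rank_one" and B: "B \<noteq> 0"
  then have "inner B (jordan A B) > 0" by (simp add: posdef_oct_def)
  moreover have "\<exists>r\<ge>0. inner B (jordan A B) = r * inner A B"
  proof -
    from \<open>B \<in> rank_one\<close> obtain u p q where "B = R1 u p q \<or> B = R2 p u q \<or> B = R3 p q u"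
      unfolding rank_one_def by blast
    then show ?thesis
      by (intro exI[of _ "u\<^sup>2 + inner p p + inner q q"]) (auto simp: inner_jordan_R)
  qed
  ultimately show "inner A B > 0" by (auto simp: zero_less_mult_iff)
next
  fix A assume A: "A \<in> {A. \<forall>B\<in>rank_one. B \<noteq> 0 \<longrightarrow> inner A B > 0}"
  have "inner Y (jordan A Y) > 0" if "Y \<noteq> 0" for Y
  proof -
    obtain b1 b2 b3 p q s where Y: "Y = H3 b1 b2 b3 p q s" by (rule H3_cases)
    let ?B1 = "R1 b1 p q" and ?B2 = "R2 p b2 s" and ?B3 = "R3 q s b3"
    have r: "?B1 \<in> rank_one" "?B2 \<in> rank_one" "?B3 \<in> rank_one" by simp_all
    have pos: "B \<noteq> 0 \<Longrightarrow> inner A B > 0" "inner A B \<ge> 0" if "B \<in> rank_one" for B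
      using A that by (cases "B = 0"; force)+
    have "?B1 \<noteq> 0 \<or> ?B2 \<noteq> 0 \<or> ?B3 \<noteq> 0"
    proof (rule ccontr)
      assume "\<not> ?thesis"
      then have "b1 = 0 \<and> p = 0 \<and> q = 0 \<and> b2 = 0 \<and> s = 0 \<and> b3 = 0" by (simp add: R_eq_zero_iff)
      then show False using \<open>Y \<noteq> 0\<close> by (simp add: Y H3_zero)
    qed
    with pos[OF r(1)] pos[OF r(2)] pos[OF r(3)] show ?thesis
      unfolding Y inner_jordan by linarith
  qed
  then show "A \<in> posdef_oct" by (simp add: posdef_oct_def)
qed

lemma bilinear_jordan: "bilinear jordan"
  unfolding bilinear_def
proof (intro conjI allI; rule linearI)
  fix A B C :: "(octonion, 3) herm" and r :: real
  obtain a1 a2 a3 x z w where A: "A = H3 a1 a2 a3 x z w" by (rule H3_cases)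
  obtain b1 b2 b3 p q s where B: "B = H3 b1 b2 b3 p q s" by (rule H3_cases)
  obtain c1 c2 c3 k l n where C: "C = H3 c1 c2 c3 k l n" by (rule H3_cases)
  note [simp] = A B C H3_add H3_scaleR jordan_H3 oct_distrib_left oct_distrib_right oct_scaleR_left
    oct_scaleR_right conjg_add conjg_scaleR inner_add_left inner_add_right scaleR_add_left scaleR_add_right
  show "jordan A (B + C) = jordan A B + jordan A C" "jordan (B + C) A = jordan B A + jordan C A"
    by (simp_all add: algebra_simps add_divide_distrib)
  show "jordan A (r *\<^sub>R B) = r *\<^sub>R jordan A B" "jordan (r *\<^sub>R B) A = r *\<^sub>R jordan B A"
    by (simp_all add: algebra_simps)
qed

lemma open_posdef_oct: "open posdef_oct"
proof -
  interpret jordan: bounded_bilinear jordan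
    using bilinear_jordan by (simp add: bilinear_conv_bounded_bilinear)
  have "posdef_oct = {A. \<forall>Y\<in>sphere 0 1. inner Y (jordan A Y) > 0}"
    unfolding posdef_oct_def
    by (subst positive_quadratic_iff_sphere) (simp_all add: jordan.scaleR_right power2_eq_square)
  moreover have "continuous_on UNIV (\<lambda>z. inner (snd z) (jordan (fst z) (snd z)))"
    by (intro continuous_intros jordan.continuous_on)
  from open_positive_on_compact[OF compact_sphere this, of 0 1]
  have "open {A. \<forall>Y\<in>sphere 0 1. inner Y (jordan A Y) > 0}" by simp
  ultimately show ?thesis by simp
qed

section \<open>Multiplication operators\<close>

datatype coord = K1 | K2 | K3 | K4

definition mk :: "(coord \<Rightarrow> complex) \<Rightarrow> octonion" where
  "mk f = CD (CD (f K1) (f K2)) (CD (f K3) (f K4))"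

fun co :: "coord \<Rightarrow> octonion \<Rightarrow> complex" where
  "co K1 x = cd_fst (cd_fst x)"
| "co K2 x = cd_snd (cd_fst x)"
| "co K3 x = cd_fst (cd_snd x)"
| "co K4 x = cd_snd (cd_snd x)"

lemma co_mk [simp]: "co k (mk f) = f k"
  by (cases k) (simp_all add: mk_def)

lemma oct_eqI: "(\<And>k. co k x = co k y) \<Longrightarrow> x = y"
  by (metis cd.expand co.simps)

lemma co_linear [simp]:
  "co k (x + y) = co k x + co k y" "co k (x - y) = co k x - co k y" "co k (- x) = - co k x"
  "co k (r *\<^sub>R x) = r *\<^sub>R co k x" "co k 0 = 0"
  by (cases k; simp add: plus_cd_def minus_cd_def uminus_cd_def scaleR_cd_def zero_cd_def)+

lemma inner_co:
  "inner x y = inner (co K1 x) (co K1 y) + inner (co K2 x) (co K2 y) + inner (co K3 x) (co K3 y) + inner (co K4 x) (co K4 y)"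
  by (simp add: inner_cd_def)

text \<open>Coordinatewise product in four complex coordinates, unrelated to octonion
  multiplication: the operators that are complex diagonal in these coordinates.\<close>

definition tw :: "octonion \<Rightarrow> octonion \<Rightarrow> octonion" where
  "tw m x = mk (\<lambda>k. co k m * co k x)"

lemma co_tw [simp]: "co k (tw m x) = co k m * co k x"
  by (simp add: tw_def)

lemma tw_algebra:
  "tw m x = tw x m" "tw m (tw n x) = tw (tw m n) x" "tw m (x + y) = tw m x + tw m y"
  "tw (m + n) x = tw m x + tw n x" "tw m (r *\<^sub>R x) = r *\<^sub>R tw m x" "tw (r *\<^sub>R m) x = r *\<^sub>R tw m x"
  "tw (mk (\<lambda>_. 1)) x = x" "tw m 0 = 0" "tw (m - n) x = tw m x - tw n x"
  by (rule oct_eqI; simp add: algebra_simps)+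

definition cinj :: "coord \<Rightarrow> complex \<Rightarrow> octonion" where
  "cinj k c = mk (\<lambda>j. if j = k then c else 0)"

lemma co_cinj: "co l (cinj k c) = (if l = k then c else 0)"
  by (simp add: cinj_def)

lemma cinj_sum: "x = cinj K1 (co K1 x) + cinj K2 (co K2 x) + cinj K3 (co K3 x) + cinj K4 (co K4 x)"
  by (rule oct_eqI, case_tac k) (simp_all add: co_cinj)

lemma linear_cinj: "linear (cinj k)"
  by (rule linearI; rule oct_eqI) (simp_all add: co_cinj)

lemma mk_cinj: "mk f = cinj K1 (f K1) + cinj K2 (f K2) + cinj K3 (f K3) + cinj K4 (f K4)"
  using cinj_sum[of "mk f"] by simp

lemma sums_mk:
  assumes "\<And>k. (\<lambda>n. f n k) sums g k"
  shows "(\<lambda>n. mk (f n)) sums mk g"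
  unfolding mk_cinj
  by (intro sums_add bounded_linear.sums[OF linear_cinj[unfolded linear_conv_bounded_linear]] assms)

lemma inner_tw: "inner (tw m x) y = inner x (tw (mk (\<lambda>k. cnj (co k m))) y)"
  by (simp add: inner_co inner_complex_def algebra_simps)

lemma oct_mult_CD:
  "CD (CD a b) (CD c d) * CD (CD a' b') (CD c' d') =
     CD (CD (a * a' - cnj b' * b - cnj c' * c - d' * cnj d) (a * b' + b * cnj a' - d * cnj c' + d' * cnj c))
        (CD (a * c' - cnj b * d' + c * cnj a' + d * cnj b') (b * c' + cnj a * d' - b' * c + d * a'))"
  by (simp add: times_cd_def conjg_cd_def conjg_complex_def minus_cd_def plus_cd_def)

lemma tw_CD: "tw (mk f) (CD (CD a b) (CD c d)) = CD (CD (f K1 * a) (f K2 * b)) (CD (f K3 * c) (f K4 * d))"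
  by (simp add: tw_def mk_def)

text \<open>The sixteen conditions correspond to the monomials of the octonion product in the four
  complex coordinates.\<close>

lemma tw_mult:
  assumes "G K1 = A K1 * B K1" "G K1 = A K2 * cnj (B K2)" "G K1 = A K3 * cnj (B K3)" "G K1 = cnj (A K4) * B K4"
    and "G K2 = A K1 * B K2" "G K2 = A K2 * cnj (B K1)" "G K2 = A K4 * cnj (B K3)" "G K2 = cnj (A K3) * B K4"
    and "G K3 = A K1 * B K3" "G K3 = cnj (A K2) * B K4" "G K3 = A K3 * cnj (B K1)" "G K3 = A K4 * cnj (B K2)"
    and "G K4 = A K2 * B K3" "G K4 = cnj (A K1) * B K4" "G K4 = A K3 * B K2" "G K4 = A K4 * B K1"
  shows "tw (mk G) (x * y) = tw (mk A) x * tw (mk B) y"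
proof -
  obtain a b c d where x: "x = CD (CD a b) (CD c d)" by (metis cd.exhaust)
  obtain a' b' c' d' where y: "y = CD (CD a' b') (CD c' d')" by (metis cd.exhaust)
  have "G K1 * (a * a') = A K1 * a * (B K1 * a')" "G K1 * (cnj b' * b) = cnj (B K2 * b') * (A K2 * b)"
    "G K1 * (cnj c' * c) = cnj (B K3 * c') * (A K3 * c)" "G K1 * (d' * cnj d) = (B K4 * d') * cnj (A K4 * d)"
    by (simp only: assms(1) mult_ac, simp only: assms(2) complex_cnj_mult mult_ac,
        simp only: assms(3) complex_cnj_mult mult_ac, simp only: assms(4) complex_cnj_mult mult_ac)
  moreover have "G K2 * (a * b') = A K1 * a * (B K2 * b')" "G K2 * (b * cnj a') = A K2 * b * cnj (B K1 * a')"
    "G K2 * (d * cnj c') = A K4 * d * cnj (B K3 * c')" "G K2 * (d' * cnj c) = (B K4 * d') * cnj (A K3 * c)"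
    by (simp only: assms(5) mult_ac, simp only: assms(6) complex_cnj_mult mult_ac,
        simp only: assms(7) complex_cnj_mult mult_ac, simp only: assms(8) complex_cnj_mult mult_ac)
  moreover have "G K3 * (a * c') = A K1 * a * (B K3 * c')" "G K3 * (cnj b * d') = cnj (A K2 * b) * (B K4 * d')"
    "G K3 * (c * cnj a') = A K3 * c * cnj (B K1 * a')" "G K3 * (d * cnj b') = (A K4 * d) * cnj (B K2 * b')"
    by (simp only: assms(9) mult_ac, simp only: assms(10) complex_cnj_mult mult_ac,
        simp only: assms(11) complex_cnj_mult mult_ac, simp only: assms(12) complex_cnj_mult mult_ac)
  moreover have "G K4 * (b * c') = A K2 * b * (B K3 * c')" "G K4 * (cnj a * d') = cnj (A K1 * a) * (B K4 * d')"
    "G K4 * (b' * c) = (B K2 * b') * (A K3 * c)" "G K4 * (d * a') = (A K4 * d) * (B K1 * a')"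
    by (simp only: assms(13) mult_ac, simp only: assms(14) complex_cnj_mult mult_ac,
        simp only: assms(15) mult_ac, simp only: assms(16) mult_ac)
  ultimately have
    "G K1 * (a * a' - cnj b' * b - cnj c' * c - d' * cnj d)
       = A K1 * a * (B K1 * a') - cnj (B K2 * b') * (A K2 * b) - cnj (B K3 * c') * (A K3 * c) - (B K4 * d') * cnj (A K4 * d)"
    "G K2 * (a * b' + b * cnj a' - d * cnj c' + d' * cnj c)
       = A K1 * a * (B K2 * b') + A K2 * b * cnj (B K1 * a') - A K4 * d * cnj (B K3 * c') + (B K4 * d') * cnj (A K3 * c)"
    "G K3 * (a * c' - cnj b * d' + c * cnj a' + d * cnj b')
       = A K1 * a * (B K3 * c') - cnj (A K2 * b) * (B K4 * d') + A K3 * c * cnj (B K1 * a') + (A K4 * d) * cnj (B K2 * b')"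
    "G K4 * (b * c' + cnj a * d' - b' * c + d * a')
       = A K2 * b * (B K3 * c') + cnj (A K1 * a) * (B K4 * d') - (B K2 * b') * (A K3 * c) + (A K4 * d) * (B K1 * a')"
    by (simp_all only: right_diff_distrib distrib_left)
  then show ?thesis
    unfolding x y tw_CD oct_mult_CD by (simp only:)
qed

text \<open>The maximal torus of \<open>Spin(8)\<close>: its weights on the three eight-dimensional representations,
  the first being the standard one.\<close>

definition be :: "(coord \<Rightarrow> real) \<Rightarrow> coord \<Rightarrow> real" where
  "be t k = (case k of K1 \<Rightarrow> (t K2 + t K3 - t K1 - t K4) / 2 | K2 \<Rightarrow> (t K2 + t K4 - t K1 - t K3) / 2
     | K3 \<Rightarrow> (t K3 + t K4 - t K1 - t K2) / 2 | K4 \<Rightarrow> (t K1 + t K2 + t K3 + t K4) / 2)"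

text \<open>For phases, the sixteen conditions of \<open>tw_mult\<close> become linear equations
  between angles, such as \<open>ga t K1 = t K1 + be t K1 = t K2 - be t K2\<close>. Solving them for
  given \<open>t\<close> yields these formulas.\<close>

definition ga :: "(coord \<Rightarrow> real) \<Rightarrow> coord \<Rightarrow> real" where
  "ga t k = (case k of K1 \<Rightarrow> (t K1 + t K2 + t K3 - t K4) / 2 | K2 \<Rightarrow> (t K1 + t K2 + t K4 - t K3) / 2
     | K3 \<Rightarrow> (t K1 + t K3 + t K4 - t K2) / 2 | K4 \<Rightarrow> (t K2 + t K3 + t K4 - t K1) / 2)"

lemma be_ga_linear:
  "be (\<lambda>k. s k + t k) = (\<lambda>k. be s k + be t k)" "ga (\<lambda>k. s k + t k) = (\<lambda>k. ga s k + ga t k)"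
  "be (\<lambda>k. r * t k) = (\<lambda>k. r * be t k)" "ga (\<lambda>k. r * t k) = (\<lambda>k. r * ga t k)"
  "be (\<lambda>k. - t k) = (\<lambda>k. - be t k)" "ga (\<lambda>k. - t k) = (\<lambda>k. - ga t k)"
  "be (\<lambda>_. 0) = (\<lambda>_. 0)" "ga (\<lambda>_. 0) = (\<lambda>_. 0)"
  by (rule ext, simp add: be_def ga_def field_simps split: coord.split)+

text \<open>Both maps are orthogonal matrices with entries 1/2 and -1/2. That of \<open>ga\<close>
  is symmetric and hence its own inverse; for \<open>be\<close> the witness is the transpose. Thus
  each of the three off-diagonal blocks sees every choice of angles.\<close>

lemma be_ga_surj: "\<exists>s. be s = t" "\<exists>s. ga s = t"
proof -
  have "be (\<lambda>k. case k of K1 \<Rightarrow> (t K4 - t K1 - t K2 - t K3) / 2 | K2 \<Rightarrow> (t K1 + t K2 + t K4 - t K3) / 2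
     | K3 \<Rightarrow> (t K1 + t K3 + t K4 - t K2) / 2 | K4 \<Rightarrow> (t K2 + t K3 + t K4 - t K1) / 2) = t"
    by (rule ext) (simp add: be_def field_simps split: coord.split)
  then show "\<exists>s. be s = t" by blast
  have "ga (\<lambda>k. case k of K1 \<Rightarrow> (t K1 + t K2 + t K3 - t K4) / 2 | K2 \<Rightarrow> (t K1 + t K2 + t K4 - t K3) / 2
     | K3 \<Rightarrow> (t K1 + t K3 + t K4 - t K2) / 2 | K4 \<Rightarrow> (t K2 + t K3 + t K4 - t K1) / 2) = t"
    by (rule ext) (simp add: ga_def field_simps split: coord.split)
  then show "\<exists>s. ga s = t" by blast
qed

section \<open>Triality for the torus of phases\<close>

definition ph :: "(coord \<Rightarrow> real) \<Rightarrow> octonion" where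
  "ph t = mk (\<lambda>k. cis (t k))"

lemma tw_ph_minus: "tw (ph t) (ph (\<lambda>k. - t k)) = mk (\<lambda>_. 1)"
  by (rule oct_eqI) (simp add: ph_def cis_mult)

lemma inner_tw_ph: "inner (tw (ph t) x) y = inner x (tw (ph (\<lambda>k. - t k)) y)"
  by (simp add: inner_tw ph_def cis_cnj)

lemma inner_tw_ph_self: "inner (tw (ph t) x) (tw (ph t) x) = inner x x"
  by (simp add: inner_tw_ph tw_algebra(2) tw_algebra(7) tw_algebra(1)[of "ph (\<lambda>k. - t k)"] tw_ph_minus)

lemma triality: "tw (ph (ga t)) (x * y) = tw (ph t) x * tw (ph (be t)) y"
  unfolding ph_def
  by (rule tw_mult; simp only: cis_cnj cis_mult; rule arg_cong[of _ _ cis]; simp add: be_def ga_def field_simps)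

text \<open>Multiplying by the transformed \<open>x\<close> or \<open>y\<close> reduces both claims
  to \<open>triality\<close> and an alternative law; a nonzero octonion can be cancelled, and phases
  preserve the norm.\<close>

lemma triality':
  "tw (ph (be t)) (conjg x * z) = conjg (tw (ph t) x) * tw (ph (ga t)) z"
  "tw (ph t) (z * conjg y) = tw (ph (ga t)) z * conjg (tw (ph (be t)) y)"
proof -
  show "tw (ph (be t)) (conjg x * z) = conjg (tw (ph t) x) * tw (ph (ga t)) z"
  proof (cases "x = 0")
    case False
    let ?x = "tw (ph t) x"
    have "?x * tw (ph (be t)) (conjg x * z) = inner x x *\<^sub>R tw (ph (ga t)) z"
      by (simp add: triality[symmetric] oct_alternative_left' tw_algebra(5))
    then have "conjg ?x * (?x * tw (ph (be t)) (conjg x * z)) = inner x x *\<^sub>R (conjg ?x * tw (ph (ga t)) z)"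
      by (simp add: oct_scaleR_right)
    then show ?thesis using False by (simp add: oct_alternative_left inner_tw_ph_self)
  qed (simp add: oct_mult_zero tw_algebra(8))
  show "tw (ph t) (z * conjg y) = tw (ph (ga t)) z * conjg (tw (ph (be t)) y)"
  proof (cases "y = 0")
    case False
    let ?y = "tw (ph (be t)) y"
    have "tw (ph t) (z * conjg y) * ?y = inner y y *\<^sub>R tw (ph (ga t)) z"
      by (simp add: triality[symmetric] oct_alternative_right' tw_algebra(5))
    then have "(tw (ph t) (z * conjg y) * ?y) * conjg ?y = inner y y *\<^sub>R (tw (ph (ga t)) z * conjg ?y)"
      by (simp add: oct_scaleR_left)
    then show ?thesis using False by (simp add: oct_alternative_right inner_tw_ph_self)
  qed (simp add: oct_mult_zero tw_algebra(8))
qed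

section \<open>Entrywise multiplication of self-adjoint matrices\<close>

definition hprod :: "(octonion, 3) herm \<Rightarrow> (octonion, 3) herm \<Rightarrow> (octonion, 3) herm" where
  "hprod A B = H3 (inner 1 (Rep_herm A $ 1 $ 1) * inner 1 (Rep_herm B $ 1 $ 1))
     (inner 1 (Rep_herm A $ 2 $ 2) * inner 1 (Rep_herm B $ 2 $ 2))
     (inner 1 (Rep_herm A $ 3 $ 3) * inner 1 (Rep_herm B $ 3 $ 3))
     (tw (Rep_herm A $ 1 $ 2) (Rep_herm B $ 1 $ 2)) (tw (Rep_herm A $ 1 $ 3) (Rep_herm B $ 1 $ 3))
     (tw (Rep_herm A $ 2 $ 3) (Rep_herm B $ 2 $ 3))"

lemma hprod_H3 [simp]:
  "hprod (H3 a b c x z w) (H3 a' b' c' x' z' w') = H3 (a * a') (b * b') (c * c') (tw x x') (tw z z') (tw w w')"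
  by (simp add: hprod_def oct_inner_one)

definition hone :: "(octonion, 3) herm" where
  "hone = H3 1 1 1 (mk (\<lambda>_. 1)) (mk (\<lambda>_. 1)) (mk (\<lambda>_. 1))"

lemma hprod_commute: "hprod A B = hprod B A"
  unfolding hprod_def by (simp only: tw_algebra(1)[of "Rep_herm A $ _ $ _"] mult.commute[of "inner 1 (Rep_herm A $ _ $ _)"])

lemma hprod_algebra:
  "hprod A (hprod B C) = hprod (hprod A B) C" "hprod hone A = A"
  "hprod A (B + C) = hprod A B + hprod A C" "hprod (A + B) C = hprod A C + hprod B C"
  "hprod A (r *\<^sub>R B) = r *\<^sub>R hprod A B" "hprod (r *\<^sub>R A) B = r *\<^sub>R hprod A B"
  by (cases A rule: H3_cases; cases B rule: H3_cases; cases C rule: H3_cases;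
      simp add: hone_def H3_add H3_scaleR tw_algebra(2-7) distrib_left distrib_right mult_ac)+

text \<open>These operators form a commutative algebra containing every torus element, so brackets
  vanish there and exponential series are computed entry by entry.\<close>

definition Mop :: "(octonion, 3) herm \<Rightarrow> (octonion, 3) herm \<Rightarrow>\<^sub>L (octonion, 3) herm" where
  "Mop A = Blinfun (hprod A)"

lemma Mop_apply [simp]: "blinfun_apply (Mop A) B = hprod A B"
proof -
  have "linear (hprod A)" by (rule linearI) (simp_all add: hprod_algebra(3,5))
  then have "bounded_linear (hprod A)" by (simp add: linear_conv_bounded_linear)
  then show ?thesis by (simp add: Mop_def bounded_linear_Blinfun_apply)
qed

lemma linear_Mop: "linear Mop"
  by (rule linearI; rule blinfun_eqI) (simp_all add: hprod_algebra(4,6) plus_blinfun.rep_eq scaleR_blinfun.rep_eq)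

lemma Mop_compose: "Mop A o\<^sub>L Mop B = Mop (hprod A B)"
  by (rule blinfun_eqI) (simp add: hprod_algebra(1))

lemma Mop_hone: "id_blinfun = Mop hone"
  by (rule blinfun_eqI) (simp add: hprod_algebra(2))

lemma octonion_space_simps [simp]:
  "gmul octonion_space = (o\<^sub>L)" "gone octonion_space = id_blinfun"
  "gstar octonion_space = (\<lambda>g. Blinfun (adjoint (blinfun_apply g)))"
  "grp octonion_space = {g. bij (blinfun_apply g) \<and> blinfun_apply g ` posdef_oct = posdef_oct}"
  "act octonion_space = blinfun_apply" "cone octonion_space = posdef_oct"
  "base octonion_space = H3 1 1 1 0 0 0"
  by (simp_all add: octonion_space_def H3_one)

lemma sums_H3:
  assumes "a sums a'" "b sums b'" "c sums c'" "x sums x'" "z sums z'" "w sums w'"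
  shows "(\<lambda>n. H3 (a n) (b n) (c n) (x n) (z n) (w n)) sums H3 a' b' c' x' z' w'"
proof -
  have split: "H3 a b c x z w = H3 a 0 0 0 0 0 + H3 0 b 0 0 0 0 + H3 0 0 c 0 0 0
      + H3 0 0 0 x 0 0 + H3 0 0 0 0 z 0 + H3 0 0 0 0 0 w" for a b c x z w
    by (simp add: H3_add)
  have lin: "bounded_linear (\<lambda>a. H3 a 0 0 0 0 0)" "bounded_linear (\<lambda>b. H3 0 b 0 0 0 0)"
    "bounded_linear (\<lambda>c. H3 0 0 c 0 0 0)" "bounded_linear (\<lambda>x. H3 0 0 0 x 0 0)"
    "bounded_linear (\<lambda>z. H3 0 0 0 0 z 0)" "bounded_linear (\<lambda>w. H3 0 0 0 0 0 w)"
    unfolding linear_conv_bounded_linear[symmetric] by (simp_all add: linear_iff H3_add H3_scaleR)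
  have "(\<lambda>n. H3 (a n) 0 0 0 0 0 + H3 0 (b n) 0 0 0 0 + H3 0 0 (c n) 0 0 0
      + H3 0 0 0 (x n) 0 0 + H3 0 0 0 0 (z n) 0 + H3 0 0 0 0 0 (w n)) sums
      (H3 a' 0 0 0 0 0 + H3 0 b' 0 0 0 0 + H3 0 0 c' 0 0 0
      + H3 0 0 0 x' 0 0 + H3 0 0 0 0 z' 0 + H3 0 0 0 0 0 w')"
    by (intro sums_add bounded_linear.sums[OF lin(1) assms(1)] bounded_linear.sums[OF lin(2) assms(2)]
        bounded_linear.sums[OF lin(3) assms(3)] bounded_linear.sums[OF lin(4) assms(4)]
        bounded_linear.sums[OF lin(5) assms(5)] bounded_linear.sums[OF lin(6) assms(6)])
  then show ?thesis by (simp only: split[symmetric])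
qed

text \<open>The exponential for the product \<open>tw\<close>, not for octonion
  multiplication.\<close>

definition oexp :: "octonion \<Rightarrow> octonion" where
  "oexp x = mk (\<lambda>k. exp (co k x))"

lemma gexp_Mop:
  "gexp octonion_space (Mop (H3 a b c x z w)) = Mop (H3 (exp a) (exp b) (exp c) (oexp x) (oexp z) (oexp w))"
    (is "gexp _ (Mop ?A) = Mop ?E")
proof -
  have pow: "((o\<^sub>L) (Mop ?A) ^^ n) id_blinfun = Mop (H3 (a ^ n) (b ^ n) (c ^ n)
      (mk (\<lambda>k. co k x ^ n)) (mk (\<lambda>k. co k z ^ n)) (mk (\<lambda>k. co k w ^ n)))" for n
    by (induction n) (simp_all add: Mop_hone hone_def Mop_compose tw_def)
  have o: "(\<lambda>n. mk (\<lambda>k. co k y ^ n /\<^sub>R fact n)) sums oexp y" for y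
    unfolding oexp_def by (intro sums_mk exp_converges)
  have mk: "r *\<^sub>R mk f = mk (\<lambda>k. r *\<^sub>R f k)" for r f by (rule oct_eqI) simp
  have "(\<lambda>n. H3 (a ^ n /\<^sub>R fact n) (b ^ n /\<^sub>R fact n) (c ^ n /\<^sub>R fact n)
      (mk (\<lambda>k. co k x ^ n /\<^sub>R fact n)) (mk (\<lambda>k. co k z ^ n /\<^sub>R fact n)) (mk (\<lambda>k. co k w ^ n /\<^sub>R fact n))) sums ?E"
    by (intro sums_H3 exp_converges o)
  also have "(\<lambda>n. H3 (a ^ n /\<^sub>R fact n) (b ^ n /\<^sub>R fact n) (c ^ n /\<^sub>R fact n)
      (mk (\<lambda>k. co k x ^ n /\<^sub>R fact n)) (mk (\<lambda>k. co k z ^ n /\<^sub>R fact n)) (mk (\<lambda>k. co k w ^ n /\<^sub>R fact n)))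
    = (\<lambda>n. (1 / fact n) *\<^sub>R H3 (a ^ n) (b ^ n) (c ^ n)
      (mk (\<lambda>k. co k x ^ n)) (mk (\<lambda>k. co k z ^ n)) (mk (\<lambda>k. co k w ^ n)))"
    by (simp add: H3_scaleR mk divide_inverse)
  finally have "(\<lambda>n. Mop ((1 / fact n) *\<^sub>R H3 (a ^ n) (b ^ n) (c ^ n)
      (mk (\<lambda>k. co k x ^ n)) (mk (\<lambda>k. co k z ^ n)) (mk (\<lambda>k. co k w ^ n)))) sums Mop ?E"
    by (rule bounded_linear.sums[OF linear_Mop[unfolded linear_conv_bounded_linear]])
  from sums_unique[OF this] show ?thesis
    unfolding gexp_def octonion_space_simps pow linear_scale[OF linear_Mop] by simp
qed

section \<open>A subgroup of the automorphism group of the cone\<close>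

text \<open>The multiplier of the map \<open>A \<mapsto> D A D\<close> for \<open>D\<close> diagonal
  with entries \<open>r1\<close>, \<open>r2\<close>, \<open>r3\<close>, combined with a triality
  triple of phases on the off-diagonal entries.\<close>

definition gel :: "real \<Rightarrow> real \<Rightarrow> real \<Rightarrow> (coord \<Rightarrow> real) \<Rightarrow> (octonion, 3) herm" where
  "gel r1 r2 r3 t = H3 (r1\<^sup>2) (r2\<^sup>2) (r3\<^sup>2) ((r1 * r2) *\<^sub>R ph t) ((r1 * r3) *\<^sub>R ph (ga t)) ((r2 * r3) *\<^sub>R ph (be t))"

text \<open>The operator transforms the underlying column vector entry by entry; triality is exactly
  what makes this compatible with the entry that is a product of two octonions.\<close>

lemma gel_rank_one:
  assumes "B \<in> rank_one"
  shows "hprod (gel r1 r2 r3 t) B \<in> rank_one"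
proof -
  have "hprod (gel r1 r2 r3 t) (R1 u p q) = R1 (r1 * u) (r2 *\<^sub>R tw (ph t) p) (r3 *\<^sub>R tw (ph (ga t)) q)"
    "hprod (gel r1 r2 r3 t) (R2 p u q) = R2 (r1 *\<^sub>R tw (ph t) p) (r2 * u) (r3 *\<^sub>R tw (ph (be t)) q)"
    "hprod (gel r1 r2 r3 t) (R3 p q u) = R3 (r1 *\<^sub>R tw (ph (ga t)) p) (r2 *\<^sub>R tw (ph (be t)) q) (r3 * u)" for u p q
    by (simp_all add: gel_def R1_def R2_def R3_def tw_algebra(5,6) triality triality' conjg_scaleR oct_scaleR_left
        oct_scaleR_right inner_tw_ph_self power2_eq_square mult_ac)
  with assms show ?thesis by (elim rank_one_cases) (simp_all only: rank_one_R)
qed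

lemma gel_inverse:
  assumes "r1 \<noteq> 0" "r2 \<noteq> 0" "r3 \<noteq> 0"
  shows "hprod (gel r1 r2 r3 t) (hprod (gel (inverse r1) (inverse r2) (inverse r3) (\<lambda>k. - t k)) A) = A"
proof -
  have "hprod (gel r1 r2 r3 t) (gel (inverse r1) (inverse r2) (inverse r3) (\<lambda>k. - t k)) = hone"
    using assms by (simp add: gel_def hone_def tw_algebra(5,6) be_ga_linear tw_ph_minus field_simps power2_eq_square)
  then show ?thesis by (simp add: hprod_algebra(1,2))
qed

lemma inner_gel: "inner (hprod (gel r1 r2 r3 t) A) B = inner A (hprod (gel r1 r2 r3 (\<lambda>k. - t k)) B)"
  by (cases A rule: H3_cases; cases B rule: H3_cases)
    (simp add: gel_def H3_inner tw_algebra(6) be_ga_linear inner_tw_ph algebra_simps)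

text \<open>In the dual description of the cone it suffices that the adjoint preserves nonzero
  rank-one matrices, and the adjoint is an operator of the same kind with opposite phases.\<close>

lemma gel_cone:
  assumes "r1 \<noteq> 0" "r2 \<noteq> 0" "r3 \<noteq> 0" "A \<in> posdef_oct"
  shows "hprod (gel r1 r2 r3 t) A \<in> posdef_oct"
  unfolding posdef_oct_rank_one
proof (intro CollectI ballI impI)
  fix B assume B: "B \<in> rank_one" "B \<noteq> 0"
  let ?C = "hprod (gel r1 r2 r3 (\<lambda>k. - t k)) B"
  have "?C \<noteq> 0"
  proof
    assume "?C = 0"
    then have "hprod (gel (inverse r1) (inverse r2) (inverse r3) t) ?C = 0"
      using hprod_algebra(5)[of _ 0 0] by simp
    moreover have "hprod (gel (inverse r1) (inverse r2) (inverse r3) t) ?C = B"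
      using gel_inverse[of "inverse r1" "inverse r2" "inverse r3" t] assms(1-3) by simp
    ultimately show False using B(2) by simp
  qed
  then show "inner (hprod (gel r1 r2 r3 t) A) B > 0"
    unfolding inner_gel using assms(4) gel_rank_one[OF B(1)] by (simp add: posdef_oct_rank_one)
qed

lemma gel_grp:
  assumes "r1 \<noteq> 0" "r2 \<noteq> 0" "r3 \<noteq> 0"
  shows "Mop (gel r1 r2 r3 t) \<in> grp octonion_space"
proof -
  let ?g = "hprod (gel r1 r2 r3 t)" and ?h = "hprod (gel (inverse r1) (inverse r2) (inverse r3) (\<lambda>k. - t k))"
  have gh: "?g (?h A) = A" for A by (rule gel_inverse[OF assms])
  have hg: "?h (?g A) = A" for A
    using gel_inverse[of "inverse r1" "inverse r2" "inverse r3" "\<lambda>k. - t k"] assms by simp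
  have "bij ?g" by (rule o_bij[of ?h]) (auto simp: gh hg)
  moreover have "?g ` posdef_oct = posdef_oct"
  proof (intro equalityI subsetI)
    fix A assume "A \<in> posdef_oct"
    then have "?h A \<in> posdef_oct" using assms by (intro gel_cone) auto
    then have "?g (?h A) \<in> ?g ` posdef_oct" by (rule imageI)
    then show "A \<in> ?g ` posdef_oct" by (simp only: gh)
  qed (use gel_cone[OF assms] in auto)
  moreover have "blinfun_apply (Mop (gel r1 r2 r3 t)) = ?g" by (rule ext) simp
  ultimately show ?thesis by simp
qed

definition wt :: "real \<Rightarrow> (coord \<Rightarrow> real) \<Rightarrow> octonion" where
  "wt s t = mk (\<lambda>k. Complex s (t k))"

text \<open>The infinitesimal generator of \<open>gel\<close> for
  \<open>r_i = exp (d_i / 2)\<close>: a diagonal entry grows at its own rate, an off-diagonal one at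
  the mean of two rates, and the angles are the imaginary parts.\<close>

definition tor :: "real \<Rightarrow> real \<Rightarrow> real \<Rightarrow> (coord \<Rightarrow> real) \<Rightarrow> (octonion, 3) herm" where
  "tor d1 d2 d3 t = H3 d1 d2 d3 (wt ((d1 + d2) / 2) t) (wt ((d1 + d3) / 2) (ga t)) (wt ((d2 + d3) / 2) (be t))"

lemma tor_linear:
  "tor d1 d2 d3 t + tor e1 e2 e3 s = tor (d1 + e1) (d2 + e2) (d3 + e3) (\<lambda>k. t k + s k)"
  "r *\<^sub>R tor d1 d2 d3 t = tor (r * d1) (r * d2) (r * d3) (\<lambda>k. r * t k)"
  "tor 0 0 0 (\<lambda>_. 0) = 0"
proof -
  have "wt s t + wt s' t' = wt (s + s') (\<lambda>k. t k + t' k)" "r *\<^sub>R wt s t = wt (r * s) (\<lambda>k. r * t k)"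
    "wt 0 (\<lambda>_. 0) = 0" for s s' t t'
    by (rule oct_eqI; simp add: wt_def complex_eq_iff)+
  then show "tor d1 d2 d3 t + tor e1 e2 e3 s = tor (d1 + e1) (d2 + e2) (d3 + e3) (\<lambda>k. t k + s k)"
    "r *\<^sub>R tor d1 d2 d3 t = tor (r * d1) (r * d2) (r * d3) (\<lambda>k. r * t k)" "tor 0 0 0 (\<lambda>_. 0) = 0"
    by (simp_all add: tor_def H3_add H3_scaleR H3_zero be_ga_linear)
      (auto intro!: arg_cong2[of _ _ _ _ wt] simp: field_simps)
qed

lemma gexp_tor:
  "gexp octonion_space (Mop (tor d1 d2 d3 t)) = Mop (gel (exp (d1 / 2)) (exp (d2 / 2)) (exp (d3 / 2)) t)"
proof -
  have "oexp (wt ((a + b) / 2) s) = (exp (a / 2) * exp (b / 2)) *\<^sub>R ph s" for a b s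
    by (rule oct_eqI)
      (simp add: oexp_def wt_def ph_def exp_eq_polar[of "Complex _ _"] add_divide_distrib exp_add scaleR_conv_of_real)
  moreover have "(exp (a / 2))\<^sup>2 = exp a" for a :: real
    by (simp add: power2_eq_square flip: exp_add)
  ultimately show ?thesis by (simp add: tor_def gexp_Mop gel_def)
qed

section \<open>The Lie algebra of the automorphism group of the octonionic cone\<close>

text \<open>For \<open>\<bar>t\<bar> \<le> 1\<close> every power from the second on is at most
  \<open>t\<^sup>2\<close>, so the tail of the exponential series of \<open>norm X\<close> serves as
  the constant.\<close>

lemma gexp_first_order:
  fixes X :: "'v::euclidean_space \<Rightarrow>\<^sub>L 'v"
  assumes S: "gmul S = (o\<^sub>L)" "gone S = id_blinfun"
  obtains K where "\<And>t. \<bar>t\<bar> \<le> 1 \<Longrightarrow> norm (gexp S (t *\<^sub>R X) - id_blinfun - t *\<^sub>R X) \<le> K * t\<^sup>2"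
proof
  let ?K = "\<Sum>n. norm X ^ (n + 2) / fact (n + 2)"
  fix t :: real assume t: "\<bar>t\<bar> \<le> 1"
  interpret comp: bounded_bilinear "(o\<^sub>L) :: ('v \<Rightarrow>\<^sub>L 'v) \<Rightarrow> ('v \<Rightarrow>\<^sub>L 'v) \<Rightarrow> ('v \<Rightarrow>\<^sub>L 'v)"
    by (rule bounded_bilinear_blinfun_compose)
  define p where "p n = ((o\<^sub>L) X ^^ n) id_blinfun" for n
  have pow: "((o\<^sub>L) (t *\<^sub>R X) ^^ n) id_blinfun = t ^ n *\<^sub>R p n" for n
    by (induction n) (simp_all add: p_def comp.scaleR_left comp.scaleR_right)
  have norm_p: "norm (p n) \<le> norm X ^ n" for n
  proof (induction n)
    case 0
    then show ?case by (simp add: p_def norm_blinfun_id_le)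
  next
    case (Suc n)
    have "norm (p (Suc n)) \<le> norm X * norm (p n)"
      unfolding p_def by (simp add: norm_blinfun_compose)
    also have "\<dots> \<le> norm X * norm X ^ n" using Suc by (intro mult_left_mono) auto
    finally show ?case by simp
  qed
  define f where "f n = (1 / fact n) *\<^sub>R (t ^ n *\<^sub>R p n)" for n
  have norm_f: "norm (f n) \<le> \<bar>t\<bar> ^ n * (norm X ^ n / fact n)" for n
  proof -
    have "norm (f n) = \<bar>t\<bar> ^ n * (norm (p n) / fact n)" by (simp add: f_def power_abs)
    also have "\<dots> \<le> \<bar>t\<bar> ^ n * (norm X ^ n / fact n)"
      by (intro mult_left_mono divide_right_mono norm_p) auto
    finally show ?thesis .
  qed
  have summ_X: "summable (\<lambda>n. norm X ^ n / fact n)"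
    using summable_exp_generic[of "norm X"] by (simp add: divide_inverse mult.commute)
  have norm_f': "norm (f n) \<le> norm X ^ n / fact n" for n
  proof -
    have "\<bar>t\<bar> ^ n * (norm X ^ n / fact n) \<le> 1 * (norm X ^ n / fact n)"
      by (intro mult_right_mono power_le_one) (use t in auto)
    with norm_f[of n] show ?thesis by simp
  qed
  have summ: "summable f"
    by (rule summable_comparison_test'[OF summ_X]) (rule norm_f')
  have summ_norm: "summable (\<lambda>n. norm (f (n + 2)))"
    using summable_ignore_initial_segment[OF summable_comparison_test'[OF summ_X, of 0 "\<lambda>n. norm (f n)"], of 2]
      norm_f' by simp
  have "gexp S (t *\<^sub>R X) = suminf f"
    unfolding gexp_def S pow f_def ..
  also have "\<dots> = (\<Sum>n. f (n + 2)) + (\<Sum>i<2. f i)"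
    by (rule suminf_split_initial_segment[OF summ])
  also have "(\<Sum>i<2. f i) = id_blinfun + t *\<^sub>R X"
  proof -
    have "X o\<^sub>L id_blinfun = X" by (rule blinfun_eqI) simp
    then show ?thesis by (simp add: f_def p_def numeral_2_eq_2)
  qed
  finally have "gexp S (t *\<^sub>R X) - id_blinfun - t *\<^sub>R X = (\<Sum>n. f (n + 2))" by simp
  also have "norm \<dots> \<le> (\<Sum>n. norm (f (n + 2)))" by (rule summable_norm[OF summ_norm])
  also have "\<dots> \<le> (\<Sum>n. t\<^sup>2 * (norm X ^ (n + 2) / fact (n + 2)))"
  proof (rule suminf_le[OF _ summ_norm])
    show "summable (\<lambda>n. t\<^sup>2 * (norm X ^ (n + 2) / fact (n + 2)))"
      by (intro summable_mult summable_ignore_initial_segment summ_X)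
    fix n
    have "\<bar>t\<bar> ^ (n + 2) \<le> \<bar>t\<bar> ^ 2" using t by (intro power_decreasing) auto
    then have "\<bar>t\<bar> ^ (n + 2) * (norm X ^ (n + 2) / fact (n + 2)) \<le> t\<^sup>2 * (norm X ^ (n + 2) / fact (n + 2))"
      by (intro mult_right_mono) auto
    then show "norm (f (n + 2)) \<le> t\<^sup>2 * (norm X ^ (n + 2) / fact (n + 2))"
      using norm_f[of "n + 2"] by linarith
  qed
  also have "\<dots> = t\<^sup>2 * ?K"
    by (intro suminf_mult summable_ignore_initial_segment summ_X)
  finally show "norm (gexp S (t *\<^sub>R X) - id_blinfun - t *\<^sub>R X) \<le> ?K * t\<^sup>2" by (simp only: mult.commute)
qed

text \<open>By self-duality this is the closure of the cone; its boundary points are those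
  orthogonal to some nonzero rank-one matrix.\<close>

definition dual_cone :: "(octonion, 3) herm set" where
  "dual_cone = {A. \<forall>B\<in>rank_one. 0 \<le> inner A B}"

text \<open>The linear consequence of membership in \<open>lie_algebra\<close> on which the analysis
  of the octonionic Lie algebra rests.\<close>

definition face_preserving :: "((octonion, 3) herm \<Rightarrow>\<^sub>L (octonion, 3) herm) \<Rightarrow> bool" where
  "face_preserving X \<longleftrightarrow> (\<forall>A\<in>dual_cone. \<forall>B\<in>rank_one. inner A B = 0 \<longrightarrow> inner (blinfun_apply X A) B = 0)"

lemma sum_three_squares_pos: "0 < u\<^sup>2 + inner p p + inner q q \<longleftrightarrow> u \<noteq> 0 \<or> p \<noteq> 0 \<or> q \<noteq> 0"
  for u :: real and p q :: "'a::real_inner"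
  by (auto simp: less_le add_nonneg_eq_0_iff add_nonneg_nonneg)

lemma one_posdef_oct: "H3 1 1 1 0 0 0 \<in> posdef_oct"
  unfolding posdef_oct_rank_one
proof (intro CollectI ballI impI)
  fix B assume "B \<in> rank_one" and "B \<noteq> 0"
  moreover have "inner (H3 1 1 1 0 0 0) (R1 u p q) = u\<^sup>2 + inner p p + inner q q"
    "inner (H3 1 1 1 0 0 0) (R2 p u q) = u\<^sup>2 + inner p p + inner q q"
    "inner (H3 1 1 1 0 0 0) (R3 p q u) = u\<^sup>2 + inner p p + inner q q" for u p q
    by (simp_all add: R1_def R2_def R3_def H3_inner)
  ultimately show "inner (H3 1 1 1 0 0 0) B > 0"
    by (elim rank_one_cases) (auto simp: R_eq_zero_iff sum_three_squares_pos)
qed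

lemma grp_dual_cone:
  assumes g: "g \<in> grp octonion_space" and A: "A \<in> dual_cone"
  shows "blinfun_apply g A \<in> dual_cone"
  unfolding dual_cone_def
proof (intro CollectI ballI)
  fix B assume B: "B \<in> rank_one"
  let ?one = "H3 1 1 1 0 0 0"
  have g_cone: "blinfun_apply g C \<in> posdef_oct" if "C \<in> posdef_oct" for C
    using g that by auto
  show "0 \<le> inner (blinfun_apply g A) B"
  proof (cases "B = 0")
    case False
    show ?thesis
    proof (rule ccontr)
      assume neg: "\<not> 0 \<le> inner (blinfun_apply g A) B"
      have k: "inner (blinfun_apply g ?one) B > 0"
        using g_cone[OF one_posdef_oct] B False by (simp add: posdef_oct_rank_one)
      \<comment> \<open>Chosen so that the image of the interior point
        \<open>A + e *\<^sub>R ?one\<close> pairs to exactly 0 with \<open>B\<close>, against strict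
        positivity.\<close>
      define e where "e = - inner (blinfun_apply g A) B / inner (blinfun_apply g ?one) B"
      have e: "e > 0" using neg k by (simp add: e_def divide_neg_pos)
      have "A + e *\<^sub>R ?one \<in> posdef_oct"
        unfolding posdef_oct_rank_one
      proof (intro CollectI ballI impI)
        fix C assume "C \<in> rank_one" "C \<noteq> 0"
        then have "inner ?one C > 0" "inner A C \<ge> 0"
          using one_posdef_oct A by (auto simp: posdef_oct_rank_one dual_cone_def)
        then show "inner (A + e *\<^sub>R ?one) C > 0"
          using e by (simp add: inner_add_left add_nonneg_pos)
      qed
      from g_cone[OF this] have "inner (blinfun_apply g (A + e *\<^sub>R ?one)) B > 0"
        using B False by (simp add: posdef_oct_rank_one)
      then show False
        using k by (simp add: blinfun.add_right blinfun.diff_right blinfun.scaleR_right inner_add_left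
            inner_diff_left e_def)
    qed
  qed simp
qed

lemma lie_algebra_face_preserving:
  assumes X: "X \<in> lie_algebra octonion_space"
  shows "face_preserving X"
  unfolding face_preserving_def
proof (intro ballI impI)
  fix A B assume A: "A \<in> dual_cone" and B: "B \<in> rank_one" and AB: "inner A B = 0"
  obtain K where K: "\<And>t. \<bar>t\<bar> \<le> 1 \<Longrightarrow>
      norm (gexp octonion_space (t *\<^sub>R X) - id_blinfun - t *\<^sub>R X) \<le> K * t\<^sup>2"
    by (rule gexp_first_order[of octonion_space X]) auto
  let ?L = "inner (blinfun_apply X A) B"
  let ?M = "K * norm A * norm B"
  have est: "- ?M * t\<^sup>2 \<le> t * ?L" if t: "\<bar>t\<bar> \<le> 1" for t
  proof -
    let ?R = "gexp octonion_space (t *\<^sub>R X) - id_blinfun - t *\<^sub>R X"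
    have "gexp octonion_space (t *\<^sub>R X) \<in> grp octonion_space"
      using X unfolding lie_algebra_def by blast
    then have "0 \<le> inner (blinfun_apply (gexp octonion_space (t *\<^sub>R X)) A) B"
      using grp_dual_cone[OF _ A] B unfolding dual_cone_def by blast
    also have "\<dots> = t * ?L + inner (blinfun_apply ?R A) B"
      by (simp add: blinfun.diff_left blinfun.scaleR_left inner_diff_left AB)
    also have "inner (blinfun_apply ?R A) B \<le> norm (blinfun_apply ?R A) * norm B"
      by (rule norm_cauchy_schwarz)
    also have "\<dots> \<le> (norm ?R * norm A) * norm B"
      by (intro mult_right_mono norm_blinfun) auto
    also have "\<dots> \<le> (K * t\<^sup>2 * norm A) * norm B"
      by (intro mult_right_mono K t) auto
    finally show ?thesis by (simp add: algebra_simps)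
  qed
  show "?L = 0"
  proof (rule ccontr)
    assume L: "?L \<noteq> 0"
    \<comment> \<open>Small enough for the linear term to beat the quadratic remainder;
      \<open>est\<close> at \<open>t\<close> and at \<open>- t\<close> handles both signs of
      \<open>?L\<close>.\<close>
    define t where "t = min 1 (\<bar>?L\<bar> / (2 * (\<bar>?M\<bar> + 1)))"
    have t: "0 < t" "t \<le> 1" "t \<le> \<bar>?L\<bar> / (2 * (\<bar>?M\<bar> + 1))" using L by (auto simp: t_def)
    from t(3) have "t * (\<bar>?M\<bar> + 1) \<le> \<bar>?L\<bar> / 2" by (simp add: field_simps)
    moreover have "?M \<le> \<bar>?M\<bar> + 1" by simp
    then have "t * ?M \<le> t * (\<bar>?M\<bar> + 1)" using t(1) by (intro mult_left_mono) auto
    ultimately have "t * ?M < \<bar>?L\<bar>" using L by linarith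
    then have "t * (t * ?M) < t * \<bar>?L\<bar>" using t(1) by simp
    moreover have "t * \<bar>?L\<bar> \<le> ?M * t\<^sup>2"
      using est[of t] est[of "- t"] t(1,2) by (cases "?L \<ge> 0") auto
    moreover have "t * (t * ?M) = ?M * t\<^sup>2" by (simp add: power2_eq_square)
    ultimately show False by linarith
  qed
qed

section \<open>Boundary points of the cone used as test elements\<close>

lemma unit_plus_self:
  "inner x x = 1 \<Longrightarrow> 0 \<le> u\<^sup>2 + inner p p + 2 * u * inner x p" for x p :: "'a::real_inner"
  using inner_ge_zero[of "u *\<^sub>R x + p"]
  by (simp add: inner_add_left inner_add_right inner_commute power2_eq_square algebra_simps)

lemma unit_mult_plus_self:
  fixes w p q :: octonion
  assumes "inner w w = 1"
  shows "0 \<le> inner p p + inner q q + 2 * inner w (conjg p * q)"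
  using inner_ge_zero[of "p * w + q"] assms
  by (simp add: inner_add_left inner_add_right inner_commute[of q "p * w"] oct_inner_left oct_alternative_left)

text \<open>These are the rank-one matrices \<open>R1 1 x 0\<close>, \<open>R1 1 0 x\<close> and
  \<open>R2 0 1 x\<close>; each is orthogonal to the one formed with \<open>- x\<close>, which makes
  it a test element for \<open>face_preserving\<close>.\<close>

lemma dual_cone_pairs:
  assumes x: "inner x x = 1"
  shows "H3 1 1 0 x 0 0 \<in> dual_cone" "H3 1 0 1 0 x 0 \<in> dual_cone" "H3 0 1 1 0 0 x \<in> dual_cone"
proof -
  have m: "0 \<le> inner p p + inner q q + 2 * inner x (p * conjg q)"
    "0 \<le> inner p p + inner q q + 2 * inner x (p * q)" for p q
    using unit_mult_plus_self[of x "conjg p" "conjg q"] unit_mult_plus_self[of x "conjg p" q] x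
    by (simp_all add: oct_inner_conjg)
  note s = unit_plus_self[OF x] unit_mult_plus_self[OF x] m
  show "H3 1 1 0 x 0 0 \<in> dual_cone" "H3 1 0 1 0 x 0 \<in> dual_cone" "H3 0 1 1 0 0 x \<in> dual_cone"
    unfolding dual_cone_def rank_one_def R1_def R2_def R3_def
    using s by (auto simp: H3_inner algebra_simps)
qed

text \<open>The left-hand side is the pairing of \<open>R1 u p q\<close> with
  \<open>R1 1 x (x * w)\<close>, whose entries are \<open>x\<close>, \<open>x * w\<close> and
  \<open>w\<close>. Writing it as a squared length gives nonnegativity and at the same time
  describes orthogonality by one octonion equation.\<close>

lemma unit_triple:
  fixes x w p q :: octonion
  assumes x: "inner x x = 1" and w: "inner w w = 1"
  shows "u\<^sup>2 + inner p p + inner q q + 2 * (u * inner x p + u * inner (x * w) q + inner w (conjg p * q))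
    = inner (q + u *\<^sub>R (x * w) + p * w) (q + u *\<^sub>R (x * w) + p * w)"
proof -
  have "inner (x * w) (p * w) = inner x p"
    by (simp add: oct_inner_right oct_alternative_right w)
  moreover have "inner (p * w) q = inner w (conjg p * q)" by (rule oct_inner_left)
  ultimately show ?thesis
    using x w by (simp add: inner_add_left inner_add_right inner_commute[of q "p * w"] inner_commute[of q "x * w"]
        inner_commute[of "p * w" "x * w"] oct_inner_mult_self power2_eq_square algebra_simps)
qed

lemma dual_cone_triple:
  assumes x: "inner x x = 1" and w: "inner w w = 1"
  shows "H3 1 1 1 x (x * w) w \<in> dual_cone"
  unfolding dual_cone_def
proof (intro CollectI ballI)
  fix B assume "B \<in> rank_one"
  then consider u p q where "B = R1 u p q" | u p q where "B = R2 p u q" | u p q where "B = R3 p q u"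
    by (rule rank_one_cases)
  then show "0 \<le> inner (H3 1 1 1 x (x * w) w) B"
  proof cases
    case 1
    then show ?thesis
      using unit_triple[OF x w, of u p q] inner_ge_zero by (simp add: R1_def H3_inner)
  next
    case 2
    \<comment> \<open>Exchanging the first two coordinates moves the real entry to the front and
      keeps the shape of the triple, because \<open>conjg x * (x * w) = w\<close>. The third case is
      analogous.\<close>
    have "0 \<le> u\<^sup>2 + inner p p + inner q q + 2 * (u * inner x p + u * inner w q + inner (x * w) (p * q))"
      using unit_triple[of "conjg x" "x * w" u "conjg p" q] x w
      by (simp add: oct_inner_conjg oct_alternative_left oct_inner_mult_self)
    then show ?thesis by (simp add: 2 R2_def H3_inner algebra_simps)
  next
    case 3
    have "0 \<le> u\<^sup>2 + inner p p + inner q q + 2 * (u * inner (x * w) p + u * inner w q + inner x (p * conjg q))"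
      using unit_triple[of "conjg (x * w)" x u "conjg p" "conjg q"] x w
      by (simp add: oct_inner_conjg oct_inner_mult_self)
        (simp add: oct_conjg_mult oct_alternative_right' oct_inner_conjg)
    then show ?thesis by (simp add: 3 R3_def H3_inner algebra_simps)
  qed
qed

section \<open>Operators preserving the Peirce decomposition\<close>

locale peirce_operator =
  fixes X :: "(octonion, 3) herm \<Rightarrow>\<^sub>L (octonion, 3) herm" and r1 r2 r3 :: real
    and S12 S13 S23 :: "octonion \<Rightarrow> octonion"
  assumes linear_S: "linear S12" "linear S13" "linear S23"
    and X_H3: "blinfun_apply X (H3 a b c p q s) = H3 (r1 * a) (r2 * b) (r3 * c) (S12 p) (S13 q) (S23 s)"
    and face: "face_preserving X"
begin

text \<open>The rank-one matrices belonging to \<open>x\<close> and \<open>- x\<close> are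
  orthogonal, and the face condition for this pair reads off the quadratic form of each
  block.\<close>

lemma diagonal_form_unit:
  assumes x: "inner x x = 1"
  shows "2 * inner (S12 x) x = r1 + r2" "2 * inner (S13 x) x = r1 + r3" "2 * inner (S23 x) x = r2 + r3"
proof -
  note [simp] = R1_def R2_def H3_inner X_H3 oct_mult_zero x linear_0[OF linear_S(1)] linear_0[OF linear_S(2)]
    linear_0[OF linear_S(3)]
  have "inner (blinfun_apply X (H3 1 1 0 x 0 0)) (R1 1 (- x) 0) = 0"
    "inner (blinfun_apply X (H3 1 0 1 0 x 0)) (R1 1 0 (- x)) = 0"
    "inner (blinfun_apply X (H3 0 1 1 0 0 x)) (R2 0 1 (- x)) = 0"
    by (rule face[unfolded face_preserving_def, rule_format, OF _ rank_one_R(1)], rule dual_cone_pairs[OF x], simp,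
        rule face[unfolded face_preserving_def, rule_format, OF _ rank_one_R(1)], rule dual_cone_pairs[OF x], simp,
        rule face[unfolded face_preserving_def, rule_format, OF _ rank_one_R(2)], rule dual_cone_pairs[OF x], simp)
  then show "2 * inner (S12 x) x = r1 + r2" "2 * inner (S13 x) x = r1 + r3" "2 * inner (S23 x) x = r2 + r3"
    by simp_all
qed

lemma diagonal_form:
  "2 * inner (S12 x) x = (r1 + r2) * inner x x" "2 * inner (S13 x) x = (r1 + r3) * inner x x"
  "2 * inner (S23 x) x = (r2 + r3) * inner x x"
proof -
  have "2 * inner (S x) x = r * inner x x"
    if "linear S" and u: "\<And>y. inner y y = 1 \<Longrightarrow> 2 * inner (S y) y = r" for S and r :: real
  proof (cases "x = 0")
    case False
    let ?y = "x /\<^sub>R norm x"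
    have "inner ?y ?y = 1" using False by (simp add: dot_square_norm power2_eq_square)
    from u[OF this] have "2 * (inner (S x) x / (norm x)\<^sup>2) = r"
      by (simp add: linear_scale[OF \<open>linear S\<close>] power2_eq_square divide_inverse mult_ac)
    then show ?thesis using False by (simp add: dot_square_norm field_simps)
  qed simp
  from this[OF linear_S(1) diagonal_form_unit(1)] this[OF linear_S(2) diagonal_form_unit(2)]
    this[OF linear_S(3) diagonal_form_unit(3)]
  show "2 * inner (S12 x) x = (r1 + r2) * inner x x" "2 * inner (S13 x) x = (r1 + r3) * inner x x"
    "2 * inner (S23 x) x = (r2 + r3) * inner x x" by blast+
qed

text \<open>\<open>q\<close> is the value for which the square in \<open>unit_triple\<close>
  vanishes at \<open>u = 1\<close>. The face condition for the resulting orthogonal pair couples the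
  three blocks, which is infinitesimal triality.\<close>

lemma triality_form:
  assumes x: "inner x x = 1" and w: "inner w w = 1" and q: "q = - (x * w + p * w)"
  shows "r1 + r2 * inner p p + r3 * inner q q
     + 2 * (inner (S12 x) p + inner (S13 (x * w)) q + inner (S23 w) (conjg p * q)) = 0"
proof -
  have "inner (H3 1 1 1 x (x * w) w) (R1 1 p q) = 0"
    using unit_triple[OF x w, of 1 p q] by (simp add: R1_def H3_inner q)
  then have "inner (blinfun_apply X (H3 1 1 1 x (x * w) w)) (R1 1 p q) = 0"
    by (rule face[unfolded face_preserving_def, rule_format, OF dual_cone_triple[OF x w] rank_one_R(1)])
  then show ?thesis by (simp add: R1_def H3_inner X_H3)
qed

end

lemma tw_wt_zero: "tw (wt s (\<lambda>_. 0)) p = s *\<^sub>R p"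
  by (rule oct_eqI) (simp add: wt_def complex_eq_iff)

lemma hprod_tor_split:
  "hprod (tor d1 d2 d3 (\<lambda>_. 0)) (H3 a b c p q s)
     = H3 (d1 * a) (d2 * b) (d3 * c) (((d1 + d2) / 2) *\<^sub>R p) (((d1 + d3) / 2) *\<^sub>R q) (((d2 + d3) / 2) *\<^sub>R s)"
  by (simp add: tor_def be_ga_linear tw_wt_zero)

text \<open>The operator with parameters 2, 4, 8 has the six distinct eigenvalues 2, 4, 8, 3, 5, 6 on the
  Peirce spaces.\<close>

lemma peirce_operatorI:
  assumes comm: "bracket octonion_space X (Mop (tor 2 4 8 (\<lambda>_. 0))) = Mop M"
    and face: "face_preserving X"
  obtains r1 r2 r3 S12 S13 S23 where "peirce_operator X r1 r2 r3 S12 S13 S23"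
proof -
  obtain m1 m2 m3 n1 n2 n3 where M: "M = H3 m1 m2 m3 n1 n2 n3" by (rule H3_cases)
  let ?X = "blinfun_apply X" and ?L = "hprod (tor 2 4 8 (\<lambda>_. 0))"
  have eq: "?X (?L v) - ?L (?X v) = hprod M v" for v
  proof -
    have "blinfun_apply (bracket octonion_space X (Mop (tor 2 4 8 (\<lambda>_. 0)))) v = hprod M v"
      by (simp only: comm Mop_apply)
    then show ?thesis by (simp add: bracket_def blinfun.diff_left)
  qed
  \<comment> \<open>\<open>hprod M\<close> preserves each Peirce space, and the eigenvalues on the
    six spaces differ; hence the components of \<open>?X v\<close> outside the space of
    \<open>v\<close> vanish even though \<open>M\<close> may be nonzero.\<close>
  have eig: "r *\<^sub>R ?X v - ?L (?X v) = hprod M v" if "?L v = r *\<^sub>R v" for r v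
    using eq[of v] by (simp add: that blinfun.scaleR_right)
  note simps = hprod_tor_split H3_scaleR H3_diff M tw_algebra(8)
  have d: "\<exists>r. ?X (H3 a 0 0 0 0 0) = H3 r 0 0 0 0 0" "\<exists>r. ?X (H3 0 a 0 0 0 0) = H3 0 r 0 0 0 0"
    "\<exists>r. ?X (H3 0 0 a 0 0 0) = H3 0 0 r 0 0 0" for a
  proof -
    obtain b1 b2 b3 x z w where *: "?X (H3 a 0 0 0 0 0) = H3 b1 b2 b3 x z w" by (rule H3_cases)
    show "\<exists>r. ?X (H3 a 0 0 0 0 0) = H3 r 0 0 0 0 0"
      using eig[of "H3 a 0 0 0 0 0" 2] by (simp add: * simps)
    obtain b1 b2 b3 x z w where *: "?X (H3 0 a 0 0 0 0) = H3 b1 b2 b3 x z w" by (rule H3_cases)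
    show "\<exists>r. ?X (H3 0 a 0 0 0 0) = H3 0 r 0 0 0 0"
      using eig[of "H3 0 a 0 0 0 0" 4] by (simp add: * simps)
    obtain b1 b2 b3 x z w where *: "?X (H3 0 0 a 0 0 0) = H3 b1 b2 b3 x z w" by (rule H3_cases)
    show "\<exists>r. ?X (H3 0 0 a 0 0 0) = H3 0 0 r 0 0 0"
      using eig[of "H3 0 0 a 0 0 0" 8] by (simp add: * simps)
  qed
  have o: "\<exists>y. ?X (H3 0 0 0 p 0 0) = H3 0 0 0 y 0 0" "\<exists>y. ?X (H3 0 0 0 0 p 0) = H3 0 0 0 0 y 0"
    "\<exists>y. ?X (H3 0 0 0 0 0 p) = H3 0 0 0 0 0 y" for p
  proof -
    obtain b1 b2 b3 x z w where *: "?X (H3 0 0 0 p 0 0) = H3 b1 b2 b3 x z w" by (rule H3_cases)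
    show "\<exists>y. ?X (H3 0 0 0 p 0 0) = H3 0 0 0 y 0 0"
      using eig[of "H3 0 0 0 p 0 0" 3] by (simp add: * simps)
    obtain b1 b2 b3 x z w where *: "?X (H3 0 0 0 0 p 0) = H3 b1 b2 b3 x z w" by (rule H3_cases)
    show "\<exists>y. ?X (H3 0 0 0 0 p 0) = H3 0 0 0 0 y 0"
      using eig[of "H3 0 0 0 0 p 0" 5] by (simp add: * simps)
    obtain b1 b2 b3 x z w where *: "?X (H3 0 0 0 0 0 p) = H3 b1 b2 b3 x z w" by (rule H3_cases)
    show "\<exists>y. ?X (H3 0 0 0 0 0 p) = H3 0 0 0 0 0 y"
      using eig[of "H3 0 0 0 0 0 p" 6] by (simp add: * simps)
  qed
  from d(1)[of 1] obtain r1 where r1: "?X (H3 1 0 0 0 0 0) = H3 r1 0 0 0 0 0" ..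
  from d(2)[of 1] obtain r2 where r2: "?X (H3 0 1 0 0 0 0) = H3 0 r2 0 0 0 0" ..
  from d(3)[of 1] obtain r3 where r3: "?X (H3 0 0 1 0 0 0) = H3 0 0 r3 0 0 0" ..
  have "\<forall>p. \<exists>y. ?X (H3 0 0 0 p 0 0) = H3 0 0 0 (y) 0 0" using o(1) by blast
  from choice[OF this] obtain S12 where S12: "\<And>p. ?X (H3 0 0 0 p 0 0) = H3 0 0 0 (S12 p) 0 0" by blast
  have "\<forall>p. \<exists>y. ?X (H3 0 0 0 0 p 0) = H3 0 0 0 0 (y) 0" using o(2) by blast
  from choice[OF this] obtain S13 where S13: "\<And>p. ?X (H3 0 0 0 0 p 0) = H3 0 0 0 0 (S13 p) 0" by blast
  have "\<forall>p. \<exists>y. ?X (H3 0 0 0 0 0 p) = H3 0 0 0 0 0 (y)" using o(3) by blast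
  from choice[OF this] obtain S23 where S23: "\<And>p. ?X (H3 0 0 0 0 0 p) = H3 0 0 0 0 0 (S23 p)" by blast
  have "peirce_operator X r1 r2 r3 S12 S13 S23"
  proof (rule peirce_operator.intro)
    show "linear S12"
    proof (rule linearI)
      fix p q and r :: real
      have "?X (H3 0 0 0 (p + q) 0 0) = ?X (H3 0 0 0 p 0 0) + ?X (H3 0 0 0 q 0 0)"
        "?X (H3 0 0 0 (r *\<^sub>R p) 0 0) = r *\<^sub>R ?X (H3 0 0 0 p 0 0)"
        unfolding blinfun.add_right[symmetric] blinfun.scaleR_right[symmetric] H3_add H3_scaleR by simp_all
      then show "S12 (p + q) = S12 p + S12 q" "S12 (r *\<^sub>R p) = r *\<^sub>R S12 p"
        by (simp_all add: S12 H3_add H3_scaleR)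
    qed
    show "linear S13"
    proof (rule linearI)
      fix p q and r :: real
      have "?X (H3 0 0 0 0 (p + q) 0) = ?X (H3 0 0 0 0 p 0) + ?X (H3 0 0 0 0 q 0)"
        "?X (H3 0 0 0 0 (r *\<^sub>R p) 0) = r *\<^sub>R ?X (H3 0 0 0 0 p 0)"
        unfolding blinfun.add_right[symmetric] blinfun.scaleR_right[symmetric] H3_add H3_scaleR by simp_all
      then show "S13 (p + q) = S13 p + S13 q" "S13 (r *\<^sub>R p) = r *\<^sub>R S13 p"
        by (simp_all add: S13 H3_add H3_scaleR)
    qed
    show "linear S23"
    proof (rule linearI)
      fix p q and r :: real
      have "?X (H3 0 0 0 0 0 (p + q)) = ?X (H3 0 0 0 0 0 p) + ?X (H3 0 0 0 0 0 q)"
        "?X (H3 0 0 0 0 0 (r *\<^sub>R p)) = r *\<^sub>R ?X (H3 0 0 0 0 0 p)"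
        unfolding blinfun.add_right[symmetric] blinfun.scaleR_right[symmetric] H3_add H3_scaleR by simp_all
      then show "S23 (p + q) = S23 p + S23 q" "S23 (r *\<^sub>R p) = r *\<^sub>R S23 p"
        by (simp_all add: S23 H3_add H3_scaleR)
    qed
    show "?X (H3 a b c p q s) = H3 (r1 * a) (r2 * b) (r3 * c) (S12 p) (S13 q) (S23 s)" for a b c p q s
    proof -
      have "H3 a b c p q s = a *\<^sub>R H3 1 0 0 0 0 0 + b *\<^sub>R H3 0 1 0 0 0 0 + c *\<^sub>R H3 0 0 1 0 0 0
         + H3 0 0 0 p 0 0 + H3 0 0 0 0 q 0 + H3 0 0 0 0 0 s"
        by (simp add: H3_add H3_scaleR)
      then have "?X (H3 a b c p q s) = a *\<^sub>R ?X (H3 1 0 0 0 0 0) + b *\<^sub>R ?X (H3 0 1 0 0 0 0) + c *\<^sub>R ?X (H3 0 0 1 0 0 0)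
         + ?X (H3 0 0 0 p 0 0) + ?X (H3 0 0 0 0 q 0) + ?X (H3 0 0 0 0 0 s)"
        by (simp only: blinfun.add_right blinfun.scaleR_right)
      then show ?thesis by (simp add: r1 r2 r3 S12 S13 S23 H3_add H3_scaleR mult.commute)
    qed
  qed (rule face)
  then show thesis by (rule that)
qed

section \<open>A Cartan subalgebra in the octonionic case\<close>

definition torus :: "((octonion, 3) herm \<Rightarrow>\<^sub>L (octonion, 3) herm) set" where
  "torus = {Mop (tor d1 d2 d3 t) | d1 d2 d3 t. True}"

definition split_torus :: "((octonion, 3) herm \<Rightarrow>\<^sub>L (octonion, 3) herm) set" where
  "split_torus = {Mop (tor d1 d2 d3 (\<lambda>_. 0)) | d1 d2 d3. True}"

lemma torusI: "Mop (tor d1 d2 d3 t) \<in> torus"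
  unfolding torus_def by blast

lemma split_torusI: "Mop (tor d1 d2 d3 (\<lambda>_. 0)) \<in> split_torus"
  unfolding split_torus_def by blast

lemma split_torus_subset: "split_torus \<subseteq> torus"
  unfolding torus_def split_torus_def by blast

lemma subspace_torus: "subspace torus" "subspace split_torus"
proof -
  have add: "Mop (tor d1 d2 d3 t) + Mop (tor e1 e2 e3 s) = Mop (tor (d1 + e1) (d2 + e2) (d3 + e3) (\<lambda>k. t k + s k))"
    for d1 d2 d3 t e1 e2 e3 s
    by (simp only: linear_add[OF linear_Mop, symmetric] tor_linear)
  have scale: "r *\<^sub>R Mop (tor d1 d2 d3 t) = Mop (tor (r * d1) (r * d2) (r * d3) (\<lambda>k. r * t k))" for r d1 d2 d3 t
    by (simp only: linear_scale[OF linear_Mop, symmetric] tor_linear)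
  have zero: "0 = Mop (tor 0 0 0 (\<lambda>_. 0))"
    by (simp only: tor_linear linear_0[OF linear_Mop])
  show "subspace torus"
    unfolding subspace_def
  proof (intro conjI ballI allI)
    show "0 \<in> torus" unfolding zero by (rule torusI)
  next
    fix x y assume "x \<in> torus" "y \<in> torus"
    then show "x + y \<in> torus" unfolding torus_def by (auto simp only: add) blast
  next
    fix c :: real and x assume "x \<in> torus"
    then show "c *\<^sub>R x \<in> torus" unfolding torus_def by (auto simp only: scale) blast
  qed
  show "subspace split_torus"
    unfolding subspace_def
  proof (intro conjI ballI allI)
    show "0 \<in> split_torus" unfolding zero by (rule split_torusI)
  next
    fix x y assume "x \<in> split_torus" "y \<in> split_torus"
    then obtain d1 d2 d3 e1 e2 e3 where "x = Mop (tor d1 d2 d3 (\<lambda>_. 0))" "y = Mop (tor e1 e2 e3 (\<lambda>_. 0))"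
      unfolding split_torus_def by blast
    then show "x + y \<in> split_torus" by (simp add: add split_torusI)
  next
    fix c :: real and x assume "x \<in> split_torus"
    then obtain d1 d2 d3 where "x = Mop (tor d1 d2 d3 (\<lambda>_. 0))" unfolding split_torus_def by blast
    then show "c *\<^sub>R x \<in> split_torus" by (simp add: scale split_torusI)
  qed
qed

lemma torus_lie_algebra: "torus \<subseteq> lie_algebra octonion_space"
proof
  fix X assume "X \<in> torus"
  then obtain d1 d2 d3 t where X: "X = Mop (tor d1 d2 d3 t)" by (auto simp: torus_def)
  have "gexp octonion_space (r *\<^sub>R X) \<in> grp octonion_space" for r
    unfolding X linear_scale[OF linear_Mop, symmetric] tor_linear gexp_tor by (rule gel_grp) auto
  then show "X \<in> lie_algebra octonion_space" unfolding lie_algebra_def by blast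
qed

lemma bracket_torus: "X \<in> torus \<Longrightarrow> Y \<in> torus \<Longrightarrow> bracket octonion_space X Y = 0"
  by (auto simp: torus_def bracket_def Mop_compose hprod_commute)

text \<open>\<open>S\<close> is only real linear. Rotating a single coordinate rules out mixing
  between coordinates, and rotating all of them together makes each diagonal block complex
  linear.\<close>

lemma multiplier_if_normalizes:
  assumes S: "linear S"
    and M: "\<And>t. \<exists>M. \<forall>p. S (tw (wt 0 t) p) - tw (wt 0 t) (S p) = tw M p"
  obtains m where "S = tw m"
proof -
  have rot: "tw (wt 0 t) (cinj k c) = cinj k (\<i> * t k * c)" for t k c
    by (rule oct_eqI) (simp add: wt_def co_cinj complex_eq_iff)
  have off: "co l (S (cinj k c)) = 0" if "l \<noteq> k" for k l c
  proof -
    let ?t = "\<lambda>j. if j = k then 1 else 0"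
    \<comment> \<open>Only coordinate \<open>k\<close> is rotated, and the rotation takes this
      argument to \<open>cinj k c\<close>; at \<open>l\<close> both the rotated image and the
      multiplier term vanish, leaving \<open>S (cinj k c)\<close> alone.\<close>
    obtain m where "S (tw (wt 0 ?t) (cinj k (- \<i> * c))) - tw (wt 0 ?t) (S (cinj k (- \<i> * c))) = tw m (cinj k (- \<i> * c))"
      using M by blast
    then have "co l (S (tw (wt 0 ?t) (cinj k (- \<i> * c))) - tw (wt 0 ?t) (S (cinj k (- \<i> * c)))) = co l (tw m (cinj k (- \<i> * c)))"
      by simp
    then show ?thesis using that by (simp add: rot co_cinj) (simp add: wt_def complex_eq_iff)
  qed
  have diag: "co k (S (cinj k c)) = co k (S (cinj k 1)) * c" for k c
  proof -
    let ?s = "\<lambda>c. co k (S (cinj k c))"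
    have lin: "?s (a *\<^sub>R b) = a *\<^sub>R ?s b" "?s (b + b') = ?s b + ?s b'" for a b b'
      by (simp_all add: linear_scale[OF linear_cinj] linear_scale[OF S] linear_add[OF linear_cinj] linear_add[OF S])
    obtain m where m: "\<And>p. S (tw (wt 0 (\<lambda>_. 1)) p) - tw (wt 0 (\<lambda>_. 1)) (S p) = tw m p"
      using M by blast
    have s: "?s (\<i> * c) = \<i> * ?s c + co k m * c" for c
    proof -
      have "co k (S (tw (wt 0 (\<lambda>_. 1)) (cinj k c)) - tw (wt 0 (\<lambda>_. 1)) (S (cinj k c))) = co k (tw m (cinj k c))"
        by (simp only: m)
      moreover have "co k (wt 0 (\<lambda>_. 1)) = \<i>" by (simp add: wt_def complex_eq_iff)
      ultimately show ?thesis by (simp add: rot co_cinj algebra_simps)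
    qed
    \<comment> \<open>Applying the relation twice and using \<i> squared = -1 gives
      \<open>2 * \<i> * co k m = 0\<close>, so the commutator defect vanishes.\<close>
    have "?s (\<i> * (\<i> * 1)) = \<i> * (\<i> * ?s 1 + co k m * 1) + co k m * (\<i> * 1)"
      by (simp only: s)
    moreover have "?s (\<i> * (\<i> * 1)) = - ?s 1"
      using lin(1)[of "-1" 1] by simp
    ultimately have "co k m = 0" by (simp add: algebra_simps)
    with s[of 1] have si: "?s \<i> = \<i> * ?s 1" by simp
    have "c = Re c *\<^sub>R 1 + Im c *\<^sub>R \<i>" by (simp add: complex_eq_iff)
    then have "?s c = ?s (Re c *\<^sub>R 1 + Im c *\<^sub>R \<i>)" by (rule arg_cong)
    also have "\<dots> = Re c *\<^sub>R ?s 1 + Im c *\<^sub>R (\<i> * ?s 1)" by (simp only: lin si)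
    also have "\<dots> = ?s 1 * c" by (simp add: complex_eq_iff)
    finally show ?thesis .
  qed
  have "S p = tw (mk (\<lambda>k. co k (S (cinj k 1)))) p" for p
  proof (rule oct_eqI)
    fix l
    have "S p = S (cinj K1 (co K1 p)) + S (cinj K2 (co K2 p)) + S (cinj K3 (co K3 p)) + S (cinj K4 (co K4 p))"
      by (subst cinj_sum[of p]) (simp only: linear_add[OF S])
    then have "co l (S p) = co l (S (cinj K1 (co K1 p))) + co l (S (cinj K2 (co K2 p))) + co l (S (cinj K3 (co K3 p))) + co l (S (cinj K4 (co K4 p)))"
      by (simp only: co_linear)
    also have "\<dots> = co l (S (cinj l (co l p)))"
      using off by (cases l) (simp_all del: co.simps)
    also have "\<dots> = co l (S (cinj l 1)) * co l p" by (rule diag)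
    finally show "co l (S p) = co l (tw (mk (\<lambda>k. co k (S (cinj k 1)))) p)" by simp
  qed
  then have "S = tw (mk (\<lambda>k. co k (S (cinj k 1))))" by (rule ext)
  then show thesis by (rule that)
qed

context peirce_operator
begin

text \<open>A symmetric operator is determined by its quadratic form, and
  \<open>diagonal_form\<close> says that on each block this form is that of a scalar.\<close>

lemma symmetric_imp_split:
  assumes sym: "\<And>A B. inner (blinfun_apply X A) B = inner A (blinfun_apply X B)"
  shows "X = Mop (tor r1 r2 r3 (\<lambda>_. 0))"
proof -
  have scalar: "S x = (r / 2) *\<^sub>R x"
    if lin: "linear S" and symS: "\<And>x y. inner (S x) y = inner x (S y)"
      and form: "\<And>x. 2 * inner (S x) x = r * inner x x" for S x and r :: real
  proof -
    let ?T = "\<lambda>x. S x - (r / 2) *\<^sub>R x"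
    have 0: "inner (?T x) x = 0" for x
      using form[of x] by (simp add: inner_diff_left)
    \<comment> \<open>Polarisation in the direction \<open>?T x\<close>: all values of the form
      vanish, so the mixed term, twice the squared length of \<open>?T x\<close>, vanishes
      too.\<close>
    have "inner (?T (x + ?T x)) (x + ?T x) = inner (?T x) x + inner (?T (?T x)) (?T x) + 2 * inner (?T x) (?T x)"
      using symS[of "?T x" x]
      by (simp add: linear_add[OF lin] linear_diff[OF lin] linear_scale[OF lin] inner_add_left inner_add_right
          inner_diff_left inner_diff_right inner_commute algebra_simps) (simp add: field_simps)
    then have "inner (?T x) (?T x) = 0" by (simp only: 0)
    then show ?thesis by simp
  qed
  have "inner (S12 x) y = inner x (S12 y)" "inner (S13 x) y = inner x (S13 y)" "inner (S23 x) y = inner x (S23 y)" for x y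
    using sym[of "H3 0 0 0 x 0 0" "H3 0 0 0 y 0 0"] sym[of "H3 0 0 0 0 x 0" "H3 0 0 0 0 y 0"]
      sym[of "H3 0 0 0 0 0 x" "H3 0 0 0 0 0 y"] by (simp_all add: X_H3 H3_inner)
  note S = scalar[OF linear_S(1) this(1) diagonal_form(1)] scalar[OF linear_S(2) this(2) diagonal_form(2)]
    scalar[OF linear_S(3) this(3) diagonal_form(3)]
  show ?thesis
  proof (rule blinfun_eqI)
    fix A
    obtain a b c p q s where A: "A = H3 a b c p q s" by (rule H3_cases)
    show "blinfun_apply X A = blinfun_apply (Mop (tor r1 r2 r3 (\<lambda>_. 0))) A"
      by (simp add: A X_H3 hprod_tor_split S)
  qed
qed

text \<open>\<open>diagonal_form\<close> fixes the real parts of the multipliers and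
  \<open>triality_form\<close> expresses the angles on two blocks through those on the third,
  leaving three scalings and four angles.\<close>

lemma multipliers_imp_torus:
  assumes S: "S12 = tw m12" "S13 = tw m13" "S23 = tw m23"
  shows "X \<in> torus"
proof -
  have wt: "m = wt (r / 2) (\<lambda>k. Im (co k m))" if "\<And>x. 2 * inner (tw m x) x = r * inner x x" for m r
  proof (rule oct_eqI)
    fix k show "co k m = co k (wt (r / 2) (\<lambda>k. Im (co k m)))"
      using that[of "cinj k 1"]
      by (cases k) (simp_all add: wt_def inner_co co_cinj complex_eq_iff inner_complex_def del: co.simps)
  qed
  define a g b where "a k = Im (co k m12)" and "g k = Im (co k m13)" and "b k = Im (co k m23)" for k
  have m: "m12 = wt ((r1 + r2) / 2) a" "m13 = wt ((r1 + r3) / 2) g" "m23 = wt ((r2 + r3) / 2) b"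
    unfolding a_def g_def b_def
    by (rule wt, use diagonal_form(1) S in simp, rule wt, use diagonal_form(2) S in simp,
        rule wt, use diagonal_form(3) S in simp)
  have unit: "inner (cinj k 1) (cinj k 1) = 1" for k
    by (cases k) (simp_all add: inner_co co_cinj del: co.simps)
  \<comment> \<open>Testing with coordinate units, \<open>p\<close> being \<i> times such a unit,
    gives linear relations between angles. The eight selected below determine the eight unknowns
    \<open>g k\<close> and \<open>b k\<close> from \<open>a\<close>.\<close>
  note rel = triality_form[OF unit unit refl, where p = "cinj _ \<i>", unfolded S m]
  note calc = wt_def cinj_def mk_def tw_def oct_simps
  have "a K1 = g K1 - b K1" using rel[of K1 K1 K1] by (simp add: calc) (simp add: field_simps)
  moreover have "a K2 = g K1 + b K2" using rel[of K2 K2 K2] by (simp add: calc) (simp add: field_simps)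
  moreover have "a K3 = g K1 + b K3" using rel[of K3 K3 K3] by (simp add: calc) (simp add: field_simps)
  moreover have "a K4 = b K4 - g K1" using rel[of K4 K4 K4] by (simp add: calc) (simp add: field_simps)
  moreover have "a K1 = g K2 - b K2" using rel[of K1 K1 K2] by (simp add: calc) (simp add: field_simps)
  moreover have "a K4 = g K2 + b K3" using rel[of K4 K4 K3] by (simp add: calc) (simp add: field_simps)
  moreover have "a K1 = g K3 - b K3" using rel[of K1 K1 K3] by (simp add: calc) (simp add: field_simps)
  moreover have "a K4 = g K4 - b K1" using rel[of K4 K4 K1] by (simp add: calc) (simp add: field_simps)
  ultimately have gb: "g k = ga a k" "b k = be a k" for k
    by (cases k; simp add: ga_def be_def)+
  have "X = Mop (tor r1 r2 r3 a)"
  proof (rule blinfun_eqI)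
    fix A
    obtain x y z p q s where A: "A = H3 x y z p q s" by (rule H3_cases)
    have "g = ga a" "b = be a" by (rule ext, rule gb)+
    then show "blinfun_apply X A = blinfun_apply (Mop (tor r1 r2 r3 a)) A"
      by (simp add: A X_H3 S m tor_def)
  qed
  then show ?thesis by (simp add: torusI)
qed

end

lemma gstar_eq_iff:
  "gstar octonion_space X = X \<longleftrightarrow> (\<forall>A B. inner (blinfun_apply X A) B = inner A (blinfun_apply X B))"
proof -
  have lin: "linear (blinfun_apply X)" by (rule bounded_linear.linear[OF blinfun.bounded_linear_right])
  have "bounded_linear (adjoint (blinfun_apply X))"
    using adjoint_linear[OF lin] by (simp add: linear_conv_bounded_linear)
  then have "gstar octonion_space X = X \<longleftrightarrow> adjoint (blinfun_apply X) = blinfun_apply X"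
    by (simp add: blinfun_apply_inject[symmetric] bounded_linear_Blinfun_apply)
  also have "\<dots> \<longleftrightarrow> (\<forall>A B. inner (blinfun_apply X A) B = inner A (blinfun_apply X B))"
  proof
    assume "adjoint (blinfun_apply X) = blinfun_apply X"
    then show "\<forall>A B. inner (blinfun_apply X A) B = inner A (blinfun_apply X B)"
      using adjoint_works[OF lin] by simp
  qed (rule adjoint_unique)
  finally show ?thesis .
qed

lemma torus_cartan_t: "torus \<inter> cartan_t octonion_space = split_torus"
proof (intro equalityI subsetI)
  fix X assume X: "X \<in> torus \<inter> cartan_t octonion_space"
  then obtain d1 d2 d3 t where t: "X = Mop (tor d1 d2 d3 t)" by (auto simp: torus_def)
  have sym: "inner (blinfun_apply X A) B = inner A (blinfun_apply X B)" for A B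
    using X gstar_eq_iff unfolding cartan_t_def by blast
  have "t k = 0" for k
    \<comment> \<open>A rotation is antisymmetric in the plane spanned by 1 and \<i> of one
      coordinate, so symmetry forces its angle to be 0.\<close>
    using sym[of "H3 0 0 0 (cinj k 1) 0 0" "H3 0 0 0 (cinj k \<i>) 0 0"]
    by (cases k) (simp_all add: t tor_def H3_inner inner_co co_cinj wt_def inner_complex_def del: co.simps)
  then have "t = (\<lambda>_. 0)" by (rule ext)
  then show "X \<in> split_torus" using t split_torusI by simp
next
  fix X assume X: "X \<in> split_torus"
  then obtain d1 d2 d3 where d: "X = Mop (tor d1 d2 d3 (\<lambda>_. 0))" by (auto simp: split_torus_def)
  have "inner (blinfun_apply X A) B = inner A (blinfun_apply X B)" for A B
    by (cases A rule: H3_cases; cases B rule: H3_cases) (simp add: d hprod_tor_split H3_inner)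
  then show "X \<in> torus \<inter> cartan_t octonion_space"
    using X split_torus_subset torus_lie_algebra gstar_eq_iff unfolding cartan_t_def by blast
qed

text \<open>Commuting with the single element \<open>tor 2 4 8\<close> forces the block form, and
  symmetry then leaves only scalars on the blocks.\<close>

lemma maximal_abelian_split_torus: "maximal_abelian_subspace octonion_space split_torus"
  unfolding maximal_abelian_subspace_def
proof (intro conjI allI impI)
  show "abelian_subspace octonion_space split_torus"
    unfolding abelian_subspace_def
    using subspace_torus(2) torus_cartan_t split_torus_subset bracket_torus by blast
  fix \<bb> assume "abelian_subspace octonion_space \<bb> \<and> split_torus \<subseteq> \<bb>"
  then have b: "split_torus \<subseteq> \<bb>" "\<bb> \<subseteq> cartan_t octonion_space"
    "\<And>X Y. X \<in> \<bb> \<Longrightarrow> Y \<in> \<bb> \<Longrightarrow> bracket octonion_space X Y = 0"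
    by (auto simp: abelian_subspace_def)
  have "X \<in> split_torus" if X: "X \<in> \<bb>" for X
  proof -
    have lie: "X \<in> lie_algebra octonion_space" and sym: "gstar octonion_space X = X"
      using X b(2) unfolding cartan_t_def by blast+
    have "bracket octonion_space X (Mop (tor 2 4 8 (\<lambda>_. 0))) = Mop 0"
      using b X split_torusI by (metis linear_0[OF linear_Mop] subsetD)
    then obtain r1 r2 r3 S12 S13 S23 where "peirce_operator X r1 r2 r3 S12 S13 S23"
      using lie_algebra_face_preserving[OF lie] by (rule peirce_operatorI)
    then interpret peirce_operator X r1 r2 r3 S12 S13 S23 .
    have "X = Mop (tor r1 r2 r3 (\<lambda>_. 0))"
      using sym gstar_eq_iff by (intro symmetric_imp_split) blast
    then show ?thesis using split_torusI by simp
  qed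
  with b(1) show "\<bb> = split_torus" by blast
qed

text \<open>Normalising a scaling with distinct eigenvalues gives the block form; normalising the
  phases turns the blocks into multipliers. Since \<open>ga\<close> and \<open>be\<close> are onto,
  every rotation is available on each of the three blocks.\<close>

lemma torus_self_normalizing:
  assumes lie: "X \<in> lie_algebra octonion_space"
    and norm: "\<And>Y. Y \<in> torus \<Longrightarrow> bracket octonion_space X Y \<in> torus"
  shows "X \<in> torus"
proof -
  have "bracket octonion_space X (Mop (tor 2 4 8 (\<lambda>_. 0))) \<in> torus" by (intro norm torusI)
  then obtain M where "bracket octonion_space X (Mop (tor 2 4 8 (\<lambda>_. 0))) = Mop M"
    unfolding torus_def by blast
  then obtain r1 r2 r3 S12 S13 S23 where "peirce_operator X r1 r2 r3 S12 S13 S23"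
    using lie_algebra_face_preserving[OF lie] by (rule peirce_operatorI)
  then interpret peirce_operator X r1 r2 r3 S12 S13 S23 .
  have comm: "\<exists>m1 m2 m3. \<forall>p. S12 (tw (wt 0 t) p) - tw (wt 0 t) (S12 p) = tw m1 p
      \<and> S13 (tw (wt 0 (ga t)) p) - tw (wt 0 (ga t)) (S13 p) = tw m2 p
      \<and> S23 (tw (wt 0 (be t)) p) - tw (wt 0 (be t)) (S23 p) = tw m3 p" for t
  proof -
    have "bracket octonion_space X (Mop (tor 0 0 0 t)) \<in> torus" by (intro norm torusI)
    then obtain M where M: "bracket octonion_space X (Mop (tor 0 0 0 t)) = Mop M"
      unfolding torus_def by blast
    obtain d1 d2 d3 m1 m2 m3 where H: "M = H3 d1 d2 d3 m1 m2 m3" by (rule H3_cases)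
    have eq: "blinfun_apply X (hprod (tor 0 0 0 t) v) - hprod (tor 0 0 0 t) (blinfun_apply X v) = hprod M v" for v
    proof -
      have "blinfun_apply (bracket octonion_space X (Mop (tor 0 0 0 t))) v = hprod M v"
        by (simp only: M Mop_apply)
      then show ?thesis by (simp add: bracket_def blinfun.diff_left)
    qed
    have "S12 (tw (wt 0 t) p) - tw (wt 0 t) (S12 p) = tw m1 p
      \<and> S13 (tw (wt 0 (ga t)) p) - tw (wt 0 (ga t)) (S13 p) = tw m2 p
      \<and> S23 (tw (wt 0 (be t)) p) - tw (wt 0 (be t)) (S23 p) = tw m3 p" for p
      using eq[of "H3 0 0 0 p p p"] by (simp add: tor_def X_H3 H3_diff H)
    then show ?thesis by blast
  qed
  obtain n1 where n1: "S12 = tw n1"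
    by (rule multiplier_if_normalizes[OF linear_S(1)]) (use comm in blast)
  obtain n2 where n2: "S13 = tw n2"
  proof (rule multiplier_if_normalizes[OF linear_S(2)])
    fix t obtain s where "ga s = t" using be_ga_surj(2) by blast
    then show "\<exists>M. \<forall>p. S13 (tw (wt 0 t) p) - tw (wt 0 t) (S13 p) = tw M p" using comm[of s] by blast
  qed
  obtain n3 where n3: "S23 = tw n3"
  proof (rule multiplier_if_normalizes[OF linear_S(3)])
    fix t obtain s where "be s = t" using be_ga_surj(1) by blast
    then show "\<exists>M. \<forall>p. S23 (tw (wt 0 t) p) - tw (wt 0 t) (S23 p) = tw M p" using comm[of s] by blast
  qed
  show ?thesis by (rule multipliers_imp_torus[OF n1 n2 n3])
qed

lemma cartan_subalgebra_torus: "cartan_subalgebra octonion_space torus"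
  unfolding cartan_subalgebra_def
proof (intro conjI ballI impI)
  have "lower_central octonion_space torus (Suc 0) = {0}"
  proof -
    have "{bracket octonion_space X Y | X Y. X \<in> torus \<and> Y \<in> torus} \<subseteq> {0}"
      using bracket_torus by auto
    from span_mono[OF this] show ?thesis using span_zero by (auto simp: subset_singleton_iff)
  qed
  then show "\<exists>n. lower_central octonion_space torus n = {0}" ..
  show "X \<in> torus" if "X \<in> lie_algebra octonion_space" "\<forall>Y\<in>torus. bracket octonion_space X Y \<in> torus" for X
    by (rule torus_self_normalizing[OF that(1)]) (use that(2) in blast)
qed (simp_all only: subspace_torus torus_lie_algebra bracket_torus subspace_0[OF subspace_torus(1)])

lemma exp_orbit_torus:
  "exp_orbit octonion_space torus = {H3 a b c 0 0 0 | a b c. a > 0 \<and> b > 0 \<and> c > 0}"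
  "exp_orbit octonion_space split_torus = {H3 a b c 0 0 0 | a b c. a > 0 \<and> b > 0 \<and> c > 0}"
proof -
  have act: "act octonion_space (gexp octonion_space (Mop (tor d1 d2 d3 t))) (base octonion_space)
      = H3 (exp d1) (exp d2) (exp d3) 0 0 0" for d1 d2 d3 t
  proof -
    have "(exp (d / 2))\<^sup>2 = exp d" for d :: real by (simp add: power2_eq_square flip: exp_add)
    then show ?thesis unfolding gexp_tor by (simp add: gel_def tw_algebra(8))
  qed
  let ?M = "{H3 a b c 0 0 0 | a b c. a > 0 \<and> b > 0 \<and> c > 0}"
  have "exp_orbit octonion_space torus \<subseteq> ?M"
  proof
    fix x assume "x \<in> exp_orbit octonion_space torus"
    then obtain d1 d2 d3 t where
      "x = act octonion_space (gexp octonion_space (Mop (tor d1 d2 d3 t))) (base octonion_space)"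
      unfolding exp_orbit_def torus_def by blast
    then show "x \<in> ?M" unfolding act by auto
  qed
  moreover have "?M \<subseteq> exp_orbit octonion_space split_torus"
  proof
    fix x assume "x \<in> ?M"
    then obtain a b c where "x = H3 a b c 0 0 0" "a > 0" "b > 0" "c > 0" by blast
    then have "x = act octonion_space (gexp octonion_space (Mop (tor (ln a) (ln b) (ln c) (\<lambda>_. 0)))) (base octonion_space)"
      unfolding act by simp
    then show "x \<in> exp_orbit octonion_space split_torus"
      unfolding exp_orbit_def using split_torusI by blast
  qed
  moreover have "exp_orbit octonion_space split_torus \<subseteq> exp_orbit octonion_space torus"
    using split_torus_subset unfolding exp_orbit_def by blast
  ultimately show "exp_orbit octonion_space torus = ?M" "exp_orbit octonion_space split_torus = ?M" by blast+
qed

lemma adapted_cartan_subalgebra_torus: "adapted_cartan_subalgebra octonion_space torus"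
  unfolding adapted_cartan_subalgebra_def torus_cartan_t exp_orbit_torus
  using cartan_subalgebra_torus maximal_abelian_split_torus by blast

section \<open>Sign changes of the octonionic cone and the conclusion\<close>

definition oct_flips :: "((octonion, 3) herm \<Rightarrow> (octonion, 3) herm) set" where
  "oct_flips = {hprod (gel (- 1) 1 1 (\<lambda>_. 0)), hprod (gel 1 (- 1) 1 (\<lambda>_. 0))}"

text \<open>Between them the two maps negate each off-diagonal entry, and the sign change of the
  third coordinate is their product, so two generators suffice.\<close>

lemma oct_flips_H3:
  "hprod (gel (- 1) 1 1 (\<lambda>_. 0)) (H3 a b c p q s) = H3 a b c (- p) (- q) s"
  "hprod (gel 1 (- 1) 1 (\<lambda>_. 0)) (H3 a b c p q s) = H3 a b c (- p) q (- s)"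
proof -
  have "ph (\<lambda>_. 0) = mk (\<lambda>_. 1)" by (simp add: ph_def)
  moreover have "tw (- m) x = - tw m x" for m x by (rule oct_eqI) simp
  ultimately show "hprod (gel (- 1) 1 1 (\<lambda>_. 0)) (H3 a b c p q s) = H3 a b c (- p) (- q) s"
    "hprod (gel 1 (- 1) 1 (\<lambda>_. 0)) (H3 a b c p q s) = H3 a b c (- p) q (- s)"
    by (simp_all add: gel_def be_ga_linear tw_algebra(7))
qed

lemma exp_orbit_torus_fixed:
  "exp_orbit octonion_space torus = posdef_oct \<inter> {A. \<forall>g\<in>oct_flips. g A = A}"
  unfolding exp_orbit_torus
proof (intro equalityI subsetI)
  fix A assume "A \<in> {H3 a b c 0 0 0 | a b c. a > 0 \<and> b > 0 \<and> c > 0}"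
  then obtain a b c where A: "A = H3 a b c 0 0 0" "a > 0" "b > 0" "c > 0" by blast
  \<comment> \<open>Square roots appear because \<open>gel\<close> squares its parameters on the
    diagonal; the point is thus moved from the base point by a cone automorphism.\<close>
  have "A = hprod (gel (sqrt a) (sqrt b) (sqrt c) (\<lambda>_. 0)) (H3 1 1 1 0 0 0)"
    using A by (simp add: gel_def tw_algebra(8))
  also have "\<dots> \<in> posdef_oct" using A by (intro gel_cone one_posdef_oct) auto
  finally have "A \<in> posdef_oct" .
  then show "A \<in> posdef_oct \<inter> {A. \<forall>g\<in>oct_flips. g A = A}" by (simp add: A(1) oct_flips_def oct_flips_H3)
next
  fix A assume A: "A \<in> posdef_oct \<inter> {A. \<forall>g\<in>oct_flips. g A = A}"
  obtain a b c p q s where H: "A = H3 a b c p q s" by (rule H3_cases)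
  have neg: "- x = x \<Longrightarrow> x = 0" for x :: octonion by (metis add.left_inverse scaleR_2 scaleR_eq_0_iff zero_neq_numeral)
  have "- p = p" "- q = q" "- s = s" using A by (simp_all add: H oct_flips_def oct_flips_H3)
  then have H0: "A = H3 a b c 0 0 0" using neg H by simp
  have "inner A (R1 1 0 0) > 0" "inner A (R2 0 1 0) > 0" "inner A (R3 0 0 1) > 0"
    using A by (simp_all add: posdef_oct_rank_one R_eq_zero_iff)
  then have "a > 0" "b > 0" "c > 0"
    by (simp_all add: H0 R1_def R2_def R3_def H3_inner)
  then show "A \<in> {H3 a b c 0 0 0 | a b c. a > 0 \<and> b > 0 \<and> c > 0}" using H0 by blast
qed

theorem totally_geodesic_exp_torus:
  assumes "invariant_metric octonion_space m"
  shows "\<exists>\<aa>. adapted_cartan_subalgebra octonion_space \<aa> \<and>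
    totally_geodesic_submanifold posdef_oct m (exp_orbit octonion_space \<aa>)"
proof (intro exI conjI)
  interpret riemannian posdef_oct m
    using assms open_posdef_oct by unfold_locales (simp_all add: invariant_metric_def)
  have inv: "m (hprod (gel r1 r2 r3 t) p) (hprod (gel r1 r2 r3 t) u) (hprod (gel r1 r2 r3 t) v) = m p u v"
    if "r1 \<noteq> 0" "r2 \<noteq> 0" "r3 \<noteq> 0" "p \<in> posdef_oct" for r1 r2 r3 t p u v
  proof -
    have "m (blinfun_apply g p) (blinfun_apply g u) (blinfun_apply g v) = m p u v" if "g \<in> grp octonion_space" for g
      using assms that \<open>p \<in> posdef_oct\<close> unfolding invariant_metric_def octonion_space_simps(5,6) by blast
    from this[OF gel_grp[OF that(1-3)]] show ?thesis by (simp only: Mop_apply)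
  qed
  have "totally_geodesic_submanifold posdef_oct m (posdef_oct \<inter> {A. \<forall>g\<in>oct_flips. g A = A})"
  proof (rule totally_geodesic_fixed_points)
    show "linear g" if "g \<in> oct_flips" for g
      using that by (auto simp: oct_flips_def hprod_algebra intro!: linearI)
    show "g (g x) = x" if "g \<in> oct_flips" for g x
      using that by (cases x rule: H3_cases) (auto simp: oct_flips_def oct_flips_H3)
  qed (auto simp: oct_flips_def intro: gel_cone inv)
  then show "totally_geodesic_submanifold posdef_oct m (exp_orbit octonion_space torus)"
    unfolding exp_orbit_torus_fixed .
qed (rule adapted_cartan_subalgebra_torus)

theorem proposition6p5p1:
  shows "(\<forall>m. invariant_metric (matrix_space :: (real^'n^'n, (real, 'n::finite) herm) cone_space) m \<longrightarrow>
            (\<exists>\<aa>. adapted_cartan_subalgebra matrix_space \<aa> \<and>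
              totally_geodesic_submanifold posdef m (exp_orbit matrix_space \<aa>)))
       \<and> (\<forall>m. invariant_metric (matrix_space :: (complex^'n^'n, (complex, 'n::finite) herm) cone_space) m \<longrightarrow>
            (\<exists>\<aa>. adapted_cartan_subalgebra matrix_space \<aa> \<and>
              totally_geodesic_submanifold posdef m (exp_orbit matrix_space \<aa>)))
       \<and> (\<forall>m. invariant_metric (matrix_space :: (quaternion^'n^'n, (quaternion, 'n::finite) herm) cone_space) m \<longrightarrow>
            (\<exists>\<aa>. adapted_cartan_subalgebra matrix_space \<aa> \<and>
              totally_geodesic_submanifold posdef m (exp_orbit matrix_space \<aa>)))
       \<and> (\<forall>m. invariant_metric octonion_space m \<longrightarrow>
            (\<exists>\<aa>. adapted_cartan_subalgebra octonion_space \<aa> \<and>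
              totally_geodesic_submanifold posdef_oct m (exp_orbit octonion_space \<aa>)))"
  using real_torus.totally_geodesic_exp_diagonals complex_torus.totally_geodesic_exp_diagonals
    quaternion_torus.totally_geodesic_exp_diagonals totally_geodesic_exp_torus
  by blast

end
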